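(* Let $G=(V,E)$ be an infinite connected graph with bounded degrees, and consider the edge-averaging process $(f_t)_{t\ge0}$ on $G$. Suppose that for some $p>4$ the i.i.d.\ initial opinions $\{f_0(v)\}_{v\in V}$ are in $L^p$, and let $\mu:=\mathbb{E}[f_0(v)]$. Then for every $v\in V$, $\lim_{t\to\infty}f_t(v)=\mu$ almost surely.
   Context: Edge-averaging process: each vertex $v\in V$ carries an opinion $f_t(v)\in\mathbb R$ at each time $t\ge 0$. Each edge carries an independent rate-one Poisson clock (clocks independent of the initial opinions). When the clock of edge $\{u,v\}$ rings at time $t$, both endpoints update to $f_t(u)=f_t(v)=\frac{f_{t-}(u)+f_{t-}(v)}{2}$, where $f_{t-}(u)=\lim_{s\uparrow t}f_s(u)$; other opinions are unchanged. *)

theory Defs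
  imports "HOL-Probability.Probability"
begin

definition simple_graph :: "('v \<Rightarrow> 'v \<Rightarrow> bool) \<Rightarrow> bool" where
  "simple_graph adj \<longleftrightarrow> (\<forall>u v. adj u v = adj v u) \<and> (\<forall>v. \<not> adj v v)"

definition graph_connected :: "('v \<Rightarrow> 'v \<Rightarrow> bool) \<Rightarrow> bool" where
  "graph_connected adj \<longleftrightarrow> (\<forall>u v. adj\<^sup>*\<^sup>* u v)"

definition bounded_degree :: "('v \<Rightarrow> 'v \<Rightarrow> bool) \<Rightarrow> bool" where
  "bounded_degree adj \<longleftrightarrow> (\<exists>D::nat. \<forall>v. finite {u. adj v u} \<and> card {u. adj v u} \<le> D)"

definition edges :: "('v \<Rightarrow> 'v \<Rightarrow> bool) \<Rightarrow> 'v set set" where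
  "edges adj = {{u, v} | u v. adj u v}"

text \<open>Poisson clock of edge e: i.i.d. Exp(1) inter-arrival times tau e k (k = 0,1,...);
  the n-th ring (n = 0,1,...) happens at time tau e 0 + ... + tau e n.\<close>

definition ring_time :: "('e \<Rightarrow> nat \<Rightarrow> 'a \<Rightarrow> real) \<Rightarrow> 'e \<Rightarrow> nat \<Rightarrow> 'a \<Rightarrow> real" where
  "ring_time \<tau> e n \<omega> = (\<Sum>k\<le>n. \<tau> e k \<omega>)"

definition rings_at :: "('e \<Rightarrow> nat \<Rightarrow> 'a \<Rightarrow> real) \<Rightarrow> 'e \<Rightarrow> 'a \<Rightarrow> real \<Rightarrow> bool" where
  "rings_at \<tau> e \<omega> t \<longleftrightarrow> (\<exists>n. ring_time \<tau> e n \<omega> = t)"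

definition edge_averaging ::
  "('v \<Rightarrow> 'v \<Rightarrow> bool) \<Rightarrow> ('v set \<Rightarrow> nat \<Rightarrow> 'a \<Rightarrow> real) \<Rightarrow> (real \<Rightarrow> 'v \<Rightarrow> 'a \<Rightarrow> real) \<Rightarrow> 'a \<Rightarrow> bool"
where
  "edge_averaging adj \<tau> f \<omega> \<longleftrightarrow>
     (\<forall>v s t. 0 \<le> s \<and> s \<le> t \<and>
         (\<forall>u r. adj v u \<and> rings_at \<tau> {v, u} \<omega> r \<longrightarrow> \<not> (s < r \<and> r \<le> t))
       \<longrightarrow> f t v \<omega> = f s v \<omega>)
   \<and> (\<forall>u v t. adj u v \<and> 0 < t \<and> rings_at \<tau> {u, v} \<omega> t \<longrightarrow>
         f t v \<omega> = (Lim (at_left t) (\<lambda>s. f s u \<omega>) + Lim (at_left t) (\<lambda>s. f s v \<omega>)) / 2)"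

end

theory Submission
  imports Defs "HOL-Real_Asymp.Real_Asymp"
begin

text \<open>
  Fix a vertex \<open>v\<close> and cut the time interval \<open>[0, n + 1]\<close> into small cells. By the memoryless property, the
  edges of a large ball around \<open>v\<close> ring in the cells independently, so the word formed by the sets of
  edges that ring in the successive cells has i.i.d. letters. Up to events of small probability no two
  edges ring in the same cell, and \<open>f t v\<close> depends only on the initial opinions in the ball. Then
  \<open>f t v = (\<Sum>w. g w * f 0 w)\<close>, where \<open>g\<close> arises from the unit mass at \<open>v\<close> by averaging along the reversed
  word; and the reversed word has the same law. While \<open>(\<Sum>w. (g w)\<^sup>2) \<ge> s\<close>, a Nash-type inequality makes
  this quantity decay at rate of order \<open>s\<^sup>2\<close>, so it is below \<open>s = n powr (- (1 - \<delta>) / 2)\<close> at time \<open>n\<close> with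
  overwhelming probability. Given the clocks, the \<open>p\<close>-th moment of \<open>f t v - \<mu>\<close> is then
  \<open>O(s powr (p / 2))\<close>, which is summable over \<open>n\<close> since \<open>p > 4\<close>. The supremum over \<open>t \<in> [n, n + 1]\<close> costs only a
  constant factor, because after a large deviation \<open>v\<close> stays untouched until time \<open>n + 1\<close> with
  probability bounded below. Borel-Cantelli concludes.
\<close>

section \<open>Weighted sums over words\<close>

text \<open>The decay rate of order \<open>s\<^sup>2\<close> comes from a single path in the graph,
  so it is the one-dimensional rate. It takes effect once \<open>n * s\<^sup>2\<close> is large,
  which forces \<open>s\<close> slightly above \<open>n powr (- 1 / 2)\<close>; then
  \<open>s powr (p / 2)\<close> is nearly \<open>n powr (- p / 4)\<close>. This is the origin of the
  exponent 4, and \<delta> takes up the slack. Duality reads the clocks backwards. For paths in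
  continuous time on an infinite graph this is delicate, whereas for i.i.d. letters it is a symmetry
  of a finite sum; hence the discretisation. The cell size is chosen after the ball: a collision in
  one cell has probability quadratic in the cell size while the number of cells is only inversely
  proportional to it, so refinement makes collisions negligible for any finite set of edges.
  Measurability is given for \<open>f 0\<close> but not for later times. Hence every probability is
  estimated for an event expressed by the ring word and the initial opinions, and the dynamics
  enters through a deterministic statement about single paths.\<close>

definition words :: "'z set \<Rightarrow> nat \<Rightarrow> 'z list set" where
  "words Z k = {zs. set zs \<subseteq> Z \<and> length zs = k}"

text \<open>For a probability vector \<pi> this is the expectation of \<open>F\<close> over words of
  \<open>k\<close> i.i.d. letters. As it is a finite sum, splitting off the first letter and
  reversing the word are mere reindexings.\<close>

definition word_sum :: "'z set \<Rightarrow> ('z \<Rightarrow> real) \<Rightarrow> nat \<Rightarrow> ('z list \<Rightarrow> real) \<Rightarrow> real" where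
  "word_sum Z \<pi> k F = (\<Sum>zs\<in>words Z k. prod_list (map \<pi> zs) * F zs)"

lemma finite_words: "finite Z \<Longrightarrow> finite (words Z k)"
  unfolding words_def by (rule finite_lists_length_eq)

lemma words_0 [simp]: "words Z 0 = {[]}"
  by (auto simp: words_def)

lemma words_Suc: "words Z (Suc k) = (\<lambda>(z, zs). z # zs) ` (Z \<times> words Z k)"
  by (force simp: words_def length_Suc_conv image_iff)

lemma word_sum_0 [simp]: "word_sum Z \<pi> 0 F = F []"
  by (simp add: word_sum_def)

lemma word_sum_Suc:
  "word_sum Z \<pi> (Suc k) F = (\<Sum>z\<in>Z. \<pi> z * word_sum Z \<pi> k (\<lambda>zs. F (z # zs)))"
proof -
  have inj: "inj_on (\<lambda>(z, zs). z # zs) (Z \<times> words Z k)"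
    by (auto simp: inj_on_def)
  show ?thesis
    unfolding word_sum_def words_Suc sum.reindex[OF inj]
    by (simp add: sum.cartesian_product sum_distrib_left mult.assoc case_prod_unfold)
qed

text \<open>The weight of a word is a product over its letters, so reversal preserves it. This is
  the form in which time reversal of the clocks is used.\<close>

lemma word_sum_rev: "word_sum Z \<pi> k (\<lambda>zs. F (rev zs)) = word_sum Z \<pi> k F"
  unfolding word_sum_def
  by (rule sum.reindex_bij_witness[of _ rev rev])
     (auto simp: words_def rev_map[symmetric] prod_list.rev)

lemma word_sum_cmult: "word_sum Z \<pi> k (\<lambda>zs. c * F zs) = c * word_sum Z \<pi> k F"
  by (simp add: word_sum_def sum_distrib_left mult_ac)

lemma word_sum_add: "word_sum Z \<pi> k (\<lambda>zs. F zs + G zs) = word_sum Z \<pi> k F + word_sum Z \<pi> k G"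
  by (simp add: word_sum_def sum.distrib distrib_left)

locale weights =
  fixes Z :: "'z set" and \<pi> :: "'z \<Rightarrow> real"
  assumes fin: "finite Z" and nonneg: "z \<in> Z \<Longrightarrow> 0 \<le> \<pi> z" and total: "sum \<pi> Z = 1"
begin

lemma prod_list_nonneg: "zs \<in> words Z k \<Longrightarrow> 0 \<le> prod_list (map \<pi> zs)"
  by (induction zs arbitrary: k) (auto simp: words_def nonneg)

lemma word_sum_mono:
  assumes "\<And>zs. zs \<in> words Z k \<Longrightarrow> F zs \<le> G zs"
  shows "word_sum Z \<pi> k F \<le> word_sum Z \<pi> k G"
  unfolding word_sum_def by (intro sum_mono mult_left_mono assms prod_list_nonneg)

lemma word_sum_const [simp]: "word_sum Z \<pi> k (\<lambda>_. c) = c"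
  by (induction k) (simp_all add: word_sum_Suc total flip: sum_distrib_right)

text \<open>A one-step bound on the mean of \<Phi>, iterated along the random word.
  \<open>Inv\<close> carries the property under which the one-step bound is known. The factor
  \<open>r\<close> may lie on either side of 1: below it for the decay of the spread, above it for
  the growth of influence sets.\<close>

lemma word_sum_drift:
  assumes drift: "\<And>s. Inv s \<Longrightarrow> (\<Sum>z\<in>Z. \<pi> z * \<Phi> (step z s)) \<le> r * \<Phi> s"
    and inv: "\<And>s z. Inv s \<Longrightarrow> z \<in> Z \<Longrightarrow> Inv (step z s)"
    and r: "0 \<le> r" and s: "Inv s"
  shows "word_sum Z \<pi> k (\<lambda>zs. \<Phi> (fold step zs s)) \<le> r ^ k * \<Phi> s"
  using s
proof (induction k arbitrary: s)
  case (Suc k)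
  have "word_sum Z \<pi> (Suc k) (\<lambda>zs. \<Phi> (fold step zs s))
      = (\<Sum>z\<in>Z. \<pi> z * word_sum Z \<pi> k (\<lambda>zs. \<Phi> (fold step zs (step z s))))"
    by (simp add: word_sum_Suc)
  also have "\<dots> \<le> (\<Sum>z\<in>Z. \<pi> z * (r ^ k * \<Phi> (step z s)))"
    by (intro sum_mono mult_left_mono Suc.IH inv Suc.prems nonneg)
  also have "\<dots> = r ^ k * (\<Sum>z\<in>Z. \<pi> z * \<Phi> (step z s))"
    by (simp add: sum_distrib_left mult_ac)
  also have "\<dots> \<le> r ^ k * (r * \<Phi> s)"
    by (intro mult_left_mono drift Suc.prems) (simp add: r)
  finally show ?case by (simp add: mult_ac)
qed simp

lemma word_sum_exists:
  "word_sum Z \<pi> k (\<lambda>zs. of_bool (\<exists>z\<in>set zs. P z)) \<le> k * (\<Sum>z\<in>Z. \<pi> z * of_bool (P z))"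
proof (induction k)
  case (Suc k)
  have "word_sum Z \<pi> (Suc k) (\<lambda>zs. of_bool (\<exists>z\<in>set zs. P z))
     \<le> (\<Sum>z\<in>Z. \<pi> z * word_sum Z \<pi> k (\<lambda>zs. of_bool (P z) + of_bool (\<exists>z\<in>set zs. P z)))"
    unfolding word_sum_Suc by (intro sum_mono mult_left_mono word_sum_mono nonneg) auto
  also have "\<dots> = (\<Sum>z\<in>Z. \<pi> z * of_bool (P z)) + word_sum Z \<pi> k (\<lambda>zs. of_bool (\<exists>z\<in>set zs. P z))"
    by (simp add: word_sum_add distrib_left sum.distrib total flip: sum_distrib_right)
  finally show ?case using Suc by (simp add: algebra_simps)
qed simp

text \<open>Once the bad event has occurred, it survives as long as only quiet letters follow.\<close>

lemma word_sum_maximal: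
  assumes Q: "Q \<subseteq> Z" and c: "0 \<le> c" "c \<le> sum \<pi> Q"
    and quiet: "\<And>z s. z \<in> Q \<Longrightarrow> bad s \<Longrightarrow> bad (step z s)"
  shows "c ^ k * word_sum Z \<pi> (m + k) (\<lambda>zs. of_bool (\<exists>j\<in>{m..m + k}. bad (fold step (take j zs) s)))
     \<le> word_sum Z \<pi> (m + k) (\<lambda>zs. of_bool (bad (fold step zs s)))"
proof (induction m arbitrary: s)
  case 0
  show ?case
  \<comment> \<open>Here the window opens at once. From a bad state, \<open>k\<close> quiet letters
    suffice, which costs \<open>c ^ k\<close>; from a good one the first letter is consumed and one
    factor \<open>c \<le> 1\<close> is given away.\<close>
  proof (induction k arbitrary: s)
    case (Suc k)
    let ?V = "\<lambda>k s. word_sum Z \<pi> k (\<lambda>zs. of_bool (\<exists>j\<in>{0..k}. bad (fold step (take j zs) s)))"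
    let ?U = "\<lambda>k s. word_sum Z \<pi> k (\<lambda>zs. of_bool (bad (fold step zs s)))"
    have c1: "c \<le> 1"
    proof -
      have "sum \<pi> Q \<le> sum \<pi> Z" by (intro sum_mono2 fin Q nonneg) auto
      thus ?thesis using c total by simp
    qed
    have Upos: "0 \<le> ?U k s" for k s
      using word_sum_mono[of k "\<lambda>_. 0" "\<lambda>zs. of_bool (bad (fold step zs s))"] by simp
    have Ubad: "c ^ k \<le> ?U k s" if "bad s" for k s
      using that
    proof (induction k arbitrary: s)
      case (Suc k)
      have "c ^ Suc k \<le> (\<Sum>z\<in>Q. \<pi> z) * c ^ k"
        using c by (auto intro!: mult_right_mono)
      also have "\<dots> \<le> (\<Sum>z\<in>Q. \<pi> z * ?U k (step z s))"
        unfolding sum_distrib_right using Q Suc quiet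
        by (intro sum_mono mult_left_mono nonneg) auto
      also have "\<dots> \<le> (\<Sum>z\<in>Z. \<pi> z * ?U k (step z s))"
        using Q fin by (intro sum_mono2 mult_nonneg_nonneg nonneg Upos) auto
      finally show ?case by (simp add: word_sum_Suc)
    qed simp
    show ?case
    proof (cases "bad s")
      case True
      have "?V (Suc k) s \<le> 1"
        using word_sum_mono[of "Suc k" "\<lambda>zs. of_bool (\<exists>j\<in>{0..Suc k}. bad (fold step (take j zs) s))" "\<lambda>_. 1"]
        by simp
      hence "c ^ Suc k * ?V (Suc k) s \<le> c ^ Suc k * 1"
        by (intro mult_left_mono) (simp_all add: c)
      thus ?thesis using Ubad[OF True, of "Suc k"] by simp
    next
      case False
      have "(\<exists>j\<in>{0..Suc k}. bad (fold step (take j (z # zs)) s)) \<longleftrightarrow>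
        (\<exists>j\<in>{0..k}. bad (fold step (take j zs) (step z s)))" for z zs
      proof
        assume "\<exists>j\<in>{0..Suc k}. bad (fold step (take j (z # zs)) s)"
        then obtain j where "j \<le> Suc k" "bad (fold step (take j (z # zs)) s)" by auto
        thus "\<exists>j\<in>{0..k}. bad (fold step (take j zs) (step z s))"
          using False by (cases j) auto
      next
        assume "\<exists>j\<in>{0..k}. bad (fold step (take j zs) (step z s))"
        then obtain j where "j \<le> k" "bad (fold step (take j zs) (step z s))" by auto
        thus "\<exists>j\<in>{0..Suc k}. bad (fold step (take j (z # zs)) s)"
          by (intro bexI[of _ "Suc j"]) auto
      qed
      hence "?V (Suc k) s = (\<Sum>z\<in>Z. \<pi> z * ?V k (step z s))"
        by (simp add: word_sum_Suc)
      hence "c ^ Suc k * ?V (Suc k) s = c * (\<Sum>z\<in>Z. \<pi> z * (c ^ k * ?V k (step z s)))"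
        by (simp add: sum_distrib_left mult_ac)
      also have "\<dots> \<le> c * (\<Sum>z\<in>Z. \<pi> z * ?U k (step z s))"
        using Suc c by (intro mult_left_mono sum_mono nonneg) auto
      also have "\<dots> \<le> 1 * (\<Sum>z\<in>Z. \<pi> z * ?U k (step z s))"
        using c1 by (intro mult_right_mono sum_nonneg mult_nonneg_nonneg nonneg Upos) auto
      finally show ?thesis by (simp add: word_sum_Suc)
    qed
  qed simp
next
  case (Suc m)
  have "(\<exists>j\<in>{Suc m..Suc (m + k)}. bad (fold step (take j (z # zs)) s)) \<longleftrightarrow>
    (\<exists>j\<in>{m..m + k}. bad (fold step (take j zs) (step z s)))" for z zs
    unfolding image_Suc_atLeastAtMost[symmetric] by (auto simp del: image_Suc_atLeastAtMost)
  hence "c ^ k * word_sum Z \<pi> (Suc m + k) (\<lambda>zs. of_bool (\<exists>j\<in>{Suc m..Suc m + k}. bad (fold step (take j zs) s)))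
    = (\<Sum>z\<in>Z. \<pi> z * (c ^ k * word_sum Z \<pi> (m + k)
        (\<lambda>zs. of_bool (\<exists>j\<in>{m..m + k}. bad (fold step (take j zs) (step z s))))))"
    by (simp add: word_sum_Suc sum_distrib_left mult_ac)
  also have "\<dots> \<le> (\<Sum>z\<in>Z. \<pi> z * word_sum Z \<pi> (m + k) (\<lambda>zs. of_bool (bad (fold step zs (step z s)))))"
    by (intro sum_mono mult_left_mono Suc nonneg)
  finally show ?case by (simp add: word_sum_Suc)
qed

end

section \<open>Moments of weighted sums of independent variables\<close>

lemma exp_le_quadratic:
  fixes y c :: real
  assumes "\<bar>y\<bar> \<le> c"
  shows "exp y \<le> 1 + y + exp c * y\<^sup>2"
proof -
  obtain t where t: "\<bar>t\<bar> \<le> \<bar>y\<bar>" "exp y = (\<Sum>m<2. y ^ m / fact m) + exp t / fact 2 * y ^ 2"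
    using Maclaurin_exp_le[of y 2] by blast
  have "exp t / fact 2 \<le> exp t" by simp
  also have "\<dots> \<le> exp c" using t(1) assms by simp
  finally have "exp t / fact 2 * y ^ 2 \<le> exp c * y ^ 2" by (rule mult_right_mono) simp
  thus ?thesis using t(2) by (simp add: numeral_2_eq_2)
qed

text \<open>For \<open>|x| \<le> 1 / 2\<close> this is the second-order Taylor bound for
  \<open>exp (p * x)\<close>, which dominates the left side. For larger \<open>|x|\<close> one has
  \<open>|1 + x| \<le> 3 * |x|\<close>, and the linear term, if negative, is absorbed by the
  quadratic one.\<close>

lemma abs_one_plus_powr_le:
  fixes p x :: real
  assumes p: "2 \<le> p"
  shows "\<bar>1 + x\<bar> powr p \<le> 1 + p * x + (3 powr p + p\<^sup>2 * exp p) * (x\<^sup>2 + \<bar>x\<bar> powr p)"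
    (is "_ \<le> _ + ?C * _")
proof (cases "\<bar>x\<bar> \<le> 1 / 2")
  case True
  have "\<bar>1 + x\<bar> powr p = exp (p * ln (1 + x))"
    using True by (simp add: powr_def)
  also have "\<dots> \<le> exp (p * x)"
    using True p ln_add_one_self_le_self2[of x] by simp
  also have "\<dots> \<le> 1 + p * x + exp p * (p * x)\<^sup>2"
  proof (rule exp_le_quadratic)
    have "\<bar>p * x\<bar> = p * \<bar>x\<bar>" using p by (simp add: abs_mult)
    also have "\<dots> \<le> p * 1" using p True by (intro mult_left_mono) auto
    finally show "\<bar>p * x\<bar> \<le> p" by simp
  qed
  also have "exp p * (p * x)\<^sup>2 \<le> ?C * (x\<^sup>2 + \<bar>x\<bar> powr p)"
  proof -
    have "exp p * (p * x)\<^sup>2 = (p\<^sup>2 * exp p) * x\<^sup>2" by (simp add: power_mult_distrib)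
    also have "\<dots> \<le> ?C * (x\<^sup>2 + \<bar>x\<bar> powr p)" by (intro mult_mono) auto
    finally show ?thesis .
  qed
  finally show ?thesis by simp
next
  case False
  have "\<bar>1 + x\<bar> powr p \<le> (3 * \<bar>x\<bar>) powr p"
    using False p by (intro powr_mono2) auto
  also have "\<dots> = 3 powr p * \<bar>x\<bar> powr p" by (simp add: powr_mult)
  finally have 1: "\<bar>1 + x\<bar> powr p \<le> 3 powr p * \<bar>x\<bar> powr p" .
  have "- x \<le> 2 * x\<^sup>2"
  proof -
    have "- x \<le> \<bar>x\<bar> * 1" by simp
    also have "\<dots> \<le> \<bar>x\<bar> * (2 * \<bar>x\<bar>)" using False by (intro mult_left_mono) auto
    also have "\<dots> = 2 * x\<^sup>2" by (simp add: power2_eq_square)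
    finally show ?thesis .
  qed
  hence "p * (- x) \<le> p * (2 * x\<^sup>2)" using p by (intro mult_left_mono) auto
  also have "\<dots> \<le> (p\<^sup>2 * exp p) * x\<^sup>2"
  proof -
    have "p * 2 \<le> p * p" using p by (intro mult_left_mono) auto
    also have "\<dots> \<le> p\<^sup>2 * exp p" using p mult_left_mono[of 1 "exp p" "p\<^sup>2"] by (simp add: power2_eq_square)
    finally have "p * 2 * x\<^sup>2 \<le> p\<^sup>2 * exp p * x\<^sup>2" by (rule mult_right_mono) simp
    thus ?thesis by (simp add: mult_ac)
  qed
  finally have 2: "- (p * x) \<le> (p\<^sup>2 * exp p) * x\<^sup>2" by simp
  have "0 \<le> 3 powr p * x\<^sup>2" "0 \<le> p\<^sup>2 * exp p * \<bar>x\<bar> powr p" by auto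
  with 1 2 show ?thesis unfolding distrib_left distrib_right by linarith
qed

text \<open>Homogeneity: the previous bound at \<open>b / a\<close>, multiplied by
  \<open>|a| powr p\<close>. The coefficient of the linear term is exact, since that term must
  cancel in the mean rather than be estimated.\<close>

lemma abs_add_powr_le:
  fixes p a b :: real
  assumes p: "2 < p"
  shows "\<bar>a + b\<bar> powr p \<le> \<bar>a\<bar> powr p + p * sgn a * \<bar>a\<bar> powr (p - 1) * b
    + (3 powr p + p\<^sup>2 * exp p) * (\<bar>a\<bar> powr (p - 2) * b\<^sup>2 + \<bar>b\<bar> powr p)"
proof (cases "a = 0")
  case True
  have "1 \<le> (3::real) powr p" using p by (intro ge_one_powr_ge_zero) auto
  hence "1 * \<bar>b\<bar> powr p \<le> (3 powr p + p\<^sup>2 * exp p) * \<bar>b\<bar> powr p"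
    by (intro mult_right_mono) (auto simp: add_increasing2)
  thus ?thesis using True p by simp
next
  case False
  let ?C = "3 powr p + p\<^sup>2 * exp p"
  have eq: "\<bar>a\<bar> powr p * (b / a) = sgn a * \<bar>a\<bar> powr (p - 1) * b"
    "\<bar>a\<bar> powr p * (b / a)\<^sup>2 = \<bar>a\<bar> powr (p - 2) * b\<^sup>2"
    "\<bar>a\<bar> powr p * \<bar>b / a\<bar> powr p = \<bar>b\<bar> powr p"
    using False
    by (auto simp: powr_diff abs_divide power_divide powr_divide sgn_if field_simps power2_eq_square)
  have "\<bar>a + b\<bar> = \<bar>a\<bar> * \<bar>1 + b / a\<bar>"
    using False by (simp flip: abs_mult add: distrib_left)
  hence "\<bar>a + b\<bar> powr p = \<bar>a\<bar> powr p * \<bar>1 + b / a\<bar> powr p"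
    by (simp add: powr_mult)
  also have "\<dots> \<le> \<bar>a\<bar> powr p * (1 + p * (b / a) + ?C * ((b / a)\<^sup>2 + \<bar>b / a\<bar> powr p))"
    using p by (intro mult_left_mono abs_one_plus_powr_le) auto
  also have "\<dots> = \<bar>a\<bar> powr p + p * (\<bar>a\<bar> powr p * (b / a))
    + ?C * (\<bar>a\<bar> powr p * (b / a)\<^sup>2 + \<bar>a\<bar> powr p * \<bar>b / a\<bar> powr p)"
    by (simp add: algebra_simps)
  finally show ?thesis unfolding eq by (simp add: mult_ac)
qed

text \<open>Write \<open>(A + G) powr q\<close> as \<open>(A + G) * (A + G) powr (q - 1)\<close>;
  the second factor dominates both \<open>A powr (q - 1)\<close> and the mean of
  \<open>A powr (q - 1)\<close> and \<open>G powr (q - 1)\<close>. In the moment induction, the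
  growth of the sum of squares from \<open>A\<close> to \<open>A + G\<close> thereby pays for both
  error terms.\<close>

lemma powr_add_ge:
  fixes A G q :: real
  assumes "0 \<le> A" "0 \<le> G" "1 \<le> q"
  shows "A powr q + (A powr (q - 1) * G + G powr q) / 2 \<le> (A + G) powr q"
proof -
  have split: "x powr q = x * x powr (q - 1)" if "0 \<le> x" for x :: real
    using that by (cases "x = 0") (auto simp: powr_diff)
  have "A powr (q - 1) \<le> (A + G) powr (q - 1)" "G powr (q - 1) \<le> (A + G) powr (q - 1)"
    using assms by (auto intro!: powr_mono2)
  hence 1: "(A powr (q - 1) + G powr (q - 1)) / 2 \<le> (A + G) powr (q - 1)"
    and 2: "A powr (q - 1) \<le> (A + G) powr (q - 1)" by auto
  have "A * A powr (q - 1) + G * ((A powr (q - 1) + G powr (q - 1)) / 2)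
     \<le> A * (A + G) powr (q - 1) + G * (A + G) powr (q - 1)"
    using 1 2 assms by (intro add_mono mult_left_mono) auto
  thus ?thesis using assms by (simp add: split algebra_simps add_divide_distrib)
qed

lemma abs_powr_le_one_plus:
  fixes x r p :: real
  assumes "0 \<le> r" "r \<le> p"
  shows "\<bar>x\<bar> powr r \<le> 1 + \<bar>x\<bar> powr p"
proof (cases "\<bar>x\<bar> \<le> 1")
  case True
  hence "\<bar>x\<bar> powr r \<le> 1" using assms by (simp add: powr_le1)
  thus ?thesis by (simp add: add_increasing2)
next
  case False
  hence "\<bar>x\<bar> powr r \<le> \<bar>x\<bar> powr p" using assms by (intro powr_mono) auto
  thus ?thesis by simp
qed

lemma (in prob_space) integrable_abs_powr_mono:
  fixes X :: "'a \<Rightarrow> real"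
  assumes [measurable]: "X \<in> borel_measurable M"
    and "integrable M (\<lambda>\<omega>. \<bar>X \<omega>\<bar> powr p)" "0 \<le> r" "r \<le> p"
  shows "integrable M (\<lambda>\<omega>. \<bar>X \<omega>\<bar> powr r)"
  by (rule Bochner_Integration.integrable_bound[of _ "\<lambda>\<omega>. 1 + \<bar>X \<omega>\<bar> powr p"])
     (use assms abs_powr_le_one_plus in \<open>auto simp: add_nonneg_nonneg\<close>)

text \<open>When a summand is added, the linear term of the expansion in \<open>abs_add_powr_le\<close> has mean zero by
  independence; the moment of order \<open>p - 2\<close> in the quadratic term is interpolated between a constant
  and the \<open>p\<close>-th moment.\<close>

lemma (in prob_space) weighted_sum_moment_le:
  fixes X :: "'i \<Rightarrow> 'a \<Rightarrow> real"
  assumes p: "2 < p" and indep: "indep_vars (\<lambda>_. borel) X I"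
    and int: "\<And>i. i \<in> I \<Longrightarrow> integrable M (\<lambda>\<omega>. \<bar>X i \<omega>\<bar> powr p)"
    and mean: "\<And>i. i \<in> I \<Longrightarrow> expectation (X i) = 0"
    and mom: "\<And>i. i \<in> I \<Longrightarrow> expectation (\<lambda>\<omega>. \<bar>X i \<omega>\<bar> powr p) \<le> \<kappa>" and \<kappa>: "0 \<le> \<kappa>"
  obtains K where "0 \<le> K"
    and "\<And>W g. finite W \<Longrightarrow> W \<subseteq> I \<Longrightarrow>
           integrable M (\<lambda>\<omega>. \<bar>\<Sum>i\<in>W. g i * X i \<omega>\<bar> powr p) \<and>
           expectation (\<lambda>\<omega>. \<bar>\<Sum>i\<in>W. g i * X i \<omega>\<bar> powr p) \<le> K * (\<Sum>i\<in>W. (g i)\<^sup>2) powr (p / 2)"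
proof -
  define C where "C = 3 powr p + p\<^sup>2 * exp p"
  define \<sigma> where "\<sigma> = 1 + \<kappa>"
  define q where "q = p / 2"
  \<comment> \<open>The value of \<open>l\<close> makes \<open>C * \<sigma> * (K / l)\<close> equal
    to \<open>K / 4\<close>; then \<open>K\<close> is large enough for
    \<open>C * \<sigma> * l powr (q - 1) \<le> K / 4\<close> and
    \<open>C * \<kappa> \<le> K / 2\<close>. There is no circularity because \<open>l\<close> does
    not involve \<open>K\<close>. The number \<sigma> bounds second moments through
    \<open>x\<^sup>2 \<le> 1 + |x| powr p\<close>.\<close>
  define l where "l = 4 * C * \<sigma>"
  define K where "K = 4 * C * \<sigma> * l powr (q - 1) + 2 * C * \<kappa>"
  have C: "0 < C" using p by (simp add: C_def add_pos_nonneg)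
  have \<sigma>: "0 < \<sigma>" using \<kappa> by (simp add: \<sigma>_def)
  have l: "0 < l" using C \<sigma> by (simp add: l_def)
  have q: "1 \<le> q" using p by (simp add: q_def)
  have K: "0 \<le> K" unfolding K_def using C \<sigma> \<kappa> by simp
  have rv: "random_variable borel (X i)" if "i \<in> I" for i
    using indep that by (auto simp: indep_vars_def)
  have "integrable M (\<lambda>\<omega>. \<bar>\<Sum>i\<in>W. g i * X i \<omega>\<bar> powr p) \<and>
        expectation (\<lambda>\<omega>. \<bar>\<Sum>i\<in>W. g i * X i \<omega>\<bar> powr p) \<le> K * (\<Sum>i\<in>W. (g i)\<^sup>2) powr q"
    if "finite W" "W \<subseteq> I" for W and g :: "'i \<Rightarrow> real"
    using that
  proof (induction W rule: finite_induct)
    case empty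
    thus ?case using p by simp
  next
    case (insert w W)
    define S where "S = (\<lambda>\<omega>. \<Sum>i\<in>W. g i * X i \<omega>)"
    define A where "A = (\<Sum>i\<in>W. (g i)\<^sup>2)"
    define G where "G = (g w)\<^sup>2"
    define b where "b = (\<lambda>\<omega>. g w * X w \<omega>)"
    have A: "0 \<le> A" by (simp add: A_def sum_nonneg)
    have G: "0 \<le> G" by (simp add: G_def)
    have wI: "w \<in> I" "W \<subseteq> I" using insert by auto
    have [measurable]: "S \<in> borel_measurable M" "X w \<in> borel_measurable M"
      unfolding S_def using rv wI by (auto intro!: borel_measurable_sum borel_measurable_times)
    have IH: "integrable M (\<lambda>\<omega>. \<bar>S \<omega>\<bar> powr p)" "expectation (\<lambda>\<omega>. \<bar>S \<omega>\<bar> powr p) \<le> K * A powr q"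
      using insert by (auto simp: S_def A_def)
    have ind: "indep_var borel (X w) borel S"
    proof -
      \<comment> \<open>The coefficient of \<open>w\<close> is replaced by 1 so that the
        independence obtained is that of \<open>X w\<close> itself and \<open>S\<close>.\<close>
      have "indep_vars (\<lambda>_. borel) (\<lambda>i \<omega>. (if i = w then 1 else g i) * X i \<omega>) (insert w W)"
        using indep_vars_compose2[OF indep_vars_subset[OF indep], of "insert w W" "\<lambda>i x. (if i = w then 1 else g i) * x" "\<lambda>_. borel"] insert(4)
        by auto
      from indep_vars_sum[OF insert(1,2) this] have "indep_var borel (X w) borel (\<lambda>\<omega>. \<Sum>i\<in>W. (if i = w then 1 else g i) * X i \<omega>)"
        by simp
      also have "(\<lambda>\<omega>. \<Sum>i\<in>W. (if i = w then 1 else g i) * X i \<omega>) = S"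
        unfolding S_def using insert(2) by (intro ext sum.cong) auto
      finally show ?thesis .
    qed
    have intX: "integrable M (X w)"
    proof (rule integrable_abs_cancel)
      have "integrable M (\<lambda>\<omega>. \<bar>X w \<omega>\<bar> powr 1)"
        using p by (intro integrable_abs_powr_mono[OF _ int[OF wI(1)]]) simp_all
      thus "integrable M (\<lambda>\<omega>. \<bar>X w \<omega>\<bar>)" by simp
    qed simp
    have intX2: "integrable M (\<lambda>\<omega>. (X w \<omega>)\<^sup>2)"
    proof -
      have "integrable M (\<lambda>\<omega>. \<bar>X w \<omega>\<bar> powr 2)"
        using p by (intro integrable_abs_powr_mono[OF _ int[OF wI(1)]]) simp_all
      thus ?thesis by simp
    qed
    have EX2: "expectation (\<lambda>\<omega>. (X w \<omega>)\<^sup>2) \<le> \<sigma>"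
    proof -
      have "expectation (\<lambda>\<omega>. (X w \<omega>)\<^sup>2) \<le> expectation (\<lambda>\<omega>. 1 + \<bar>X w \<omega>\<bar> powr p)"
        using intX2 int[OF wI(1)] abs_powr_le_one_plus[of 2 p "X w _"] p by (intro integral_mono) auto
      also have "\<dots> \<le> \<sigma>" using mom[OF wI(1)] int[OF wI(1)] by (simp add: \<sigma>_def prob_space)
      finally show ?thesis .
    qed
    define U where "U = (\<lambda>\<omega>. p * sgn (S \<omega>) * \<bar>S \<omega>\<bar> powr (p - 1))"
    define V where "V = (\<lambda>\<omega>. \<bar>S \<omega>\<bar> powr (p - 2))"
    have intU: "integrable M U"
    proof (rule Bochner_Integration.integrable_bound)
      show "integrable M (\<lambda>\<omega>. p * \<bar>S \<omega>\<bar> powr (p - 1))"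
        using p by (intro integrable_mult_right integrable_abs_powr_mono[OF _ IH(1)]) simp_all
      show "U \<in> borel_measurable M" unfolding U_def by measurable
    qed (use p in \<open>auto simp: U_def abs_mult sgn_if\<close>)
    have intV: "integrable M V"
      unfolding V_def using p by (intro integrable_abs_powr_mono[OF _ IH(1)]) simp_all
    have indU: "indep_var borel (X w) borel U"
      using indep_var_compose[OF ind, of "\<lambda>x. x" borel "\<lambda>x. p * sgn x * \<bar>x\<bar> powr (p - 1)" borel]
      by (simp add: comp_def U_def)
    have indV: "indep_var borel (\<lambda>\<omega>. (X w \<omega>)\<^sup>2) borel V"
      using indep_var_compose[OF ind, of "\<lambda>x. x\<^sup>2" borel "\<lambda>x. \<bar>x\<bar> powr (p - 2)" borel]
      by (simp add: comp_def V_def)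
    have Ub: "integrable M (\<lambda>\<omega>. U \<omega> * b \<omega>)" "expectation (\<lambda>\<omega>. U \<omega> * b \<omega>) = 0"
    proof -
      have eq: "U \<omega> * b \<omega> = g w * (X w \<omega> * U \<omega>)" for \<omega> by (simp add: b_def)
      show "integrable M (\<lambda>\<omega>. U \<omega> * b \<omega>)"
        unfolding eq using indep_var_integrable[OF indU intX intU] by simp
      show "expectation (\<lambda>\<omega>. U \<omega> * b \<omega>) = 0"
        unfolding eq using indep_var_lebesgue_integral[OF indU intX intU] mean[OF wI(1)] by simp
    qed
    have Vb: "integrable M (\<lambda>\<omega>. V \<omega> * (b \<omega>)\<^sup>2)"
      "expectation (\<lambda>\<omega>. V \<omega> * (b \<omega>)\<^sup>2) \<le> G * (\<sigma> * expectation V)"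
    proof -
      have eq: "V \<omega> * (b \<omega>)\<^sup>2 = G * ((X w \<omega>)\<^sup>2 * V \<omega>)" for \<omega>
        by (simp add: b_def G_def power_mult_distrib)
      show "integrable M (\<lambda>\<omega>. V \<omega> * (b \<omega>)\<^sup>2)"
        unfolding eq using indep_var_integrable[OF indV intX2 intV] by simp
      have "expectation (\<lambda>\<omega>. V \<omega> * (b \<omega>)\<^sup>2) = G * (expectation (\<lambda>\<omega>. (X w \<omega>)\<^sup>2) * expectation V)"
        unfolding eq using indep_var_lebesgue_integral[OF indV intX2 intV] by simp
      also have "\<dots> \<le> G * (\<sigma> * expectation V)"
        using EX2 G by (intro mult_left_mono mult_right_mono Bochner_Integration.integral_nonneg) (auto simp: V_def)
      finally show "expectation (\<lambda>\<omega>. V \<omega> * (b \<omega>)\<^sup>2) \<le> G * (\<sigma> * expectation V)" .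
    qed
    have bp_eq: "\<bar>b \<omega>\<bar> powr p = G powr q * \<bar>X w \<omega>\<bar> powr p" for \<omega>
    proof -
      have "G = \<bar>g w\<bar> powr 2" by (simp add: G_def)
      hence "G powr q = \<bar>g w\<bar> powr p" unfolding q_def by (simp only: powr_powr) simp
      thus ?thesis by (simp add: b_def abs_mult powr_mult)
    qed
    have bp: "integrable M (\<lambda>\<omega>. \<bar>b \<omega>\<bar> powr p)"
      "expectation (\<lambda>\<omega>. \<bar>b \<omega>\<bar> powr p) \<le> G powr q * \<kappa>"
      unfolding bp_eq using int[OF wI(1)] mom[OF wI(1)] by (auto intro!: mult_left_mono)
    have EV: "expectation V \<le> (l powr (q - 1) + K / l) * A powr (q - 1)"
    proof (cases "A = 0")
      case True
      hence "\<And>i. i \<in> W \<Longrightarrow> g i = 0"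
        using insert(1) by (auto simp: A_def sum_nonneg_eq_0_iff)
      hence "V = (\<lambda>_. 0)" by (auto simp: V_def S_def)
      thus ?thesis using K l by simp
    next
      case False
      with A have A: "0 < A" by simp
      \<comment> \<open>Split at \<open>(S \<omega>)\<^sup>2 = l * A\<close>: below it,
        \<open>V\<close> is at most its value there; above it, \<open>V\<close> is
        \<open>|S| powr p\<close> divided by a square exceeding \<open>l * A\<close>.\<close>
      have "V \<omega> \<le> (l * A) powr (q - 1) + \<bar>S \<omega>\<bar> powr p / (l * A)" for \<omega>
      proof (cases "(S \<omega>)\<^sup>2 \<le> l * A")
        case True
        have "V \<omega> = (\<bar>S \<omega>\<bar> powr 2) powr (q - 1)" by (simp add: V_def powr_powr q_def algebra_simps del: powr_numeral)
        also have "\<dots> \<le> (l * A) powr (q - 1)" using True q by (intro powr_mono2) auto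
        finally show ?thesis using A l by (simp add: add_increasing2)
      next
        case F: False
        hence "S \<omega> \<noteq> 0" using mult_pos_pos[OF l A] by auto
        hence "\<bar>S \<omega>\<bar> powr p = V \<omega> * (S \<omega>)\<^sup>2" by (simp add: V_def powr_diff)
        hence "V \<omega> * (l * A) \<le> \<bar>S \<omega>\<bar> powr p" using F by (simp add: V_def mult_left_mono)
        hence "V \<omega> \<le> \<bar>S \<omega>\<bar> powr p / (l * A)" using A l by (simp add: pos_le_divide_eq)
        thus ?thesis by (simp add: add_increasing)
      qed
      hence "expectation V \<le> expectation (\<lambda>\<omega>. (l * A) powr (q - 1) + \<bar>S \<omega>\<bar> powr p / (l * A))"
        using intV IH(1) by (intro integral_mono) auto
      also have "\<dots> = (l * A) powr (q - 1) + expectation (\<lambda>\<omega>. \<bar>S \<omega>\<bar> powr p) / (l * A)"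
        using IH(1) by (simp add: prob_space)
      also have "\<dots> \<le> (l * A) powr (q - 1) + K * A powr q / (l * A)"
        using IH(2) A l by (intro add_left_mono divide_right_mono) auto
      also have "\<dots> = (l powr (q - 1) + K / l) * A powr (q - 1)"
        using A l by (simp add: powr_mult powr_diff field_simps)
      finally show ?thesis .
    qed
    have sum_eq: "(\<Sum>i\<in>insert w W. g i * X i \<omega>) = S \<omega> + b \<omega>" for \<omega>
      using insert(1,2) by (simp add: S_def b_def)
    have bound: "\<bar>S \<omega> + b \<omega>\<bar> powr p \<le> \<bar>S \<omega>\<bar> powr p + U \<omega> * b \<omega> + C * (V \<omega> * (b \<omega>)\<^sup>2 + \<bar>b \<omega>\<bar> powr p)" for \<omega>
      using abs_add_powr_le[OF p, of "S \<omega>" "b \<omega>"] by (simp add: U_def V_def C_def)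
    have intB: "integrable M (\<lambda>\<omega>. \<bar>S \<omega>\<bar> powr p + U \<omega> * b \<omega> + C * (V \<omega> * (b \<omega>)\<^sup>2 + \<bar>b \<omega>\<bar> powr p))"
      using IH(1) Ub(1) Vb(1) bp(1) by auto
    have intS: "integrable M (\<lambda>\<omega>. \<bar>S \<omega> + b \<omega>\<bar> powr p)"
    proof (rule Bochner_Integration.integrable_bound[OF intB])
      show "(\<lambda>\<omega>. \<bar>S \<omega> + b \<omega>\<bar> powr p) \<in> borel_measurable M" unfolding b_def by measurable
    qed (auto intro!: AE_I2 order_trans[OF bound])
    have "expectation (\<lambda>\<omega>. \<bar>S \<omega> + b \<omega>\<bar> powr p)
       \<le> expectation (\<lambda>\<omega>. \<bar>S \<omega>\<bar> powr p + U \<omega> * b \<omega> + C * (V \<omega> * (b \<omega>)\<^sup>2 + \<bar>b \<omega>\<bar> powr p))"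
      by (intro integral_mono intS intB bound)
    also have "\<dots> = expectation (\<lambda>\<omega>. \<bar>S \<omega>\<bar> powr p)
       + C * (expectation (\<lambda>\<omega>. V \<omega> * (b \<omega>)\<^sup>2) + expectation (\<lambda>\<omega>. \<bar>b \<omega>\<bar> powr p))"
      using IH(1) Ub Vb(1) bp(1) by simp
    also have "\<dots> \<le> K * A powr q + C * (G * (\<sigma> * ((l powr (q - 1) + K / l) * A powr (q - 1))) + G powr q * \<kappa>)"
    proof (intro add_mono mult_left_mono IH(2) bp(2))
      show "expectation (\<lambda>\<omega>. V \<omega> * (b \<omega>)\<^sup>2) \<le> G * (\<sigma> * ((l powr (q - 1) + K / l) * A powr (q - 1)))"
        using G \<sigma> by (intro order_trans[OF Vb(2)] mult_left_mono EV) auto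
    qed (use C in auto)
    also have "\<dots> = K * A powr q + (C * \<sigma> * (l powr (q - 1) + K / l)) * (A powr (q - 1) * G) + (C * \<kappa>) * G powr q"
      by (simp add: algebra_simps)
    also have "\<dots> \<le> K * A powr q + (K / 2) * (A powr (q - 1) * G) + (K / 2) * G powr q"
    proof (intro add_mono mult_right_mono order_refl)
      have "C * \<sigma> * (l powr (q - 1) + K / l) = C * \<sigma> * l powr (q - 1) + K / 4"
        using C \<sigma> by (simp add: l_def field_simps)
      also have "\<dots> \<le> K / 2" using C \<sigma> \<kappa> by (simp add: K_def)
      finally show "C * \<sigma> * (l powr (q - 1) + K / l) \<le> K / 2" .
      show "C * \<kappa> \<le> K / 2" using C \<sigma> by (simp add: K_def)
    qed (use A G in auto)
    also have "\<dots> = K * (A powr q + (A powr (q - 1) * G + G powr q) / 2)"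
      by (simp add: algebra_simps)
    also have "\<dots> \<le> K * (A + G) powr q"
      using A G q K by (intro mult_left_mono powr_add_ge) auto
    also have "A + G = (\<Sum>i\<in>insert w W. (g i)\<^sup>2)"
      using insert(1,2) by (simp add: A_def G_def)
    finally show ?case using intS by (simp add: sum_eq)
  qed
  thus ?thesis using that K by (auto simp: q_def)
qed

section \<open>Poisson clocks\<close>

definition expo :: "real measure" where
  "expo = density lborel (exponential_density 1)"

definition arrival :: "(nat \<Rightarrow> real) \<Rightarrow> nat \<Rightarrow> real" where
  "arrival x n = (\<Sum>k\<le>n. x k)"

abbreviation clock :: "(nat \<Rightarrow> real) measure" where
  "clock \<equiv> \<Pi>\<^sub>M i\<in>UNIV. expo"

definition first_after :: "real \<Rightarrow> nat \<Rightarrow> (nat \<Rightarrow> real) \<Rightarrow> bool" where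
  "first_after h n x \<longleftrightarrow> (\<forall>i<n. arrival x i \<le> h) \<and> h < arrival x n"

text \<open>The clock as seen from time \<open>h\<close>, where arrival \<open>n\<close> is the
  first one after \<open>h\<close>: the residual wait comes first, then the waiting times not yet
  used. The form with \<open>case_nat\<close> fits the splitting of a sequence into head and
  tail.\<close>

definition restart :: "real \<Rightarrow> nat \<Rightarrow> (nat \<Rightarrow> real) \<Rightarrow> nat \<Rightarrow> real" where
  "restart h n x = case_nat (arrival x n - h) (\<lambda>k. x (Suc (n + k)))"

definition ring_pattern :: "real \<Rightarrow> bool list \<Rightarrow> (nat \<Rightarrow> real) \<Rightarrow> bool" where
  "ring_pattern h bs x \<longleftrightarrow>
    (\<forall>j<length bs. bs ! j \<longleftrightarrow> (\<exists>n. h * j < arrival x n \<and> arrival x n \<le> h * Suc j))"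

lemma prob_space_expo: "prob_space expo"
  unfolding expo_def by (rule prob_space_exponential_density) simp

lemma sets_expo [measurable_cong, simp]: "sets expo = sets borel"
  by (simp add: expo_def)

lemma space_expo [simp]: "space expo = UNIV"
  by (simp add: expo_def)

lemma space_clock [simp]: "space clock = UNIV"
  by (simp add: space_PiM PiE_UNIV_domain)

lemma sets_clock_Collect: "Measurable.pred clock P \<Longrightarrow> {x. P x} \<in> sets clock"
  by (simp add: pred_def)

interpretation clock: sequence_space expo
  by (intro sequence_space.intro product_prob_spaceI prob_space_expo)

lemma arrival_case_nat [simp]:
  "arrival (case_nat s y) 0 = s" "arrival (case_nat s y) (Suc n) = s + arrival y n"
  by (simp_all add: arrival_def sum.atMost_Suc_shift del: sum.atMost_Suc)

lemma arrival_Suc: "arrival x (Suc n) = arrival x n + x (Suc n)"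
  by (simp add: arrival_def)

lemma arrival_restart: "arrival (restart h n x) m = arrival x (n + m) - h"
proof (induction m)
  case (Suc m)
  have "arrival (restart h n x) (Suc m) = arrival (restart h n x) m + restart h n x (Suc m)"
    by (rule arrival_Suc)
  thus ?case using Suc by (simp add: restart_def arrival_Suc)
qed (simp add: restart_def)

lemma first_after_case_nat [simp]:
  "first_after h 0 (case_nat s y) \<longleftrightarrow> h < s"
  "first_after h (Suc n) (case_nat s y) \<longleftrightarrow> s \<le> h \<and> first_after (h - s) n y"
  by (auto simp: first_after_def less_Suc_eq_0_disj algebra_simps)

lemma restart_case_nat [simp]:
  "restart h 0 (case_nat s y) = case_nat (s - h) y"
  "restart h (Suc n) (case_nat s y) = restart (h - s) n y"
  by (auto simp: restart_def algebra_simps)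

lemma measurable_arrival [measurable]: "(\<lambda>x. arrival x n) \<in> borel_measurable clock"
  unfolding arrival_def by measurable

lemma measurable_first_after [measurable]: "Measurable.pred clock (first_after h n)"
  unfolding first_after_def by measurable

lemma measurable_restart [measurable]: "restart h n \<in> measurable clock clock"
proof (rule measurable_PiM_single')
  fix i :: nat
  show "(\<lambda>x. restart h n x i) \<in> measurable clock expo"
    by (cases i) (simp_all add: restart_def)
qed (simp add: PiE_UNIV_domain)

lemma measurable_ring_pattern [measurable]: "Measurable.pred clock (ring_pattern h bs)"
  unfolding ring_pattern_def by measurable

lemma emeasure_clock_split:
  assumes [measurable]: "Measurable.pred clock P"
  shows "emeasure clock {x. P x} = (\<integral>\<^sup>+s. emeasure clock {y. P (case_nat s y)} \<partial>expo)"
proof -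
  have [measurable]: "{x. P x} \<in> sets clock" using assms by (simp add: pred_def)
  have "emeasure clock {x. P x} = emeasure (distr (expo \<Otimes>\<^sub>M clock) clock (\<lambda>(s, y). case_nat s y)) {x. P x}"
    by (simp add: clock.PiM_iter)
  also have "\<dots> = emeasure (expo \<Otimes>\<^sub>M clock) ((\<lambda>(s, y). case_nat s y) -` {x. P x} \<inter> space (expo \<Otimes>\<^sub>M clock))"
    by (intro emeasure_distr) simp_all
  also have "\<dots> = (\<integral>\<^sup>+s. emeasure clock (Pair s -` ((\<lambda>(s, y). case_nat s y) -` {x. P x} \<inter> space (expo \<Otimes>\<^sub>M clock))) \<partial>expo)"
    by (intro clock.emeasure_pair_measure_alt) measurable
  also have "\<dots> = (\<integral>\<^sup>+s. emeasure clock {y. P (case_nat s y)} \<partial>expo)"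
    by (intro nn_integral_cong arg_cong2[where f = emeasure]) (auto simp: space_pair_measure)
  finally show ?thesis .
qed

text \<open>Memorylessness: after the substitution by \<open>h + s\<close> the density factors as
  \<open>exp (- h)\<close> times the density at \<open>s\<close>. The point \<open>s = 0\<close> has
  to be excluded, since the ray is open there while the density does not vanish; hence the equality
  almost everywhere.\<close>

lemma nn_integral_expo_shift:
  assumes h: "0 \<le> h" and [measurable]: "\<phi> \<in> borel_measurable borel"
  shows "(\<integral>\<^sup>+s. indicator {h<..} s * \<phi> (s - h) \<partial>expo) = ennreal (exp (- h)) * (\<integral>\<^sup>+s. \<phi> s \<partial>expo)"
proof -
  have "(\<integral>\<^sup>+s. indicator {h<..} s * \<phi> (s - h) \<partial>expo)
    = (\<integral>\<^sup>+s. ennreal (exponential_density 1 s) * (indicator {h<..} s * \<phi> (s - h)) \<partial>lborel)"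
    unfolding expo_def by (subst nn_integral_density) auto
  also have "\<dots> = (\<integral>\<^sup>+s. ennreal (exponential_density 1 (h + s)) * (indicator {h<..} (h + s) * \<phi> s) \<partial>lborel)"
    by (subst nn_integral_real_affine[where c = 1 and t = h]) auto
  also have "\<dots> = (\<integral>\<^sup>+s. ennreal (exp (- h)) * (ennreal (exponential_density 1 s) * \<phi> s) \<partial>lborel)"
  proof (rule nn_integral_cong_AE)
    have "AE s::real in lborel. s \<noteq> 0" by (rule AE_lborel_singleton)
    thus "AE s in lborel. ennreal (exponential_density 1 (h + s)) * (indicator {h<..} (h + s) * \<phi> s)
       = ennreal (exp (- h)) * (ennreal (exponential_density 1 s) * \<phi> s)"
    proof eventually_elim
      case (elim s)
      show ?case
      proof (cases "0 < s")
        case True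
        have "ennreal (exponential_density 1 (h + s)) = ennreal (exp (- h)) * ennreal (exponential_density 1 s)"
          using h True by (simp add: exponential_density_def ennreal_mult[symmetric] exp_add[symmetric])
        thus ?thesis using True by (simp add: mult.assoc)
      qed (use elim in \<open>auto simp: exponential_density_def\<close>)
    qed
  qed
  also have "\<dots> = ennreal (exp (- h)) * (\<integral>\<^sup>+s. \<phi> s \<partial>expo)"
    unfolding expo_def by (subst nn_integral_cmult, simp, subst nn_integral_density) auto
  finally show ?thesis .
qed

lemma emeasure_expo_greaterThan: "0 \<le> h \<Longrightarrow> emeasure expo {h<..} = ennreal (exp (- h))"
  using nn_integral_expo_shift[of h "\<lambda>_. 1"] prob_space.emeasure_space_1[OF prob_space_expo] by simp

lemma AE_expo_pos: "AE s in expo. 0 < s"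
proof -
  have "AE s in expo. s \<in> {0<..}"
    by (rule prob_space.AE_prob_1[OF prob_space_expo]) (simp add: measure_def emeasure_expo_greaterThan)
  thus ?thesis by simp
qed

text \<open>Splitting off the first waiting time \<open>s\<close> turns \<open>(h, Suc n)\<close> into \<open>(h - s, n)\<close>; only the case \<open>n = 0\<close>
  uses the exponential density.\<close>

lemma emeasure_restart:
  assumes [measurable]: "Measurable.pred clock P" and "0 \<le> h"
  shows "emeasure clock {x. first_after h n x \<and> P (restart h n x)}
    = emeasure clock {x. first_after h n x} * emeasure clock {x. P x}"
  using \<open>0 \<le> h\<close>
proof (induction n arbitrary: h)
  case 0
  have gen: "emeasure clock {x. first_after h 0 x \<and> Q (restart h 0 x)} = ennreal (exp (- h)) * emeasure clock {x. Q x}"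
    if [measurable]: "Measurable.pred clock Q" for Q
  proof -
    have meas: "(\<lambda>s. emeasure clock {y. Q (case_nat s y)}) \<in> borel_measurable borel"
    proof -
      have "(\<lambda>s. emeasure clock {y \<in> space clock. Q (case_nat s y)}) \<in> borel_measurable borel"
        by measurable
      thus ?thesis by simp
    qed
    have "emeasure clock {x. first_after h 0 x \<and> Q (restart h 0 x)}
       = (\<integral>\<^sup>+s. emeasure clock {y. h < s \<and> Q (case_nat (s - h) y)} \<partial>expo)"
      by (subst emeasure_clock_split) simp_all
    also have "\<dots> = (\<integral>\<^sup>+s. indicator {h<..} s * emeasure clock {y. Q (case_nat (s - h) y)} \<partial>expo)"
      by (intro nn_integral_cong) (auto simp: indicator_def)
    also have "\<dots> = ennreal (exp (- h)) * (\<integral>\<^sup>+s. emeasure clock {y. Q (case_nat s y)} \<partial>expo)"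
      using 0 meas by (rule nn_integral_expo_shift)
    also have "\<dots> = ennreal (exp (- h)) * emeasure clock {x. Q x}"
      by (subst (2) emeasure_clock_split) simp_all
    finally show ?thesis .
  qed
  \<comment> \<open>The instance of \<open>gen\<close> for the full event identifies
    \<open>exp (- h)\<close> as the measure of \<open>first_after h 0\<close>.\<close>
  show ?case
    using gen[OF assms(1)] gen[of "\<lambda>_. True"] clock.emeasure_space_1 by simp
next
  case (Suc n)
  have meas: "(\<lambda>s. emeasure clock {y. s \<le> h \<and> first_after (h - s) n y}) \<in> borel_measurable expo"
  proof -
    have "(\<lambda>s. emeasure clock {y \<in> space clock. s \<le> h \<and> (\<forall>i<n. arrival y i \<le> h - s) \<and> h - s < arrival y n}) \<in> borel_measurable expo"
      by measurable
    thus ?thesis by (simp add: first_after_def)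
  qed
  have "emeasure clock {x. first_after h (Suc n) x \<and> P (restart h (Suc n) x)}
     = (\<integral>\<^sup>+s. emeasure clock {y. (s \<le> h \<and> first_after (h - s) n y) \<and> P (restart (h - s) n y)} \<partial>expo)"
    by (subst emeasure_clock_split) simp_all
  also have "\<dots> = (\<integral>\<^sup>+s. emeasure clock {y. s \<le> h \<and> first_after (h - s) n y} * emeasure clock {x. P x} \<partial>expo)"
  proof (rule nn_integral_cong)
    fix s
    show "emeasure clock {y. (s \<le> h \<and> first_after (h - s) n y) \<and> P (restart (h - s) n y)}
       = emeasure clock {y. s \<le> h \<and> first_after (h - s) n y} * emeasure clock {x. P x}"
      using Suc.IH[of "h - s"] by (cases "s \<le> h") auto
  qed
  also have "\<dots> = (\<integral>\<^sup>+s. emeasure clock {y. s \<le> h \<and> first_after (h - s) n y} \<partial>expo) * emeasure clock {x. P x}"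
    by (rule nn_integral_multc[OF meas])
  also have "(\<integral>\<^sup>+s. emeasure clock {y. s \<le> h \<and> first_after (h - s) n y} \<partial>expo)
     = emeasure clock {x. first_after h (Suc n) x}"
    by (subst (2) emeasure_clock_split) simp_all
  finally show ?case .
qed

lemma AE_clock_pos: "AE x in clock. \<forall>k. 0 < x k"
  unfolding AE_all_countable
  by (intro allI AE_PiM_component prob_space_expo AE_expo_pos) simp

text \<open>Let \<open>a\<close> be the probability that all arrivals stay below \<open>m\<close>
  and all waits are positive. On this event the first wait is at most \<open>m\<close>, and the
  clock without that wait is again in the event. By independence \<open>a\<close> is at most
  \<open>a\<close> times a number less than 1, so \<open>a = 0\<close>.\<close>

lemma AE_clock_unbounded: "AE x in clock. \<forall>t. \<exists>n. t < arrival x n"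
proof -
  have "AE x in clock. \<exists>n. real m < arrival x n" for m :: nat
  proof -
    define a where "a = emeasure clock {x. (\<forall>n. arrival x n \<le> m) \<and> (\<forall>n. 0 < x n)}"
    have "a = (\<integral>\<^sup>+s. emeasure clock {y. (\<forall>n. arrival (case_nat s y) n \<le> m) \<and> (\<forall>n. 0 < (case_nat s y :: nat \<Rightarrow> real) n)} \<partial>expo)"
      unfolding a_def by (subst emeasure_clock_split) simp_all
    also have "\<dots> \<le> (\<integral>\<^sup>+s. a * indicator {..real m} s \<partial>expo)"
    proof (rule nn_integral_mono)
      fix s :: real
      have sub: "{y. (\<forall>n. arrival (case_nat s y) n \<le> m) \<and> (\<forall>n. 0 < (case_nat s y :: nat \<Rightarrow> real) n)}
         \<subseteq> {x. ((\<forall>n. arrival x n \<le> m) \<and> (\<forall>n. 0 < x n)) \<and> s \<le> m}" (is "?A \<subseteq> _")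
      proof
        fix y assume y: "y \<in> ?A"
        have "0 < y n" "s + arrival y n \<le> m" for n
          using y by (force dest: spec[of _ "Suc n"])+
        moreover have "0 < s" "s \<le> m" using y by (force dest: spec[of _ 0])+
        ultimately have "arrival y n \<le> m" for n
          by (smt (verit))
        thus "y \<in> {x. ((\<forall>n. arrival x n \<le> m) \<and> (\<forall>n. 0 < x n)) \<and> s \<le> m}"
          using \<open>\<And>n. 0 < y n\<close> \<open>s \<le> m\<close> by auto
      qed
      have "emeasure clock ?A \<le> emeasure clock {x. ((\<forall>n. arrival x n \<le> m) \<and> (\<forall>n. 0 < x n)) \<and> s \<le> m}"
      proof (rule emeasure_mono[OF sub])
        have "{x \<in> space clock. ((\<forall>n. arrival x n \<le> m) \<and> (\<forall>n. 0 < x n)) \<and> s \<le> m} \<in> sets clock" by measurable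
        thus "{x. ((\<forall>n. arrival x n \<le> m) \<and> (\<forall>n. 0 < x n)) \<and> s \<le> m} \<in> sets clock" by simp
      qed
      also have "\<dots> = a * indicator {..real m} s" by (cases "s \<le> m") (auto simp: a_def)
      finally show "emeasure clock ?A \<le> a * indicator {..real m} s" .
    qed
    also have "\<dots> = a * emeasure expo {..real m}"
      by (simp add: nn_integral_cmult_indicator)
    finally have le: "a \<le> a * emeasure expo {..real m}" .
    have "a = 0"
    proof -
      have fin: "a \<le> 1" unfolding a_def by (rule clock.emeasure_le_1)
      have "measure expo {..real m} = 1 - measure expo {real m<..}"
        using prob_space.prob_compl[OF prob_space_expo, of "{real m<..}"] by (simp add: Compl_eq_Diff_UNIV[symmetric] not_less)
      hence "measure expo {..real m} < 1"
        using emeasure_expo_greaterThan[of "real m"] by (simp add: measure_def)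
      moreover obtain r where r: "a = ennreal r" "0 \<le> r"
        using fin by (cases a) (auto simp: top_unique)
      moreover have "r \<le> r * measure expo {..real m}"
        using le r by (simp add: finite_measure.emeasure_eq_measure[OF prob_space.finite_measure[OF prob_space_expo]] ennreal_mult[symmetric])
      ultimately have "r = 0"
        by (smt (verit) mult_less_cancel_left2)
      thus ?thesis using r by simp
    qed
    hence "AE x in clock. \<not> ((\<forall>n. arrival x n \<le> m) \<and> (\<forall>n. 0 < x n))"
      unfolding a_def
      by (subst AE_iff_measurable[OF sets_clock_Collect[of "\<lambda>x. (\<forall>n. arrival x n \<le> m) \<and> (\<forall>n. 0 < x n)"]]) simp_all
    with AE_clock_pos show ?thesis
      by eventually_elim (auto simp: not_le)
  qed
  hence "AE x in clock. \<forall>m::nat. \<exists>n. real m < arrival x n"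
    by (simp add: AE_all_countable)
  thus ?thesis
  proof eventually_elim
    case (elim x)
    show ?case
    proof
      fix t
      obtain m :: nat where "t \<le> real m" using real_arch_simple by blast
      thus "\<exists>n. t < arrival x n" using elim by (meson le_less_trans)
    qed
  qed
qed

lemma arrival_mono:
  assumes "\<forall>k. 0 < x k" "m \<le> n"
  shows "arrival x m \<le> arrival x n"
  unfolding arrival_def using assms by (intro sum_mono2) (auto intro: less_imp_le)

text \<open>The arrivals up to \<open>h\<close> are exactly those with index below \<open>n\<close>,
  so they decide the first cell. The remaining ones are those of the restarted clock with indices
  shifted by \<open>n\<close>, and subtracting \<open>h\<close> turns cell \<open>j + 1\<close> into
  cell \<open>j\<close>.\<close>

lemma ring_pattern_Cons:
  assumes x: "\<forall>k. 0 < x k" and h: "0 < h" and n: "first_after h n x"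
  shows "ring_pattern h (b # bs) x \<longleftrightarrow> (b \<longleftrightarrow> 0 < n) \<and> ring_pattern h bs (restart h n x)"
proof -
  have pos: "0 < arrival x i" for i
    using arrival_mono[OF x, of 0 i] x
    by (auto simp: arrival_def[of x 0] intro: less_le_trans)
  have le: "arrival x i \<le> h \<longleftrightarrow> i < n" for i
    using n arrival_mono[OF x, of n i] unfolding first_after_def by (cases "i < n") auto
  have 0: "(\<exists>i. h * real 0 < arrival x i \<and> arrival x i \<le> h * real (Suc 0)) \<longleftrightarrow> 0 < n"
    using pos by (auto simp: le)
  have S: "(\<exists>i. h * real (Suc j) < arrival x i \<and> arrival x i \<le> h * real (Suc (Suc j))) \<longleftrightarrow>
    (\<exists>i. h * real j < arrival (restart h n x) i \<and> arrival (restart h n x) i \<le> h * real (Suc j))" for j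
  proof
    assume "\<exists>i. h * real (Suc j) < arrival x i \<and> arrival x i \<le> h * real (Suc (Suc j))"
    then obtain i where i: "h * real (Suc j) < arrival x i" "arrival x i \<le> h * real (Suc (Suc j))" by blast
    have "h * 1 \<le> h * real (Suc j)" using h by (intro mult_left_mono) auto
    hence "\<not> arrival x i \<le> h" using i by simp
    hence "n + (i - n) = i" by (simp add: le)
    hence "arrival (restart h n x) (i - n) = arrival x i - h" by (simp add: arrival_restart)
    thus "\<exists>i. h * real j < arrival (restart h n x) i \<and> arrival (restart h n x) i \<le> h * real (Suc j)"
      using i by (intro exI[of _ "i - n"]) (simp add: algebra_simps)
  next
    assume "\<exists>i. h * real j < arrival (restart h n x) i \<and> arrival (restart h n x) i \<le> h * real (Suc j)"
    thus "\<exists>i. h * real (Suc j) < arrival x i \<and> arrival x i \<le> h * real (Suc (Suc j))"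
      by (auto simp: arrival_restart algebra_simps)
  qed
  show ?thesis
    unfolding ring_pattern_def All_less_Suc2 length_Cons nth_Cons_0 nth_Cons_Suc 0 S by blast
qed

text \<open>The number of arrivals up to \<open>h\<close> is independent of the restarted clock,
  whose law does not depend on that number. Summing over the disjoint cases \<open>n \<in> J\<close>
  turns this into independence of the first cell from the later ones.\<close>

lemma emeasure_restart_UN:
  assumes [measurable]: "Measurable.pred clock P" and h: "0 \<le> h"
  shows "emeasure clock {x. \<exists>n\<in>J. first_after h n x \<and> P (restart h n x)}
    = emeasure clock {x. \<exists>n\<in>J. first_after h n x} * emeasure clock {x. P x}"
proof -
  have *: "emeasure clock {x. \<exists>n\<in>J. first_after h n x \<and> Q (restart h n x)}
    = (\<Sum>n. emeasure clock {x. first_after h n x \<and> n \<in> J}) * emeasure clock {x. Q x}"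
    if [measurable]: "Measurable.pred clock Q" for Q
  proof -
    have sets: "{x. n \<in> J \<and> first_after h n x \<and> Q (restart h n x)} \<in> sets clock" for n
    proof -
      have "{x \<in> space clock. n \<in> J \<and> first_after h n x \<and> Q (restart h n x)} \<in> sets clock" by measurable
      thus ?thesis by simp
    qed
    have disj: "disjoint_family (\<lambda>n. {x. n \<in> J \<and> first_after h n x \<and> Q (restart h n x)})"
      unfolding disjoint_family_on_def first_after_def
      by (auto simp: disjoint_iff) (metis linorder_neqE_nat not_less)
    have "{x. \<exists>n\<in>J. first_after h n x \<and> Q (restart h n x)}
        = (\<Union>n. {x. n \<in> J \<and> first_after h n x \<and> Q (restart h n x)})" by auto
    hence "emeasure clock {x. \<exists>n\<in>J. first_after h n x \<and> Q (restart h n x)}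
      = (\<Sum>n. emeasure clock {x. n \<in> J \<and> first_after h n x \<and> Q (restart h n x)})"
      using suminf_emeasure[of "\<lambda>n. {x. n \<in> J \<and> first_after h n x \<and> Q (restart h n x)}" clock] sets disj
      by (simp add: image_subset_iff)
    also have "\<dots> = (\<Sum>n. emeasure clock {x. first_after h n x \<and> n \<in> J} * emeasure clock {x. Q x})"
    proof (rule suminf_cong)
      fix n
      show "emeasure clock {x. n \<in> J \<and> first_after h n x \<and> Q (restart h n x)}
        = emeasure clock {x. first_after h n x \<and> n \<in> J} * emeasure clock {x. Q x}"
        using emeasure_restart[OF that h] by (cases "n \<in> J") auto
    qed
    finally show ?thesis by simp
  qed
  show ?thesis
    using *[OF assms(1)] *[of "\<lambda>_. True"] clock.emeasure_space_1 by simp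
qed

lemma measure_ring_pattern:
  assumes h: "0 < h"
  shows "measure clock {x. ring_pattern h bs x} = (\<Prod>b\<leftarrow>bs. if b then 1 - exp (- h) else exp (- h))"
proof (induction bs)
  case Nil
  show ?case using clock.P.prob_space by (simp add: ring_pattern_def)
next
  case (Cons b bs)
  \<comment> \<open>The arrival counts up to time \<open>h\<close> that are compatible with the
    first letter: only 0 for a silent cell, all positive counts otherwise.\<close>
  define J where "J = {n::nat. b \<longleftrightarrow> 0 < n}"
  have first: "\<exists>n. first_after h n x" if "\<exists>n. h < arrival x n" for x
    unfolding first_after_def using exists_least_iff[of "\<lambda>n. h < arrival x n"] that by (auto simp: not_less)
  have "measure clock {x. ring_pattern h (b # bs) x}
      = measure clock {x. \<exists>n\<in>J. first_after h n x \<and> ring_pattern h bs (restart h n x)}"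
  proof (rule clock.finite_measure_eq_AE)
    show "AE x in clock. (x \<in> {x. ring_pattern h (b # bs) x}) =
      (x \<in> {x. \<exists>n\<in>J. first_after h n x \<and> ring_pattern h bs (restart h n x)})"
      using AE_clock_pos AE_clock_unbounded
    proof eventually_elim
      case (elim x)
      then obtain n where n: "first_after h n x" using first by blast
      have uniq: "m = n" if "first_after h m x" for m
        using n that unfolding first_after_def by (metis linorder_neqE_nat not_less)
      have "(\<exists>m\<in>J. first_after h m x \<and> ring_pattern h bs (restart h m x)) \<longleftrightarrow>
          n \<in> J \<and> ring_pattern h bs (restart h n x)"
        using n uniq by blast
      thus ?case by (simp add: ring_pattern_Cons[OF elim(1) h n] J_def)
    qed
  qed (rule sets_clock_Collect; measurable)+
  also have "\<dots> = measure clock {x. \<exists>n\<in>J. first_after h n x} * measure clock {x. ring_pattern h bs x}"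
    using emeasure_restart_UN[of "ring_pattern h bs" h J] h
    by (simp add: clock.emeasure_eq_measure ennreal_mult[symmetric])
  also have "measure clock {x. \<exists>n\<in>J. first_after h n x} = (if b then 1 - exp (- h) else exp (- h))"
  proof -
    have "emeasure clock {x. first_after h 0 x} = (\<integral>\<^sup>+s. indicator {h<..} s \<partial>expo)"
    proof -
      have "emeasure clock {y. first_after h 0 (case_nat s y)} = indicator {h<..} s" for s
        using clock.P.emeasure_space_1 by (cases "h < s") simp_all
      thus ?thesis by (subst emeasure_clock_split) simp_all
    qed
    hence m0: "measure clock {x. first_after h 0 x} = exp (- h)"
      using h by (simp add: emeasure_expo_greaterThan measure_def)
    show ?thesis
    proof (cases b)
      case False
      hence "J = {0}" by (auto simp: J_def)
      thus ?thesis using m0 False by simp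
    next
      case True
      have m1: "{x. \<exists>n\<in>J. first_after h n x} \<in> sets clock"
        by (rule sets_clock_Collect) measurable
      have m2: "space clock - {x. first_after h 0 x} \<in> sets clock"
        by (rule sets.compl_sets, rule sets_clock_Collect) measurable
      have "measure clock {x. \<exists>n\<in>J. first_after h n x} = measure clock (space clock - {x. first_after h 0 x})"
      proof (rule clock.finite_measure_eq_AE)
        show "AE x in clock. (x \<in> {x. \<exists>n\<in>J. first_after h n x}) = (x \<in> space clock - {x. first_after h 0 x})"
          using AE_clock_unbounded
        proof eventually_elim
          case (elim x)
          then obtain n where n: "first_after h n x" using first by blast
          have uniq: "m = n" if "first_after h m x" for m
            using n that unfolding first_after_def by (metis linorder_neqE_nat not_less)
          have "first_after h 0 x \<longleftrightarrow> n = 0" "(\<exists>m\<in>J. first_after h m x) \<longleftrightarrow> n \<in> J"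
            using n uniq by blast+
          thus ?case using True by (simp add: J_def)
        qed
      qed (rule m1, rule m2)
      also have "\<dots> = 1 - exp (- h)"
        using clock.P.prob_compl[OF sets_clock_Collect[OF measurable_first_after]] m0 by simp
      finally show ?thesis using True by simp
    qed
  qed
  finally show ?case using Cons by simp
qed

section \<open>Averaging on finite graphs\<close>

definition avg :: "'v set \<Rightarrow> ('v \<Rightarrow> real) \<Rightarrow> 'v \<Rightarrow> real" where
  "avg e g w = (if w \<in> e then (\<Sum>u\<in>e. g u) / 2 else g w)"

text \<open>A letter \<open>z\<close> is the set of edges that ring in a given time cell. Cells in which two different edges
  ring are going to be negligible, hence such letters may act as the identity.\<close>

definition act :: "'v set set \<Rightarrow> ('v \<Rightarrow> real) \<Rightarrow> 'v \<Rightarrow> real" where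
  "act z g = (if is_singleton z then avg (the_elem z) g else g)"

text \<open>Folded over the reversed word, this collects all vertices whose earlier opinions can matter.\<close>

definition infl :: "'v set set \<Rightarrow> 'v set \<Rightarrow> 'v set" where
  "infl z S = (if is_singleton z \<and> the_elem z \<inter> S \<noteq> {} then S \<union> the_elem z else S)"

text \<open>The law of the random subset of \<open>E\<close> that contains each edge independently
  with probability \<open>r\<close>; later \<open>r\<close> is the probability
  \<open>1 - exp (- h)\<close> of a ring in a cell of length \<open>h\<close>.\<close>

definition bern :: "real \<Rightarrow> 'e set \<Rightarrow> 'e set \<Rightarrow> real" where
  "bern r E z = (\<Prod>e\<in>E. if e \<in> z then r else 1 - r)"

lemma bern_total:
  assumes "finite E"
  shows "(\<Sum>z\<in>Pow E. bern r E z) = 1"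
proof -
  have "(\<Sum>z\<in>Pow E. bern r E z) = (\<Sum>z\<in>Pow E. (\<Prod>e\<in>z. r) * (\<Prod>e\<in>E - z. 1 - r))"
    unfolding bern_def using assms
    by (intro sum.cong refl) (auto simp: prod.If_cases Int_absorb1 Diff_eq)
  also have "\<dots> = (\<Prod>e\<in>E. r + (1 - r))" by (rule prod_add[OF assms, symmetric])
  finally show ?thesis by simp
qed

lemma weights_bern: "finite E \<Longrightarrow> 0 \<le> r \<Longrightarrow> r \<le> 1 \<Longrightarrow> weights (Pow E) (bern r E)"
  by unfold_locales (simp_all add: bern_total, simp add: bern_def prod_nonneg)

lemma bern_singleton:
  assumes "finite E" "e \<in> E"
  shows "bern r E {e} = r * (1 - r) ^ (card E - 1)"
proof -
  have "bern r E {e} = r * (\<Prod>x\<in>E - {e}. if x \<in> {e} then r else 1 - r)"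
    unfolding bern_def using assms by (subst prod.remove[of _ e]) auto
  also have "(\<Prod>x\<in>E - {e}. if x \<in> {e} then r else 1 - r) = (\<Prod>x\<in>E - {e}. 1 - r)"
    by (intro prod.cong) auto
  finally show ?thesis using assms by simp
qed

text \<open>After subtraction of \<open>a\<close> only singletons contribute, and all of them have
  the same weight. This is the discrete counterpart of the generator of the process, and it is exact
  because colliding letters act trivially. All drift computations go through it.\<close>

lemma bern_sum_singletons:
  assumes "finite E" and H: "\<And>z. z \<subseteq> E \<Longrightarrow> \<not> is_singleton z \<Longrightarrow> H z = a"
  shows "(\<Sum>z\<in>Pow E. bern r E z * H z) = a + r * (1 - r) ^ (card E - 1) * (\<Sum>e\<in>E. H {e} - a)"
proof -
  have "(\<Sum>z\<in>Pow E. bern r E z * H z) - a = (\<Sum>z\<in>Pow E. bern r E z * H z) - (\<Sum>z\<in>Pow E. bern r E z) * a"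
    by (simp add: bern_total assms)
  also have "\<dots> = (\<Sum>z\<in>Pow E. bern r E z * (H z - a))"
    by (simp add: sum_distrib_right sum_subtractf right_diff_distrib)
  also have "\<dots> = (\<Sum>z\<in>(\<lambda>e. {e}) ` E. bern r E z * (H z - a))"
    using assms by (intro sum.mono_neutral_right) (auto simp: is_singleton_def)
  also have "\<dots> = (\<Sum>e\<in>E. bern r E {e} * (H {e} - a))"
    by (subst sum.reindex) auto
  also have "\<dots> = r * (1 - r) ^ (card E - 1) * (\<Sum>e\<in>E. H {e} - a)"
    using assms(1) by (simp add: bern_singleton sum_distrib_left)
  finally show ?thesis by simp
qed

text \<open>Subtract the probabilities of no ring and of exactly one ring from 1 and apply
  Bernoulli's inequality to both powers: the terms linear in \<open>r\<close> cancel.\<close>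

lemma bern_collision_le:
  assumes E: "finite E" and r: "0 \<le> r" "r \<le> 1"
  shows "(\<Sum>z\<in>Pow E. bern r E z * of_bool (z \<noteq> {} \<and> \<not> is_singleton z)) \<le> (real (card E) * r)\<^sup>2"
proof (cases "E = {}")
  case False
  define m where "m = card E"
  have m: "1 \<le> m" using E False by (simp add: m_def Suc_le_eq card_gt_0_iff)
  have e: "bern r E {} = (1 - r) ^ m" by (simp add: bern_def m_def)
  have "(\<Sum>z\<in>Pow E. bern r E z * of_bool (z \<noteq> {} \<and> \<not> is_singleton z))
      = (\<Sum>z\<in>Pow E. bern r E z * (of_bool (\<not> is_singleton z)) - (if z = {} then bern r E z else 0))"
    by (intro sum.cong) (auto simp: is_singleton_def)
  also have "\<dots> = (\<Sum>z\<in>Pow E. bern r E z * of_bool (\<not> is_singleton z)) - (1 - r) ^ m"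
    using E by (simp add: sum_subtractf e)
  also have "(\<Sum>z\<in>Pow E. bern r E z * of_bool (\<not> is_singleton z)) = 1 - r * (1 - r) ^ (m - 1) * m"
    using bern_sum_singletons[OF E, of "\<lambda>z. of_bool (\<not> is_singleton z)" 1 r] by (simp add: m_def)
  finally have eq: "(\<Sum>z\<in>Pow E. bern r E z * of_bool (z \<noteq> {} \<and> \<not> is_singleton z))
      = 1 - r * (1 - r) ^ (m - 1) * m - (1 - r) ^ m" .
  have b: "1 - real k * r \<le> (1 - r) ^ k" for k
    using Bernoulli_inequality[of "- r" k] r by simp
  have "r * m * (1 - real (m - 1) * r) \<le> r * m * (1 - r) ^ (m - 1)"
    using r by (intro mult_left_mono b) auto
  moreover have "r * m * (1 - real (m - 1) * r) = r * m - real m * real (m - 1) * r\<^sup>2"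
    by (simp add: algebra_simps power2_eq_square)
  moreover have "real m * real (m - 1) * r\<^sup>2 \<le> (real m * r)\<^sup>2"
    unfolding power_mult_distrib power2_eq_square[of "real m"] by (intro mult_right_mono mult_left_mono) auto
  ultimately show ?thesis using b[of m] unfolding eq m_def[symmetric] by (simp add: mult_ac)
next
  case True
  thus ?thesis by simp
qed

section \<open>Duality, spreading of mass and influence on a finite graph\<close>

locale finite_graph =
  fixes B :: "'v set" and E :: "'v set set"
  assumes finite_B: "finite B" and edge: "e \<in> E \<Longrightarrow> e \<subseteq> B \<and> card e = 2"
begin

lemma finite_E: "finite E"
  using edge by (intro finite_subset[OF _ finite_Pow_iff[THEN iffD2, OF finite_B]]) auto

lemma edgeE:
  assumes "e \<in> E"
  obtains u w where "e = {u, w}" "u \<noteq> w" "u \<in> B" "w \<in> B"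
  using edge[OF assms] by (auto simp: card_2_iff)

lemma sum_avg:
  assumes "e \<in> E"
  shows "(\<Sum>w\<in>B. avg e g w) = (\<Sum>w\<in>B. g w)"
proof -
  have *: "(\<Sum>w\<in>B. h w) = (\<Sum>w\<in>e. h w) + (\<Sum>w\<in>B - e. h w)" for h :: "'v \<Rightarrow> real"
    using edge[OF assms] finite_B by (metis add.commute sum.subset_diff)
  have "(\<Sum>w\<in>B - e. avg e g w) = (\<Sum>w\<in>B - e. g w)" by (intro sum.cong) (auto simp: avg_def)
  thus ?thesis unfolding * using edge[OF assms] by (simp add: avg_def)
qed

lemma sum_avg_adjoint:
  assumes "e \<in> E"
  shows "(\<Sum>w\<in>B. g w * avg e f w) = (\<Sum>w\<in>B. avg e g w * f w)"
proof -
  have *: "(\<Sum>w\<in>B. h w) = (\<Sum>w\<in>e. h w) + (\<Sum>w\<in>B - e. h w)" for h :: "'v \<Rightarrow> real"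
    using edge[OF assms] finite_B by (metis add.commute sum.subset_diff)
  have "(\<Sum>w\<in>e. g w * avg e f w) = (\<Sum>w\<in>e. avg e g w * f w)"
    by (simp add: avg_def flip: sum_distrib_left sum_distrib_right sum_divide_distrib)
  moreover have "(\<Sum>w\<in>B - e. g w * avg e f w) = (\<Sum>w\<in>B - e. avg e g w * f w)"
    by (intro sum.cong) (auto simp: avg_def)
  ultimately show ?thesis unfolding * by simp
qed

lemma act_cases:
  assumes "z \<subseteq> E"
  obtains "act z = (\<lambda>g. g)" | e where "e \<in> E" "act z = avg e"
proof (cases "is_singleton z")
  case True
  then obtain e where "z = {e}" by (auto simp: is_singleton_def)
  thus ?thesis using that(2)[of e] assms by (auto simp: act_def fun_eq_iff)
qed (auto simp: act_def fun_eq_iff intro: that)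

text \<open>Each letter acts as a symmetric matrix, so moving the letters one by one to the other
  side of the inner product reverses their order. With \<open>g\<close> the unit mass at
  \<open>v\<close>, the left side is the opinion at \<open>v\<close>.\<close>

lemma fold_act_dual:
  assumes "set zs \<subseteq> Pow E"
  shows "(\<Sum>w\<in>B. g w * fold act zs f w) = (\<Sum>w\<in>B. fold act (rev zs) g w * f w)"
  using assms
proof (induction zs arbitrary: f)
  case (Cons z zs)
  have "(\<Sum>w\<in>B. g w * fold act (z # zs) f w) = (\<Sum>w\<in>B. fold act (rev zs) g w * act z f w)"
    using Cons by simp
  also have "\<dots> = (\<Sum>w\<in>B. act z (fold act (rev zs) g) w * f w)"
  proof -
    have "z \<subseteq> E" using Cons.prems by simp
    thus ?thesis by (cases rule: act_cases) (simp_all add: sum_avg_adjoint)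
  qed
  finally show ?case by simp
qed simp

definition dist_on :: "('v \<Rightarrow> real) \<Rightarrow> bool" where
  "dist_on g \<longleftrightarrow> (\<forall>w\<in>B. 0 \<le> g w) \<and> (\<Sum>w\<in>B. g w) = 1"

definition sq :: "('v \<Rightarrow> real) \<Rightarrow> real" where
  "sq g = (\<Sum>w\<in>B. (g w)\<^sup>2)"

lemma dist_on_act:
  assumes "dist_on g" "z \<subseteq> E"
  shows "dist_on (act z g)"
  using assms(2)
proof (cases rule: act_cases)
  case (2 e)
  have "0 \<le> avg e g w" if "w \<in> B" for w
    using that edge[OF 2(1)] assms(1)
    unfolding avg_def dist_on_def by (auto intro!: divide_nonneg_nonneg sum_nonneg)
  thus ?thesis using assms 2 by (simp add: dist_on_def sum_avg)
qed (simp add: assms)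

lemma dist_on_fold: "dist_on g \<Longrightarrow> set zs \<subseteq> Pow E \<Longrightarrow> dist_on (fold act zs g)"
  by (induction zs arbitrary: g) (auto intro: dist_on_act)

lemma sq_avg:
  assumes "{u, w} \<in> E" "u \<noteq> w"
  shows "sq (avg {u, w} g) = sq g - (g u - g w)\<^sup>2 / 2"
proof -
  have *: "(\<Sum>w\<in>B. h w) = (\<Sum>w\<in>{u, w}. h w) + (\<Sum>w\<in>B - {u, w}. h w)" for h :: "'v \<Rightarrow> real"
    using edge[OF assms(1)] finite_B by (metis add.commute sum.subset_diff)
  have "(\<Sum>x\<in>B - {u, w}. (avg {u, w} g x)\<^sup>2) = (\<Sum>x\<in>B - {u, w}. (g x)\<^sup>2)"
    by (intro sum.cong) (auto simp: avg_def)
  thus ?thesis unfolding sq_def * using assms(2)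
    by (simp add: avg_def power2_eq_square field_simps)
qed

lemma sq_act_le:
  assumes "z \<subseteq> E"
  shows "sq (act z g) \<le> sq g"
  using assms
proof (cases rule: act_cases)
  case (2 e)
  obtain u w where "e = {u, w}" "u \<noteq> w" using 2(1) by (rule edgeE)
  thus ?thesis using sq_avg[of u w g] 2 by simp
qed simp

text \<open>A Nash-type inequality. Along a shortest path from a maximum of \<open>g\<close> to a vertex where \<open>g\<close> is at most
  half of it, all vertices but the last carry mass more than half the maximum, so the path is short and
  Cauchy-Schwarz bounds the energy from below.\<close>

lemma energy_ge:
  fixes s :: real
  assumes conn: "\<And>x y. x \<in> B \<Longrightarrow> y \<in> B \<Longrightarrow> (\<lambda>x y. {x, y} \<in> E)\<^sup>*\<^sup>* x y"
    and g: "dist_on g" and s: "s \<le> sq g" "2 \<le> s * card B" "0 < s"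
  shows "s\<^sup>2 * sq g / 16 \<le> (\<Sum>e\<in>E. sq g - sq (avg e g))"
proof -
  let ?P = "\<lambda>x y. {x, y} \<in> E"
  have ne: "B \<noteq> {}" using g by (auto simp: dist_on_def)
  obtain x where x: "x \<in> B" "\<And>y. y \<in> B \<Longrightarrow> g y \<le> g x"
    using Max_in[of "g ` B"] Max_ge[of "g ` B"] finite_B ne by fastforce
  define m where "m = g x"
  have nonneg: "0 \<le> g w" if "w \<in> B" for w using g that by (simp add: dist_on_def)
  have one: "(\<Sum>w\<in>B. g w) = 1" using g by (simp add: dist_on_def)
  have "sq g \<le> (\<Sum>w\<in>B. m * g w)"
    unfolding sq_def power2_eq_square using x nonneg by (intro sum_mono mult_right_mono) (auto simp: m_def)
  also have "\<dots> = m" by (simp add: one flip: sum_distrib_left)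
  finally have Ym: "sq g \<le> m" .
  have m: "0 < m" using Ym s by linarith
  \<comment> \<open>Otherwise the total mass would exceed \<open>card B * m / 2\<close>, which is at
    least \<open>card B * s / 2 \<ge> 1\<close>. This is why the ball must be large compared with
    \<open>1 / s\<close>.\<close>
  have "\<exists>y\<in>B. g y \<le> m / 2"
  proof (rule ccontr)
    assume "\<not> ?thesis"
    hence "(\<Sum>w\<in>B. m / 2) < (\<Sum>w\<in>B. g w)" using ne finite_B by (intro sum_strict_mono) auto
    hence "real (card B) * m < 2" by (simp add: one)
    moreover have "s * card B \<le> m * card B" using Ym s by (intro mult_right_mono) auto
    ultimately show False using s by (simp add: mult.commute)
  qed
  then obtain y0 where y0: "y0 \<in> B" "g y0 \<le> m / 2" by blast
  then obtain n0 where "(?P ^^ n0) x y0" using conn[OF x(1) y0(1)] by (metis rtranclp_imp_relpowp)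
  hence ex: "\<exists>n. \<exists>y. (?P ^^ n) x y \<and> g y \<le> m / 2" using y0 by blast
  define n where "n = (LEAST n. \<exists>y. (?P ^^ n) x y \<and> g y \<le> m / 2)"
  obtain y where y: "(?P ^^ n) x y" "g y \<le> m / 2" using LeastI_ex[OF ex] unfolding n_def by blast
  have least: "n \<le> k" if "(?P ^^ k) x y'" "g y' \<le> m / 2" for k y'
    unfolding n_def using that by (intro Least_le) blast
  obtain c where c: "c 0 = x" "c n = y" "\<And>i. i < n \<Longrightarrow> {c i, c (Suc i)} \<in> E"
    using y(1) unfolding relpowp_fun_conv by blast
  have reach: "(?P ^^ (j - i)) (c i) (c j)" if "i \<le> j" "j \<le> n" for i j
    unfolding relpowp_fun_conv using that c(3) by (intro exI[of _ "\<lambda>k. c (i + k)"]) auto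
  have big: "m / 2 < g (c i)" if "i < n" for i
    using least[of i "c i"] reach[of 0 i] that c(1) by force
  have inj': "c i \<noteq> c j" if "i < j" "j \<le> n" for i j
  proof
    assume eq: "c i = c j"
    have "(?P ^^ (i + (n - j))) x y"
    proof (rule relpowp_trans)
      show "(?P ^^ i) x (c j)" using reach[of 0 i] that c(1) eq by simp
      show "(?P ^^ (n - j)) (c j) y" using reach[of j n] that c(2) by simp
    qed
    thus False using least[of "i + (n - j)" y] y(2) that by auto
  qed
  have inj: "inj_on c {..n}"
    unfolding inj_on_def using inj' by (metis atMost_iff linorder_neqE_nat)
  have cB: "c i \<in> B" if "i < n" for i using edge[OF c(3)[OF that]] by auto
  have "real n * (m / 2) = (\<Sum>w\<in>c ` {..<n}. m / 2)"
    using inj by (simp add: card_image inj_on_subset lessThan_subset_iff subset_eq)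
  also have "\<dots> \<le> (\<Sum>w\<in>c ` {..<n}. g w)" using big by (intro sum_mono) (auto intro: less_imp_le)
  also have "\<dots> \<le> (\<Sum>w\<in>B. g w)" using cB nonneg finite_B by (intro sum_mono2) auto
  finally have n: "real n * m \<le> 2" by (simp add: one)
  let ?d = "\<lambda>i. g (c i) - g (c (Suc i))"
  have tel: "(\<Sum>i<n. ?d i) = m - g y"
    using sum_lessThan_telescope'[of "\<lambda>i. g (c i)" n] c by (simp add: m_def)
  have "(m / 2)\<^sup>2 \<le> (\<Sum>i<n. ?d i)\<^sup>2"
    unfolding tel using y(2) m by (intro power_mono) auto
  also have "\<dots> \<le> (\<Sum>i<n. (?d i)\<^sup>2) * n"
    using sum_squared_le_sum_of_squares[of ?d "{..<n}"] by simp
  finally have CS: "(m / 2)\<^sup>2 \<le> (\<Sum>i<n. (?d i)\<^sup>2) * n" .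
  have injE: "inj_on (\<lambda>i. {c i, c (Suc i)}) {..<n}"
  proof (rule inj_onI)
    fix i j assume ij: "i \<in> {..<n}" "j \<in> {..<n}" "{c i, c (Suc i)} = {c j, c (Suc j)}"
    hence "c i = c j \<or> c i = c (Suc j) \<and> c (Suc i) = c j" by (auto simp: doubleton_eq_iff)
    thus "i = j" using ij(1,2) by (auto simp: inj_on_eq_iff[OF inj])
  qed
  have drop_nonneg: "0 \<le> sq g - sq (avg e g)" if "e \<in> E" for e
    using sq_act_le[of "{e}" g] that by (simp add: act_def)
  have "(\<Sum>i<n. (?d i)\<^sup>2) / 2 = (\<Sum>i<n. sq g - sq (avg {c i, c (Suc i)} g))"
    using c(3) inj' by (simp add: sum_divide_distrib sq_avg)
  also have "\<dots> = (\<Sum>e\<in>(\<lambda>i. {c i, c (Suc i)}) ` {..<n}. sq g - sq (avg e g))"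
    by (simp add: sum.reindex[OF injE])
  also have "\<dots> \<le> (\<Sum>e\<in>E. sq g - sq (avg e g))"
    using c(3) drop_nonneg finite_E by (intro sum_mono2) auto
  finally have D: "(\<Sum>i<n. (?d i)\<^sup>2) \<le> 2 * (\<Sum>e\<in>E. sq g - sq (avg e g))" (is "_ \<le> 2 * ?D") by simp
  have D0: "0 \<le> ?D" using drop_nonneg by (intro sum_nonneg)
  \<comment> \<open>The constant 16 collects the following: the drop along the path is at least
    \<open>m / 2\<close>, an edge with difference \<open>d\<close> lowers \<open>sq\<close> by
    \<open>d\<^sup>2 / 2\<close>, and the path length satisfies
    \<open>n * m \<le> 2\<close>.\<close>
  have "m\<^sup>2 / 4 * m \<le> (\<Sum>i<n. (?d i)\<^sup>2) * n * m"
    using CS m by (intro mult_right_mono) (auto simp: power_divide)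
  also have "\<dots> \<le> (2 * ?D) * n * m"
    using D m by (intro mult_right_mono) auto
  also have "\<dots> = (2 * ?D) * (n * m)" by simp
  also have "\<dots> \<le> (2 * ?D) * 2" using n D0 by (intro mult_left_mono) auto
  finally have "m\<^sup>2 * m / 16 \<le> ?D" by simp
  \<comment> \<open>Of the three factors \<open>m\<close>, two are bounded below by \<open>s\<close>
    and one by \<open>sq g\<close>: linearity in \<open>sq g\<close> is what yields geometric
    decay.\<close>
  moreover have "s\<^sup>2 * sq g \<le> m\<^sup>2 * m" using s Ym by (intro mult_mono power_mono) auto
  ultimately show ?thesis by simp
qed

text \<open>\<Phi> is \<open>sq\<close> cut off to 0 below the level \<open>s\<close>. Since
  \<open>sq\<close> never increases, the cut-off is permanent, so the energy inequality makes \<Phi>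
  contract in the mean everywhere. Markov's inequality at level \<open>s\<close> then costs the
  factor \<open>1 / s\<close>.\<close>

lemma spread_tail:
  fixes r s :: real
  assumes conn: "\<And>x y. x \<in> B \<Longrightarrow> y \<in> B \<Longrightarrow> (\<lambda>x y. {x, y} \<in> E)\<^sup>*\<^sup>* x y"
    and r: "0 \<le> r" "r \<le> 1" and s: "2 \<le> s * card B" "0 < s" "s \<le> 1"
    and v: "v \<in> B"
  shows "word_sum (Pow E) (bern r E) k (\<lambda>zs. of_bool (s \<le> sq (fold act zs (indicator {v}))))
    \<le> (1 - r * (1 - r) ^ (card E - 1) * s\<^sup>2 / 16) ^ k / s"
proof -
  interpret weights "Pow E" "bern r E" by (rule weights_bern[OF finite_E r])
  define \<rho> where "\<rho> = r * (1 - r) ^ (card E - 1)"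
  define \<Phi> where "\<Phi> g = (if s \<le> sq g then sq g else 0)" for g
  have \<rho>: "0 \<le> \<rho>" "\<rho> \<le> 1"
    unfolding \<rho>_def using r by (auto intro!: mult_le_one power_le_one)
  have "\<rho> * s\<^sup>2 \<le> 1 * 1" using \<rho> s by (intro mult_mono power_le_one) auto
  hence \<kappa>: "0 \<le> 1 - \<rho> * s\<^sup>2 / 16" by simp
  have delta: "dist_on (indicator {v})" "sq (indicator {v}) = 1"
    using v finite_B by (auto simp: dist_on_def sq_def indicator_def power2_eq_square if_distrib cong: if_cong)
  have drift: "(\<Sum>z\<in>Pow E. bern r E z * \<Phi> (act z g)) \<le> (1 - \<rho> * s\<^sup>2 / 16) * \<Phi> g" if g: "dist_on g" for g
  proof (cases "s \<le> sq g")
    case True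
    have "(\<Sum>z\<in>Pow E. bern r E z * \<Phi> (act z g)) \<le> (\<Sum>z\<in>Pow E. bern r E z * sq (act z g))"
      by (intro sum_mono mult_left_mono nonneg) (auto simp: \<Phi>_def sq_def sum_nonneg)
    also have "\<dots> = sq g - \<rho> * (\<Sum>e\<in>E. sq g - sq (avg e g))"
      by (subst bern_sum_singletons[OF finite_E, of _ "sq g"])
         (auto simp: act_def \<rho>_def sum_subtractf right_diff_distrib)
    also have "\<dots> \<le> sq g - \<rho> * (s\<^sup>2 * sq g / 16)"
      using energy_ge[OF conn g True s(1,2)] \<rho> by (intro diff_left_mono mult_left_mono) auto
    finally show ?thesis using True by (simp add: \<Phi>_def algebra_simps)
  next
    case False
    hence "\<not> s \<le> sq (act z g)" if "z \<in> Pow E" for z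
      using sq_act_le[of z g] that by auto
    thus ?thesis using False by (simp add: \<Phi>_def)
  qed
  have "s * word_sum (Pow E) (bern r E) k (\<lambda>zs. of_bool (s \<le> sq (fold act zs (indicator {v}))))
     = word_sum (Pow E) (bern r E) k (\<lambda>zs. s * of_bool (s \<le> sq (fold act zs (indicator {v}))))"
    by (simp add: word_sum_cmult)
  also have "\<dots> \<le> word_sum (Pow E) (bern r E) k (\<lambda>zs. \<Phi> (fold act zs (indicator {v})))"
    by (intro word_sum_mono) (auto simp: \<Phi>_def)
  also have "\<dots> \<le> (1 - \<rho> * s\<^sup>2 / 16) ^ k * \<Phi> (indicator {v})"
    by (rule word_sum_drift[where Inv = dist_on, OF drift])
       (use delta \<kappa> in \<open>auto intro: dist_on_act\<close>)
  also have "\<Phi> (indicator {v}) = 1" using s by (simp add: \<Phi>_def delta)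
  finally show ?thesis using s by (simp add: \<rho>_def pos_le_divide_eq mult.commute)
qed

text \<open>The weight \<open>\<Sum>w\<in>S. 2 ^ rk w\<close> of an influence set grows at most exponentially in time, which
  makes far away influence unlikely.\<close>

lemma influence_tail:
  fixes rk :: "'v \<Rightarrow> nat"
  assumes r: "0 \<le> r" "r \<le> 1"
    and rk: "\<And>u w. {u, w} \<in> E \<Longrightarrow> rk u \<le> Suc (rk w)"
    and deg: "\<And>w. card {e\<in>E. w \<in> e} \<le> D"
    and v: "rk v = 0"
  shows "word_sum (Pow E) (bern r E) k (\<lambda>zs. of_bool (\<exists>w\<in>fold infl zs {v}. R \<le> rk w))
    \<le> (1 + 2 * D * r) ^ k / 2 ^ R"
proof -
  interpret weights "Pow E" "bern r E" by (rule weights_bern[OF finite_E r])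
  define \<rho> where "\<rho> = r * (1 - r) ^ (card E - 1)"
  have \<rho>: "0 \<le> \<rho>" "\<rho> \<le> r"
    unfolding \<rho>_def using r by (auto intro!: mult_left_le power_le_one)
  define W where "W S = (\<Sum>w\<in>S. 2 ^ rk w :: real)" for S
  have W0: "0 \<le> W S" for S by (simp add: W_def sum_nonneg)
  have fin_infl: "finite (infl z S)" if "finite S" "z \<in> Pow E" for z S
  proof (cases "is_singleton z")
    case True
    then obtain e where "z = {e}" by (auto simp: is_singleton_def)
    hence "finite (the_elem z)" using that edge[of e] by (auto simp: card_2_iff)
    thus ?thesis using that by (simp add: infl_def)
  qed (use that in \<open>simp add: infl_def\<close>)
  \<comment> \<open>Adjoining the other end \<open>u\<close> of an edge at \<open>w \<in> S\<close>
    raises the rank by at most one, so the new weight is at most twice that of \<open>w\<close>.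
    Summed over the edges, each \<open>w \<in> S\<close> is charged at most \<open>D\<close> times,
    which gives the growth factor \<open>1 + 2 * D * r\<close>.\<close>
  have grow: "W (infl {e} S) - W S \<le> (\<Sum>w\<in>e \<inter> S. 2 * 2 ^ rk w)" if e: "e \<in> E" and S: "finite S" for e S
  proof (cases "e \<inter> S = {}")
    case True
    thus ?thesis by (simp add: infl_def)
  next
    case False
    then obtain u w where uw: "e = {u, w}" "w \<in> S" "u \<noteq> w"
      using edge[OF e] by (auto simp: card_2_iff)
    have "W (infl {e} S) = W (insert u S)"
      using uw by (simp add: infl_def insert_absorb insert_commute)
    also have "\<dots> \<le> W S + 2 ^ rk u" using S by (cases "u \<in> S") (auto simp: W_def insert_absorb)
    also have "(2::real) ^ rk u \<le> 2 ^ Suc (rk w)"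
      using rk[of u w] e uw by (intro power_increasing) auto
    also have "(2::real) ^ Suc (rk w) \<le> (\<Sum>w\<in>e \<inter> S. 2 * 2 ^ rk w)"
      using uw S by (simp, intro member_le_sum[of w _ "\<lambda>w. 2 * 2 ^ rk w"]) auto
    finally show ?thesis by simp
  qed
  have drift: "(\<Sum>z\<in>Pow E. bern r E z * W (infl z S)) \<le> (1 + 2 * D * r) * W S" if S: "finite S" for S
  proof -
    have "(\<Sum>e\<in>E. W (infl {e} S) - W S) \<le> (\<Sum>e\<in>E. \<Sum>w\<in>e \<inter> S. 2 * 2 ^ rk w)"
      using S by (intro sum_mono grow)
    also have "\<dots> = (\<Sum>e\<in>E. \<Sum>w | w \<in> S \<and> w \<in> e. 2 * 2 ^ rk w)"
      by (intro sum.cong) auto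
    also have "\<dots> = (\<Sum>w\<in>S. \<Sum>e | e \<in> E \<and> w \<in> e. 2 * 2 ^ rk w)"
      using S finite_E by (rule sum.swap_restrict[symmetric])
    also have "\<dots> = (\<Sum>w\<in>S. real (card {e\<in>E. w \<in> e}) * (2 * 2 ^ rk w))" by simp
    also have "\<dots> \<le> (\<Sum>w\<in>S. real D * (2 * 2 ^ rk w))"
      using deg by (intro sum_mono mult_right_mono) auto
    also have "\<dots> = 2 * D * W S" by (simp add: W_def sum_distrib_left mult_ac)
    finally have *: "(\<Sum>e\<in>E. W (infl {e} S) - W S) \<le> 2 * D * W S" .
    have "(\<Sum>z\<in>Pow E. bern r E z * W (infl z S)) = W S + \<rho> * (\<Sum>e\<in>E. W (infl {e} S) - W S)"
      unfolding \<rho>_def by (rule bern_sum_singletons[OF finite_E]) (simp add: infl_def)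
    also have "\<dots> \<le> W S + \<rho> * (2 * D * W S)"
      using * \<rho> by (intro add_left_mono mult_left_mono)
    also have "\<dots> \<le> W S + r * (2 * D * W S)"
      using \<rho> W0 by (intro add_left_mono mult_right_mono) auto
    finally show ?thesis by (simp add: algebra_simps)
  qed
  have finS: "finite (fold infl zs {v})" if "zs \<in> words (Pow E) k" for zs k
  proof -
    have "set zs \<subseteq> Pow E \<Longrightarrow> finite S \<Longrightarrow> finite (fold infl zs S)" for zs S
      by (induction zs arbitrary: S) (auto intro: fin_infl)
    thus ?thesis using that by (auto simp: words_def)
  qed
  have "2 ^ R * word_sum (Pow E) (bern r E) k (\<lambda>zs. of_bool (\<exists>w\<in>fold infl zs {v}. R \<le> rk w))
     = word_sum (Pow E) (bern r E) k (\<lambda>zs. 2 ^ R * of_bool (\<exists>w\<in>fold infl zs {v}. R \<le> rk w))"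
    by (simp add: word_sum_cmult)
  also have "\<dots> \<le> word_sum (Pow E) (bern r E) k (\<lambda>zs. W (fold infl zs {v}))"
  proof (rule word_sum_mono)
    fix zs assume zs: "zs \<in> words (Pow E) k"
    show "2 ^ R * of_bool (\<exists>w\<in>fold infl zs {v}. R \<le> rk w) \<le> W (fold infl zs {v})"
    proof (cases "\<exists>w\<in>fold infl zs {v}. R \<le> rk w")
      case True
      then obtain w where w: "w \<in> fold infl zs {v}" "R \<le> rk w" by blast
      have "(2::real) ^ R \<le> 2 ^ rk w" using w by (intro power_increasing) auto
      also have "\<dots> \<le> W (fold infl zs {v})"
        unfolding W_def using w finS[OF zs] by (intro member_le_sum) auto
      finally show ?thesis using True by simp
    qed (simp add: W0)
  qed
  also have "\<dots> \<le> (1 + 2 * D * r) ^ k * W {v}"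
    by (rule word_sum_drift[where Inv = finite, OF drift]) (use r fin_infl in auto)
  also have "W {v} = 1" by (simp add: W_def v)
  finally show ?thesis by (simp add: pos_le_divide_eq mult.commute)
qed

end

section \<open>Trajectories of the averaging process\<close>

lemma edges_iff: "simple_graph adj \<Longrightarrow> {x, y} \<in> edges adj \<longleftrightarrow> adj x y"
  by (auto simp: edges_def simple_graph_def doubleton_eq_iff)

lemma card_edge: "simple_graph adj \<Longrightarrow> e \<in> edges adj \<Longrightarrow> card e = 2"
  unfolding edges_def simple_graph_def by auto (metis card_2_iff)

fun gball :: "('v \<Rightarrow> 'v \<Rightarrow> bool) \<Rightarrow> 'v \<Rightarrow> nat \<Rightarrow> 'v set" where
  "gball adj v 0 = {v}"
| "gball adj v (Suc R) = gball adj v R \<union> (\<Union>w\<in>gball adj v R. {u. adj w u})"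

text \<open>The graph distance from \<open>v\<close>, as the least radius of a ball containing
  \<open>w\<close>; the minimum exists by connectedness.\<close>

definition level :: "('v \<Rightarrow> 'v \<Rightarrow> bool) \<Rightarrow> 'v \<Rightarrow> 'v \<Rightarrow> nat" where
  "level adj v w = (LEAST R. w \<in> gball adj v R)"

definition ball_edges :: "('v \<Rightarrow> 'v \<Rightarrow> bool) \<Rightarrow> 'v \<Rightarrow> nat \<Rightarrow> 'v set set" where
  "ball_edges adj v R = {e \<in> edges adj. e \<subseteq> gball adj v R}"

lemma gball_mono: "R \<le> R' \<Longrightarrow> gball adj v R \<subseteq> gball adj v R'"
  by (induction R' rule: dec_induct) auto

lemma finite_gball:
  assumes "\<And>w. finite {u. adj w u}"
  shows "finite (gball adj v R)"
  by (induction R) (auto simp: assms)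

lemma center_in_gball [simp]: "v \<in> gball adj v R"
  by (induction R) auto

lemma ex_gball:
  assumes "graph_connected adj"
  shows "\<exists>R. w \<in> gball adj v R"
proof -
  have "adj\<^sup>*\<^sup>* v w" using assms by (simp add: graph_connected_def)
  thus ?thesis
  proof induction
    case base
    show ?case by (rule exI[of _ 0]) simp
  next
    case (step y z)
    then obtain R where "y \<in> gball adj v R" by blast
    hence "z \<in> gball adj v (Suc R)" using step by auto
    thus ?case by blast
  qed
qed

lemma level_le_iff:
  assumes "graph_connected adj"
  shows "level adj v w \<le> R \<longleftrightarrow> w \<in> gball adj v R"
proof
  assume "level adj v w \<le> R"
  moreover have "w \<in> gball adj v (level adj v w)"
    unfolding level_def by (rule LeastI_ex[OF ex_gball[OF assms]])
  ultimately show "w \<in> gball adj v R" using gball_mono[of "level adj v w" R adj v] by blast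
next
  assume "w \<in> gball adj v R"
  thus "level adj v w \<le> R" unfolding level_def by (rule Least_le)
qed

lemma level_adj_le:
  assumes "graph_connected adj" "adj w u"
  shows "level adj v u \<le> Suc (level adj v w)"
proof -
  have "w \<in> gball adj v (level adj v w)"
    using level_le_iff[OF assms(1), where R = "level adj v w"] by blast
  hence "u \<in> gball adj v (Suc (level adj v w))" using assms(2) by auto
  thus ?thesis by (rule level_le_iff[OF assms(1), THEN iffD2])
qed

text \<open>A ball that equals the next one is closed under adjacency, hence by connectedness the
  whole infinite vertex set; so each step adds a vertex.\<close>

lemma card_gball_ge:
  assumes "graph_connected adj" "\<And>w. finite {u. adj w u}" "infinite (UNIV :: 'v set)"
  shows "Suc R \<le> card (gball adj (v :: 'v) R)"
proof (induction R)
  case (Suc R)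
  have "gball adj v R \<noteq> gball adj v (Suc R)"
  proof
    assume eq: "gball adj v R = gball adj v (Suc R)"
    have "w \<in> gball adj v R" for w
    proof -
      have "adj\<^sup>*\<^sup>* v w" using assms by (simp add: graph_connected_def)
      thus ?thesis
      proof induction
        case (step y z)
        hence "z \<in> gball adj v (Suc R)" by auto
        with eq show ?case by blast
      qed simp
    qed
    hence "gball adj v R = UNIV" by blast
    moreover have "finite (gball adj v R)" by (rule finite_gball[OF assms(2)])
    ultimately show False using assms(3) by simp
  qed
  hence "gball adj v R \<subset> gball adj v (Suc R)" by auto
  hence "card (gball adj v R) < card (gball adj v (Suc R))"
    by (intro psubset_card_mono finite_gball assms)
  thus ?case using Suc by simp
qed simp

text \<open>Every vertex of the ball is joined to the centre through the smaller balls, so the path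
  never leaves the ball. Symmetry then links any two vertices through \<open>v\<close>.\<close>

lemma ball_edges_connected:
  assumes G: "simple_graph adj" and xy: "x \<in> gball adj v R" "y \<in> gball adj v R"
  shows "(\<lambda>x y. {x, y} \<in> ball_edges adj v R)\<^sup>*\<^sup>* x y"
proof -
  let ?P = "\<lambda>R x y. {x, y} \<in> ball_edges adj v R"
  have reach: "(?P R)\<^sup>*\<^sup>* v w" if "w \<in> gball adj v R" for w R
    using that
  proof (induction R arbitrary: w)
    case (Suc R)
    have sub: "?P R x y \<Longrightarrow> ?P (Suc R) x y" for x y
      by (auto simp: ball_edges_def)
    have mono: "(?P (Suc R))\<^sup>*\<^sup>* v w" if "w \<in> gball adj v R" for w
      using mono_rtranclp[of "?P R" "?P (Suc R)"] sub Suc.IH[OF that] by blast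
    show ?case
    proof (cases "w \<in> gball adj v R")
      case False
      then obtain u where u: "u \<in> gball adj v R" "adj u w" using Suc.prems by auto
      hence "?P (Suc R) u w" using Suc.prems G by (auto simp: ball_edges_def edges_iff)
      thus ?thesis using mono[OF u(1)] by (rule rtranclp.rtrancl_into_rtrancl[rotated])
    qed (rule mono)
  qed simp
  have "symp (?P R)" by (auto simp: symp_def insert_commute)
  hence "(?P R)\<^sup>*\<^sup>* x v" using reach[OF xy(1)] by (meson symp_rtranclp sympD)
  thus ?thesis using reach[OF xy(2)] by (rule rtranclp_trans)
qed

lemma finite_graph_ball:
  assumes "simple_graph adj" "\<And>w. finite {u. adj w u}"
  shows "finite_graph (gball adj v R) (ball_edges adj v R)"
proof
  show "finite (gball adj v R)" by (rule finite_gball) (rule assms)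
qed (auto simp: ball_edges_def card_edge[OF assms(1)])

lemma card_ball_edges_at_le:
  assumes G: "simple_graph adj" and fin: "finite {u. adj w u}" and D: "card {u. adj w u} \<le> D"
  shows "card {e \<in> ball_edges adj v R. w \<in> e} \<le> D"
proof -
  have "{e \<in> ball_edges adj v R. w \<in> e} \<subseteq> (\<lambda>u. {w, u}) ` {u. adj w u}"
    using G by (auto simp: ball_edges_def edges_def simple_graph_def)
  hence "card {e \<in> ball_edges adj v R. w \<in> e} \<le> card {u. adj w u}"
    using fin by (meson card_image_le card_mono finite_imageI order_trans)
  thus ?thesis using D by simp
qed

section \<open>Deterministic analysis of a single path\<close>

lemma edge_averaging_const:
  assumes "edge_averaging adj \<tau> f \<omega>" "0 \<le> s" "s \<le> t"
    and "\<And>y q. adj x y \<Longrightarrow> rings_at \<tau> {x, y} \<omega> q \<Longrightarrow> s < q \<Longrightarrow> q \<le> t \<Longrightarrow> False"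
  shows "f t x \<omega> = f s x \<omega>"
  using assms unfolding edge_averaging_def by blast

lemma edge_averaging_ring:
  assumes "edge_averaging adj \<tau> f \<omega>" "adj u x" "0 < t" "rings_at \<tau> {u, x} \<omega> t"
  shows "f t x \<omega> = (Lim (at_left t) (\<lambda>s. f s u \<omega>) + Lim (at_left t) (\<lambda>s. f s x \<omega>)) / 2"
  using assms unfolding edge_averaging_def by blast

lemma Lim_at_left_eventually_const:
  fixes g :: "real \<Rightarrow> real"
  assumes "a < t" "\<And>s. a \<le> s \<Longrightarrow> s < t \<Longrightarrow> g s = c"
  shows "Lim (at_left t) g = c"
proof (rule tendsto_Lim)
  have "eventually (\<lambda>s. s \<in> {a<..<t}) (at_left t)" by (rule eventually_at_left_real[OF assms(1)])
  hence "eventually (\<lambda>s. c = g s) (at_left t)" by eventually_elim (use assms in auto)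
  thus "(g \<longlongrightarrow> c) (at_left t)" by (rule Lim_transform_eventually[OF tendsto_const])
qed (simp add: trivial_limit_at_left_real)

text \<open>Averaging is idempotent: the first ring of \<open>{x, u}\<close> gives both ends the
  common mean, and further rings of the same edge preserve it. Finiteness of the ring set is what
  makes the left limits computable, because the opinions are constant between consecutive
  rings.\<close>

lemma edge_averaging_single_edge:
  assumes EA: "edge_averaging adj \<tau> f \<omega>" and G: "simple_graph adj" and xu: "adj x u"
    and s: "0 \<le> s"
    and x: "\<And>y q. adj x y \<Longrightarrow> y \<noteq> u \<Longrightarrow> rings_at \<tau> {x, y} \<omega> q \<Longrightarrow> s < q \<Longrightarrow> q \<le> t \<Longrightarrow> False"
    and u: "\<And>y q. adj u y \<Longrightarrow> y \<noteq> x \<Longrightarrow> rings_at \<tau> {u, y} \<omega> q \<Longrightarrow> s < q \<Longrightarrow> q \<le> t \<Longrightarrow> False"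
    and fin: "finite {q. s < q \<and> q \<le> t \<and> rings_at \<tau> {x, u} \<omega> q}"
    and r: "s \<le> r" "r \<le> t"
  shows "if \<exists>q. s < q \<and> q \<le> r \<and> rings_at \<tau> {x, u} \<omega> q
    then f r x \<omega> = (f s x \<omega> + f s u \<omega>) / 2 \<and> f r u \<omega> = (f s x \<omega> + f s u \<omega>) / 2
    else f r x \<omega> = f s x \<omega> \<and> f r u \<omega> = f s u \<omega>"
proof -
  let ?F = "\<lambda>r. {q. s < q \<and> q \<le> r \<and> rings_at \<tau> {x, u} \<omega> q}"
  have ux: "adj u x" using G xu by (simp add: simple_graph_def)
  have const: "f b x \<omega> = f a x \<omega>" "f b u \<omega> = f a u \<omega>"
    if ab: "s \<le> a" "a \<le> b" "b \<le> t" and no: "\<And>q. q \<in> ?F b \<Longrightarrow> q \<le> a" for a b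
  proof -
    have no': "\<not> rings_at \<tau> {x, u} \<omega> q" "\<not> rings_at \<tau> {u, x} \<omega> q" if "a < q" "q \<le> b" for q
      using no[of q] that ab by (auto simp: insert_commute[of u x])
    show "f b x \<omega> = f a x \<omega>"
    proof (rule edge_averaging_const[OF EA])
      fix y q assume "adj x y" "rings_at \<tau> {x, y} \<omega> q" "a < q" "q \<le> b"
      thus False using x[of y q] no'[of q] ab by (cases "y = u") auto
    qed (use s ab in auto)
    show "f b u \<omega> = f a u \<omega>"
    proof (rule edge_averaging_const[OF EA])
      fix y q assume "adj u y" "rings_at \<tau> {u, y} \<omega> q" "a < q" "q \<le> b"
      thus False using u[of y q] no'[of q] ab by (cases "y = x") auto
    qed (use s ab in auto)
  qed
  have "if ?F r \<noteq> {} then f r x \<omega> = (f s x \<omega> + f s u \<omega>) / 2 \<and> f r u \<omega> = (f s x \<omega> + f s u \<omega>) / 2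
    else f r x \<omega> = f s x \<omega> \<and> f r u \<omega> = f s u \<omega>"
    using r
  proof (induction "card (?F r)" arbitrary: r rule: less_induct)
    case less
    have finr: "finite (?F r)" by (rule finite_subset[OF _ fin]) (use less.prems in auto)
    show ?case
    proof (cases "?F r = {}")
      case True
      have "f r x \<omega> = f s x \<omega>" "f r u \<omega> = f s u \<omega>"
        using const[of s r] less.prems True by blast+
      thus ?thesis using True by simp
    next
      case False
      define q where "q = Max (?F r)"
      have q: "q \<in> ?F r" unfolding q_def by (rule Max_in[OF finr False])
      have qmax: "p \<le> q" if "p \<in> ?F r" for p unfolding q_def by (rule Max_ge[OF finr that])
      \<comment> \<open>The ring preceding \<open>q\<close>, or the starting time \<open>s\<close>
        if there is none; on the interval from \<open>q'\<close> up to \<open>q\<close> both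
        opinions are constant.\<close>
      define q' where "q' = Max (insert s (?F r - {q}))"
      have q': "q' \<in> insert s (?F r - {q})" unfolding q'_def using finr by (intro Max_in) auto
      have q'max: "p \<le> q'" if "p \<in> ?F r" "p \<noteq> q" for p unfolding q'_def using finr that by (intro Max_ge) auto
      have sq': "s \<le> q'" using q' by auto
      have q'q: "q' < q" using q' q qmax[of q'] by auto
      have rq: "f r x \<omega> = f q x \<omega>" "f r u \<omega> = f q u \<omega>"
      proof -
        have "s \<le> q" "q \<le> r" using q by auto
        thus "f r x \<omega> = f q x \<omega>" "f r u \<omega> = f q u \<omega>" using const[of q r] less.prems qmax by blast+
      qed
      have seg: "f b x \<omega> = f q' x \<omega>" "f b u \<omega> = f q' u \<omega>" if "q' \<le> b" "b < q" for b
      proof -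
        have "p \<le> q'" if "p \<in> ?F b" for p
          using q'max[of p] that \<open>b < q\<close> q by auto
        moreover have "b \<le> t" using that q less.prems by simp
        ultimately show "f b x \<omega> = f q' x \<omega>" "f b u \<omega> = f q' u \<omega>"
          using const[OF sq' that(1)] by blast+
      qed
      have lim: "Lim (at_left q) (\<lambda>b. f b x \<omega>) = f q' x \<omega>" "Lim (at_left q) (\<lambda>b. f b u \<omega>) = f q' u \<omega>"
        by (rule Lim_at_left_eventually_const[OF q'q], erule (1) seg)+
      have "f q x \<omega> = (f q' u \<omega> + f q' x \<omega>) / 2" "f q u \<omega> = (f q' x \<omega> + f q' u \<omega>) / 2"
      proof -
        have "0 < q" "rings_at \<tau> {x, u} \<omega> q" using q s by auto
        moreover from this have "rings_at \<tau> {u, x} \<omega> q" by (simp only: insert_commute)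
        ultimately show "f q x \<omega> = (f q' u \<omega> + f q' x \<omega>) / 2" "f q u \<omega> = (f q' x \<omega> + f q' u \<omega>) / 2"
          using edge_averaging_ring[OF EA ux, of q] edge_averaging_ring[OF EA xu, of q]
          unfolding lim by blast+
      qed
      \<comment> \<open>By the induction hypothesis at \<open>q'\<close>, which has fewer rings
        before it, both opinions are either the initial ones or already the mean; their average is
        the same in either case.\<close>
      moreover have "(f q' x \<omega> + f q' u \<omega>) / 2 = (f s x \<omega> + f s u \<omega>) / 2"
      proof -
        have "q' \<le> r" using q q'q by simp
        hence "?F q' \<subseteq> ?F r" by (intro Collect_mono) auto
        moreover have "q \<in> ?F r" "q \<notin> ?F q'" using q q'q by simp_all
        ultimately have "?F q' \<subset> ?F r" by blast
        hence "card (?F q') < card (?F r)" by (rule psubset_card_mono[OF finr])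
        moreover have "q' \<le> t" using \<open>q' \<le> r\<close> less.prems by simp
        ultimately have "if ?F q' \<noteq> {} then f q' x \<omega> = (f s x \<omega> + f s u \<omega>) / 2 \<and> f q' u \<omega> = (f s x \<omega> + f s u \<omega>) / 2
          else f q' x \<omega> = f s x \<omega> \<and> f q' u \<omega> = f s u \<omega>"
          using less.hyps sq' by blast
        thus ?thesis by (cases "?F q' = {}") simp_all
      qed
      ultimately show ?thesis using False rq by (simp add: add.commute)
    qed
  qed
  moreover have "?F r \<noteq> {} \<longleftrightarrow> (\<exists>q. s < q \<and> q \<le> r \<and> rings_at \<tau> {x, u} \<omega> q)" by auto
  ultimately show ?thesis by (simp only:)
qed

text \<open>In a cell without collision, \<open>x\<close> is touched by at most one edge
  \<open>e\<close>. If so, both ends of \<open>e\<close> lie in \<open>infl z S\<close>, where every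
  incident edge belongs to \<open>E\<close>, so \<open>z\<close> records every ring that could
  interfere. The second conclusion reduces continuous time to grid times.\<close>

lemma edge_averaging_cell:
  assumes EA: "edge_averaging adj \<tau> f \<omega>" and G: "simple_graph adj" and E: "E \<subseteq> edges adj"
    and z: "z = {e \<in> E. \<exists>q. s < q \<and> q \<le> t \<and> rings_at \<tau> e \<omega> q}" "z = {} \<or> is_singleton z"
    and s: "0 \<le> s" and x: "x \<in> S" and int: "\<And>y u. y \<in> infl z S \<Longrightarrow> adj y u \<Longrightarrow> {y, u} \<in> E"
    and fin: "\<And>e. e \<in> E \<Longrightarrow> finite {q. s < q \<and> q \<le> t \<and> rings_at \<tau> e \<omega> q}"
    and r: "s \<le> r" "r \<le> t"
  shows "f t x \<omega> = act z (\<lambda>w. f s w \<omega>) x" "f r x \<omega> = f s x \<omega> \<or> f r x \<omega> = f t x \<omega>"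
proof -
  have xS: "x \<in> infl z S" using x by (auto simp: infl_def)
  have "f t x \<omega> = act z (\<lambda>w. f s w \<omega>) x \<and> (f r x \<omega> = f s x \<omega> \<or> f r x \<omega> = f t x \<omega>)"
  proof (cases "\<exists>e. z = {e} \<and> x \<in> e")
    case False
    have no: False if "adj x y" "rings_at \<tau> {x, y} \<omega> q" "s < q" "q \<le> t" for y q
    proof -
      have "{x, y} \<in> z" using int[OF xS that(1)] that z(1) by auto
      hence "z = {{x, y}}" using z(2) by (auto simp: is_singleton_def)
      thus False using False by auto
    qed
    have "f b x \<omega> = f s x \<omega>" if "s \<le> b" "b \<le> t" for b
    proof (rule edge_averaging_const[OF EA s that(1)])
      fix y q assume "adj x y" "rings_at \<tau> {x, y} \<omega> q" "s < q" "q \<le> b"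
      thus False using no[of y q] that(2) by simp
    qed
    moreover have "act z (\<lambda>w. f s w \<omega>) x = f s x \<omega>"
      using False by (auto simp: act_def avg_def is_singleton_def)
    moreover have "f t x \<omega> = f s x \<omega>" "f r x \<omega> = f s x \<omega>" using calculation(1)[of t] calculation(1)[of r] r by simp_all
    ultimately show ?thesis by simp
  next
    case True
    then obtain e where e: "z = {e}" "x \<in> e" by blast
    hence "e \<in> E" using z by auto
    hence "e \<in> edges adj" using E by auto
    then obtain u where u: "e = {x, u}" "adj x u"
      using e G by (auto simp: edges_def simple_graph_def insert_commute)
    have uS: "u \<in> infl z S" using e u x by (auto simp: infl_def)
    have xu: "x \<noteq> u" using G u by (auto simp: simple_graph_def)
    have only: "{a, b} = e" if "a \<in> infl z S" "adj a b" "rings_at \<tau> {a, b} \<omega> q" "s < q" "q \<le> t" for a b q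
    proof -
      have "{a, b} \<in> z" using int[OF that(1,2)] that z(1) by auto
      thus ?thesis using e by simp
    qed
    have single: "if \<exists>q. s < q \<and> q \<le> b \<and> rings_at \<tau> {x, u} \<omega> q
      then f b x \<omega> = (f s x \<omega> + f s u \<omega>) / 2 \<and> f b u \<omega> = (f s x \<omega> + f s u \<omega>) / 2
      else f b x \<omega> = f s x \<omega> \<and> f b u \<omega> = f s u \<omega>" if b: "s \<le> b" "b \<le> t" for b
    proof (rule edge_averaging_single_edge[OF EA G u(2) s _ _ _ b])
      show False if "adj x y" "y \<noteq> u" "rings_at \<tau> {x, y} \<omega> q" "s < q" "q \<le> t" for y q
        using only[OF xS that(1,3-5)] that(2) u xu by (auto simp: doubleton_eq_iff)
      show False if "adj u y" "y \<noteq> x" "rings_at \<tau> {u, y} \<omega> q" "s < q" "q \<le> t" for y q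
        using only[OF uS that(1,3-5)] that(2) u xu by (auto simp: doubleton_eq_iff)
      show "finite {q. s < q \<and> q \<le> t \<and> rings_at \<tau> {x, u} \<omega> q}" using fin \<open>e \<in> E\<close> u by simp
    qed
    have "\<exists>q. s < q \<and> q \<le> t \<and> rings_at \<tau> {x, u} \<omega> q" using e z u by blast
    hence "f t x \<omega> = (f s x \<omega> + f s u \<omega>) / 2" using single[of t] r by simp
    moreover have "act z (\<lambda>w. f s w \<omega>) x = (f s x \<omega> + f s u \<omega>) / 2"
      using e u xu by (simp add: act_def avg_def)
    ultimately show ?thesis using single[OF r] by (auto split: if_splits)
  qed
  thus "f t x \<omega> = act z (\<lambda>w. f s w \<omega>) x" "f r x \<omega> = f s x \<omega> \<or> f r x \<omega> = f t x \<omega>" by auto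
qed

definition cell_rings :: "('e \<Rightarrow> nat \<Rightarrow> 'a \<Rightarrow> real) \<Rightarrow> real \<Rightarrow> 'e set \<Rightarrow> nat \<Rightarrow> 'a \<Rightarrow> 'e set" where
  "cell_rings \<tau> h E j \<omega> = {e \<in> E. \<exists>n. h * j < ring_time \<tau> e n \<omega> \<and> ring_time \<tau> e n \<omega> \<le> h * Suc j}"

definition ring_word :: "('e \<Rightarrow> nat \<Rightarrow> 'a \<Rightarrow> real) \<Rightarrow> real \<Rightarrow> 'e set \<Rightarrow> nat \<Rightarrow> 'a \<Rightarrow> 'e set list" where
  "ring_word \<tau> h E N \<omega> = map (\<lambda>j. cell_rings \<tau> h E j \<omega>) [0..<N]"

lemma ring_word_in_words: "ring_word \<tau> h E N \<omega> \<in> words (Pow E) N"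
  by (auto simp: ring_word_def words_def cell_rings_def)

lemma infl_superset: "S \<subseteq> infl z S"
  by (auto simp: infl_def)

lemma fold_infl_superset: "S \<subseteq> fold infl zs S"
proof (induction zs arbitrary: S)
  case (Cons z zs)
  show ?case using Cons[of "infl z S"] infl_superset[of S z] by auto
qed simp

text \<open>The process on the infinite graph agrees with the finite one only on a shrinking set of
  vertices: those that can still influence \<open>v\<close> by time \<open>h * N\<close>. On this
  set, agreement at the grid times follows by induction forward in time.\<close>

lemma edge_averaging_eq_fold_act:
  assumes EA: "edge_averaging adj \<tau> f \<omega>" and G: "simple_graph adj" and E: "E \<subseteq> edges adj"
    and h: "0 < h" and zs: "zs = ring_word \<tau> h E N \<omega>"
    and nocoll: "\<And>z. z \<in> set zs \<Longrightarrow> z = {} \<or> is_singleton z"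
    and int: "\<And>x u. x \<in> fold infl (rev zs) {v} \<Longrightarrow> adj x u \<Longrightarrow> {x, u} \<in> E"
    and fin: "\<And>e t. e \<in> E \<Longrightarrow> finite {n. ring_time \<tau> e n \<omega> \<le> t}"
    and t: "h * m \<le> t" "t \<le> h * N"
  shows "\<exists>j\<in>{m..N}. f t v \<omega> = fold act (take j zs) (\<lambda>w. f 0 w \<omega>) v"
proof -
  have len: "length zs = N" by (simp add: zs ring_word_def)
  have nth: "zs ! j = cell_rings \<tau> h E j \<omega>" if "j < N" for j
    using that by (simp add: zs ring_word_def)
  \<comment> \<open>The vertices whose opinions at time \<open>h * j\<close> can still matter for
    \<open>v\<close> at the end. The letters after time \<open>h * j\<close> are read backwards, so
    \<open>S\<close> decreases in \<open>j\<close> down to \<open>{v}\<close> at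
    \<open>j = N\<close>.\<close>
  define S where "S j = fold infl (rev (drop j zs)) {v}" for j
  have S_Suc: "S j = infl (zs ! j) (S (Suc j))" if "j < N" for j
    using that len by (simp add: S_def Cons_nth_drop_Suc[symmetric])
  have S_le: "S j \<subseteq> fold infl (rev zs) {v}" for j
  proof -
    have "rev zs = rev (drop j zs) @ rev (take j zs)" by (simp flip: rev_append)
    thus ?thesis using fold_infl_superset[of "S j" "rev (take j zs)"] by (simp add: S_def)
  qed
  have vS: "v \<in> S j" for j using fold_infl_superset[of "{v}"] by (auto simp: S_def)
  have cell: "f (h * Suc j) x \<omega> = act (zs ! j) (\<lambda>w. f (h * j) w \<omega>) x"
    "f r x \<omega> = f (h * j) x \<omega> \<or> f r x \<omega> = f (h * Suc j) x \<omega>"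
    if j: "j < N" and x: "x \<in> S (Suc j)" and r: "h * j \<le> r" "r \<le> h * Suc j" for j x r
  proof -
    have z: "zs ! j = {e \<in> E. \<exists>q. h * j < q \<and> q \<le> h * Suc j \<and> rings_at \<tau> e \<omega> q}"
      unfolding nth[OF j] cell_rings_def rings_at_def by auto
    have fin': "finite {q. h * j < q \<and> q \<le> h * Suc j \<and> rings_at \<tau> e \<omega> q}" if "e \<in> E" for e
    proof (rule finite_subset)
      show "{q. h * j < q \<and> q \<le> h * Suc j \<and> rings_at \<tau> e \<omega> q}
        \<subseteq> (\<lambda>n. ring_time \<tau> e n \<omega>) ` {n. ring_time \<tau> e n \<omega> \<le> h * Suc j}"
        by (auto simp: rings_at_def)
      show "finite ((\<lambda>n. ring_time \<tau> e n \<omega>) ` {n. ring_time \<tau> e n \<omega> \<le> h * Suc j})"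
        using fin[OF that] by blast
    qed
    have nc: "zs ! j = {} \<or> is_singleton (zs ! j)" using nocoll j len by simp
    have int': "{y, u} \<in> E" if "y \<in> infl (zs ! j) (S (Suc j))" "adj y u" for y u
      using int that S_le[of j] S_Suc[OF j] by blast
    note * = edge_averaging_cell[OF EA G E z nc _ x int' fin' r]
    show "f (h * Suc j) x \<omega> = act (zs ! j) (\<lambda>w. f (h * j) w \<omega>) x"
      "f r x \<omega> = f (h * j) x \<omega> \<or> f r x \<omega> = f (h * Suc j) x \<omega>"
      using * h by auto
  qed
  have grid: "\<forall>x\<in>S j. f (h * j) x \<omega> = fold act (take j zs) (\<lambda>w. f 0 w \<omega>) x" if "j \<le> N" for j
    using that
  proof (induction j)
    case (Suc j)
    show ?case
    proof
      fix x assume x: "x \<in> S (Suc j)"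
      have j: "j < N" using Suc.prems by simp
      let ?g = "fold act (take j zs) (\<lambda>w. f 0 w \<omega>)"
      have IH: "f (h * j) w \<omega> = ?g w" if "w \<in> S j" for w using Suc that by auto
      have "f (h * Suc j) x \<omega> = act (zs ! j) (\<lambda>w. f (h * j) w \<omega>) x"
        using cell(1)[OF j x, of "h * j"] h by simp
      also have "\<dots> = act (zs ! j) ?g x"
      proof (cases "is_singleton (zs ! j)")
        case True
        then obtain e where e: "zs ! j = {e}" by (auto simp: is_singleton_def)
        have "x \<in> S j" "x \<in> e \<Longrightarrow> e \<subseteq> S j"
          using S_Suc[OF j] x by (auto simp: e infl_def)
        have "avg e (\<lambda>w. f (h * j) w \<omega>) x = avg e ?g x"
        proof (cases "x \<in> e")
          case True
          hence "(\<Sum>u\<in>e. f (h * j) u \<omega>) = (\<Sum>u\<in>e. ?g u)"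
            using \<open>x \<in> e \<Longrightarrow> e \<subseteq> S j\<close> by (intro sum.cong refl IH) auto
          thus ?thesis using True by (simp add: avg_def)
        next
          case False
          thus ?thesis using IH[OF \<open>x \<in> S j\<close>] by (simp add: avg_def)
        qed
        thus ?thesis by (simp add: act_def e)
      next
        case False
        have "x \<in> S j" using S_Suc[OF j] x infl_superset[of "S (Suc j)" "zs ! j"] by (simp only: subset_iff)
        thus ?thesis using False IH[of x] by (simp add: act_def)
      qed
      also have "\<dots> = fold act (take (Suc j) zs) (\<lambda>w. f 0 w \<omega>) x"
        using j len by (simp add: take_Suc_conv_app_nth)
      finally show "f (h * Suc j) x \<omega> = fold act (take (Suc j) zs) (\<lambda>w. f 0 w \<omega>) x" .
    qed
  qed simp
  show ?thesis
  \<comment> \<open>The right end is treated apart because the index \<open>N\<close> obtained by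
    rounding down would not be that of a cell.\<close>
  proof (cases "t = h * N")
    case True
    have "h * m \<le> h * N" using t by simp
    hence "m \<le> N" using h by simp
    moreover have "f t v \<omega> = fold act (take N zs) (\<lambda>w. f 0 w \<omega>) v"
      using grid[of N] vS[of N] True by blast
    ultimately show ?thesis by force
  next
    case False
    define j where "j = nat \<lfloor>t / h\<rfloor>"
    have "0 \<le> h * m" using h by simp
    hence "0 \<le> t" using t(1) by linarith
    hence t0: "0 \<le> t / h" using h by simp
    have jj: "real j \<le> t / h" "t / h < real j + 1" using t0 by (auto simp: j_def)
    have jt: "h * j \<le> t" "t \<le> h * Suc j" using jj h by (auto simp: field_simps)
    have "m \<le> j" unfolding j_def using t h by (simp add: le_nat_floor field_simps)
    moreover have "j < N"
    proof -
      have "real j \<le> t / h" by fact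
      also have "\<dots> < N" using False t h by (simp add: field_simps)
      finally show ?thesis by simp
    qed
    moreover have "f t v \<omega> = f (h * j) v \<omega> \<or> f t v \<omega> = f (h * Suc j) v \<omega>"
      by (rule cell(2)[OF \<open>j < N\<close> vS jt])
    moreover have "f (h * j) v \<omega> = fold act (take j zs) (\<lambda>w. f 0 w \<omega>) v"
      using bspec[OF grid vS] \<open>j < N\<close> by simp
    moreover have "f (h * Suc j) v \<omega> = fold act (take (Suc j) zs) (\<lambda>w. f 0 w \<omega>) v"
      using \<open>j < N\<close> by (intro bspec[OF grid vS]) simp
    moreover have "j \<in> {m..N}" "Suc j \<in> {m..N}" using \<open>m \<le> j\<close> \<open>j < N\<close> by auto
    ultimately show ?thesis by metis
  qed
qed

section \<open>The law of the ring pattern\<close>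

locale clocked_opinions = prob_space M for M :: "'a measure" +
  fixes adj :: "'v \<Rightarrow> 'v \<Rightarrow> bool" and \<tau> :: "'v set \<Rightarrow> nat \<Rightarrow> 'a \<Rightarrow> real"
    and X :: "'v \<Rightarrow> 'a \<Rightarrow> real"
  assumes clock_dist: "e \<in> edges adj \<Longrightarrow> distributed M lborel (\<tau> e k) (exponential_density 1)"
    and indep: "indep_vars (\<lambda>_. borel) (\<lambda>i. case i of Inl v \<Rightarrow> X v | Inr (e, k) \<Rightarrow> \<tau> e k)
           (range Inl \<union> Inr ` (edges adj \<times> UNIV))"
begin

abbreviation family :: "'v + 'v set \<times> nat \<Rightarrow> 'a \<Rightarrow> real" where
  "family i \<equiv> case i of Inl v \<Rightarrow> X v | Inr (e, k) \<Rightarrow> \<tau> e k"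

lemma measurable_X [measurable]: "X v \<in> borel_measurable M"
proof -
  have "family (Inl v) \<in> borel_measurable M"
    using indep unfolding indep_vars_def by blast
  thus ?thesis by simp
qed

lemma measurable_clock: "e \<in> edges adj \<Longrightarrow> \<tau> e k \<in> borel_measurable M"
  using distributed_measurable[OF clock_dist[of e k]] by simp

lemma distr_clock_time: "e \<in> edges adj \<Longrightarrow> distr M borel (\<tau> e k) = expo"
  using distributed_distr_eq_density[OF clock_dist[of e k]]
  by (simp add: expo_def cong: distr_cong)

lemma distr_clock:
  assumes e: "e \<in> edges adj"
  shows "distr M clock (\<lambda>\<omega> k. \<tau> e k \<omega>) = clock"
proof -
  define I :: "('v + 'v set \<times> nat) set" where "I = Inr ` ({e} \<times> UNIV)"
  have sub: "I \<subseteq> range Inl \<union> Inr ` (edges adj \<times> UNIV)" using e by (auto simp: I_def)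
  have meas: "family i \<in> borel_measurable M" if "i \<in> I" for i
    using that measurable_clock[OF e] by (auto simp: I_def)
  have d: "distr M borel (family i) = expo" if "i \<in> I" for i
    using that distr_clock_time[OF e] by (auto simp: I_def)
  have "distr M (Pi\<^sub>M I (\<lambda>_. borel)) (\<lambda>\<omega>. \<lambda>i\<in>I. family i \<omega>) = Pi\<^sub>M I (\<lambda>i. distr M borel (family i))"
  proof (rule indep_vars_iff_distr_eq_PiM'[where I = I and M' = "\<lambda>_. borel" and X = family, THEN iffD1])
    show "I \<noteq> {}" by (simp add: I_def)
    show "indep_vars (\<lambda>_. borel) family I" by (rule indep_vars_subset[OF indep sub])
  qed (rule meas)
  also have "\<dots> = Pi\<^sub>M I (\<lambda>_. expo)" by (intro PiM_cong refl d)
  finally have joint: "distr M (Pi\<^sub>M I (\<lambda>_. borel)) (\<lambda>\<omega>. \<lambda>i\<in>I. family i \<omega>) = Pi\<^sub>M I (\<lambda>_. expo)" .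
  have proj: "(\<lambda>x k. x (Inr (e, k))) \<in> measurable (Pi\<^sub>M I (\<lambda>_. borel)) clock"
    by (rule measurable_PiM_single') (auto simp: I_def PiE_UNIV_domain intro!: measurable_component_singleton)
  have "distr M clock (\<lambda>\<omega> k. \<tau> e k \<omega>)
     = distr (distr M (Pi\<^sub>M I (\<lambda>_. borel)) (\<lambda>\<omega>. \<lambda>i\<in>I. family i \<omega>)) clock (\<lambda>x k. x (Inr (e, k)))"
  proof -
    have "(\<lambda>\<omega>. \<lambda>i\<in>I. family i \<omega>) \<in> measurable M (Pi\<^sub>M I (\<lambda>_. borel))"
      by (rule measurable_restrict) (rule meas)
    note distr_distr[OF proj this]
    moreover have "(\<lambda>x k. x (Inr (e, k))) \<circ> (\<lambda>\<omega>. \<lambda>i\<in>I. family i \<omega>) = (\<lambda>\<omega> k. \<tau> e k \<omega>)"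
      by (simp add: fun_eq_iff I_def)
    ultimately show ?thesis by (simp only:)
  qed
  also have "\<dots> = distr (Pi\<^sub>M I (\<lambda>_. expo)) (Pi\<^sub>M UNIV (\<lambda>k::nat. expo)) (\<lambda>x. \<lambda>k\<in>UNIV. x (Inr (e, k)))"
    by (simp only: joint restrict_UNIV)
  also have "\<dots> = clock"
    using distr_PiM_reindex[of I "\<lambda>_. expo" "\<lambda>k. Inr (e, k)" UNIV] prob_space_expo
    by (auto simp: I_def inj_on_def)
  finally show ?thesis .
qed

lemma measurable_clock_seq: "e \<in> edges adj \<Longrightarrow> (\<lambda>\<omega> k. \<tau> e k \<omega>) \<in> measurable M clock"
  by (rule measurable_PiM_single') (simp_all add: PiE_UNIV_domain measurable_cong_sets[OF refl sets_expo] measurable_clock)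

lemma ring_time_arrival: "ring_time \<tau> e n \<omega> = arrival (\<lambda>k. \<tau> e k \<omega>) n"
  by (simp add: ring_time_def arrival_def)

lemma AE_ring_times_finite:
  assumes e: "e \<in> edges adj"
  shows "AE \<omega> in M. \<forall>t. finite {n. ring_time \<tau> e n \<omega> \<le> t}"
proof -
  have "AE x in clock. \<forall>t. finite {n. arrival x n \<le> t}"
    using AE_clock_pos AE_clock_unbounded
  proof eventually_elim
    case (elim x)
    show ?case
    proof
      fix t
      obtain m where m: "t < arrival x m" using elim by blast
      have "n < m" if "arrival x n \<le> t" for n
        using arrival_mono[OF elim(1), of m n] that m by (cases "m \<le> n") auto
      hence "{n. arrival x n \<le> t} \<subseteq> {..<m}" by auto
      thus "finite {n. arrival x n \<le> t}" by (rule finite_subset) simp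
    qed
  qed
  hence "AE x in distr M clock (\<lambda>\<omega> k. \<tau> e k \<omega>). \<forall>t. finite {n. arrival x n \<le> t}"
    by (simp only: distr_clock[OF e])
  from AE_distrD[OF measurable_clock_seq[OF e] this] show ?thesis
    by (simp add: ring_time_arrival)
qed

lemma prob_ring_pattern:
  assumes "e \<in> edges adj" "0 < h"
  shows "prob {\<omega>\<in>space M. ring_pattern h bs (\<lambda>k. \<tau> e k \<omega>)}
    = (\<Prod>b\<leftarrow>bs. if b then 1 - exp (- h) else exp (- h))"
proof -
  have "measure clock {x. ring_pattern h bs x}
     = measure (distr M clock (\<lambda>\<omega> k. \<tau> e k \<omega>)) {x. ring_pattern h bs x}"
    by (simp add: distr_clock[OF assms(1)])
  also have "\<dots> = prob ((\<lambda>\<omega> k. \<tau> e k \<omega>) -` {x. ring_pattern h bs x} \<inter> space M)"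
    by (intro measure_distr measurable_clock_seq assms sets_clock_Collect) measurable
  also have "(\<lambda>\<omega> k. \<tau> e k \<omega>) -` {x. ring_pattern h bs x} \<inter> space M = {\<omega>\<in>space M. ring_pattern h bs (\<lambda>k. \<tau> e k \<omega>)}"
    by auto
  finally show ?thesis using measure_ring_pattern[OF assms(2)] by simp
qed

text \<open>A word of edge sets is a 0-1 table of cells against edges. The ring word reads it cell
  by cell, the ring patterns edge by edge; the second reading exposes the independence of different
  clocks.\<close>

lemma ring_word_eq_iff:
  assumes "zs \<in> words (Pow E) N"
  shows "ring_word \<tau> h E N \<omega> = zs \<longleftrightarrow> (\<forall>e\<in>E. ring_pattern h (map (\<lambda>z. e \<in> z) zs) (\<lambda>k. \<tau> e k \<omega>))"
proof -
  have len: "length zs = N" using assms by (simp add: words_def)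
  have sub: "zs ! j \<subseteq> E" if "j < N" for j
  proof -
    have "set zs \<subseteq> Pow E" "zs ! j \<in> set zs" using assms that by (simp_all add: words_def)
    thus ?thesis by blast
  qed
  have "ring_word \<tau> h E N \<omega> = zs \<longleftrightarrow> (\<forall>j<N. cell_rings \<tau> h E j \<omega> = zs ! j)"
    by (auto simp: list_eq_iff_nth_eq ring_word_def len)
  also have "\<dots> \<longleftrightarrow> (\<forall>j<N. \<forall>e\<in>E. e \<in> zs ! j \<longleftrightarrow>
      (\<exists>n. h * j < arrival (\<lambda>k. \<tau> e k \<omega>) n \<and> arrival (\<lambda>k. \<tau> e k \<omega>) n \<le> h * Suc j))"
    unfolding cell_rings_def ring_time_arrival using sub by blast
  also have "\<dots> \<longleftrightarrow> (\<forall>e\<in>E. ring_pattern h (map (\<lambda>z. e \<in> z) zs) (\<lambda>k. \<tau> e k \<omega>))"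
    unfolding ring_pattern_def by (auto simp: len)
  finally show ?thesis .
qed

lemma measurable_opinions: "(\<lambda>\<omega> v. X v \<omega>) \<in> measurable M (Pi\<^sub>M UNIV (\<lambda>_. borel))"
  by (rule measurable_PiM_single') (auto simp: PiE_UNIV_domain)

lemma sets_opinions:
  assumes "Measurable.pred (Pi\<^sub>M UNIV (\<lambda>_. borel)) Q"
  shows "{\<omega>\<in>space M. Q (\<lambda>v. X v \<omega>)} \<in> sets M"
  using measurable_compose[OF measurable_opinions assms] by (simp add: pred_def)

text \<open>The clocks of the finitely many edges and the family of all initial opinions depend on
  disjoint groups of the independent variables, so the probability factors over these
  groups.\<close>

lemma prob_ring_word:
  assumes E: "finite E" "E \<subseteq> edges adj" and h: "0 < h" and zs: "zs \<in> words (Pow E) N"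
    and Q: "Measurable.pred (Pi\<^sub>M UNIV (\<lambda>_. borel)) Q"
  shows "{\<omega>\<in>space M. ring_word \<tau> h E N \<omega> = zs \<and> Q (\<lambda>v. X v \<omega>)} \<in> sets M"
    and "prob {\<omega>\<in>space M. ring_word \<tau> h E N \<omega> = zs \<and> Q (\<lambda>v. X v \<omega>)}
      = prod_list (map (bern (1 - exp (- h)) E) zs) * prob {\<omega>\<in>space M. Q (\<lambda>v. X v \<omega>)}"
proof -
  let ?bs = "\<lambda>e. map (\<lambda>z. e \<in> z) zs"
  \<comment> \<open>Indices of the groups: \<open>None\<close> for all initial opinions together,
    \<open>Some e\<close> for the waiting times of the clock of \<open>e\<close>. \<open>Y j\<close>
    is the event of group \<open>j\<close> as a function of its coordinates.\<close>
  define L where "L = insert None (Some ` E)"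
  define K :: "'v set option \<Rightarrow> ('v + 'v set \<times> nat) set" where
    "K j = (case j of None \<Rightarrow> range Inl | Some e \<Rightarrow> Inr ` ({e} \<times> UNIV))" for j
  define Y where "Y j x = (case j of None \<Rightarrow> Q (\<lambda>v. x (Inl v))
    | Some e \<Rightarrow> ring_pattern h (?bs e) (\<lambda>k. x (Inr (e, k))))" for j and x :: "'v + 'v set \<times> nat \<Rightarrow> real"
  define Z where "Z j \<omega> = Y j (\<lambda>i\<in>K j. family i \<omega>)" for j \<omega>
  have Z: "Z None \<omega> = Q (\<lambda>v. X v \<omega>)" "Z (Some e) \<omega> = ring_pattern h (?bs e) (\<lambda>k. \<tau> e k \<omega>)" for e \<omega>
    by (simp_all add: Z_def Y_def K_def)
  have KI: "K j \<subseteq> range Inl \<union> Inr ` (edges adj \<times> UNIV)" if "j \<in> L" for j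
    using that E(2) unfolding L_def K_def by (cases j) auto
  have disj: "disjoint_family_on K L"
    unfolding disjoint_family_on_def L_def K_def by (auto split: option.splits)
  have indL: "indep_vars (\<lambda>j. Pi\<^sub>M (K j) (\<lambda>_. borel)) (\<lambda>j \<omega>. \<lambda>i\<in>K j. family i \<omega>) L"
    by (rule indep_vars_restrict[OF indep KI disj])
  have measY: "Y j \<in> measurable (Pi\<^sub>M (K j) (\<lambda>_. borel)) (count_space UNIV)" for j
  proof (cases j)
    case None
    have "(\<lambda>x v. x (Inl v)) \<in> measurable (Pi\<^sub>M (K j) (\<lambda>_. borel)) (Pi\<^sub>M UNIV (\<lambda>_. borel))"
      by (rule measurable_PiM_single') (auto simp: None K_def PiE_UNIV_domain intro!: measurable_component_singleton)
    from measurable_compose[OF this Q] show ?thesis by (simp add: None Y_def[abs_def])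
  next
    case (Some e)
    have "(\<lambda>x k. x (Inr (e, k))) \<in> measurable (Pi\<^sub>M (K j) (\<lambda>_. borel)) clock"
      by (rule measurable_PiM_single') (auto simp: Some K_def PiE_UNIV_domain intro!: measurable_component_singleton)
    from measurable_compose[OF this measurable_ring_pattern] show ?thesis by (simp add: Some Y_def[abs_def])
  qed
  have indZ: "indep_vars (\<lambda>_. count_space UNIV) Z L"
    unfolding Z_def by (rule indep_vars_compose2[OF indL measY])
  have measZ: "Z j \<in> measurable M (count_space UNIV)" if "j \<in> L" for j
    using indZ that unfolding indep_vars_def by blast
  have fin: "finite L" using E by (simp add: L_def)
  have eq: "{\<omega>\<in>space M. ring_word \<tau> h E N \<omega> = zs \<and> Q (\<lambda>v. X v \<omega>)} = (\<Inter>j\<in>L. Z j -` {True} \<inter> space M)"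
  proof (rule set_eqI)
    fix \<omega>
    have "\<omega> \<in> {\<omega>\<in>space M. ring_word \<tau> h E N \<omega> = zs \<and> Q (\<lambda>v. X v \<omega>)} \<longleftrightarrow>
      \<omega> \<in> space M \<and> (\<forall>e\<in>E. Z (Some e) \<omega>) \<and> Z None \<omega>"
      by (simp only: mem_Collect_eq ring_word_eq_iff[OF zs] Z)
    also have "\<dots> \<longleftrightarrow> \<omega> \<in> (\<Inter>j\<in>L. Z j -` {True} \<inter> space M)"
      unfolding L_def by (simp, blast)
    finally show "\<omega> \<in> {\<omega>\<in>space M. ring_word \<tau> h E N \<omega> = zs \<and> Q (\<lambda>v. X v \<omega>)} \<longleftrightarrow>
      \<omega> \<in> (\<Inter>j\<in>L. Z j -` {True} \<inter> space M)" .
  qed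
  show "{\<omega>\<in>space M. ring_word \<tau> h E N \<omega> = zs \<and> Q (\<lambda>v. X v \<omega>)} \<in> sets M"
    unfolding eq
  proof (rule sets.finite_INT)
    show "Z j -` {True} \<inter> space M \<in> sets M" if "j \<in> L" for j
      using measurable_sets[OF measZ[OF that], of "{True}"] by simp
  qed (use fin in \<open>auto simp: L_def\<close>)
  have r: "prob (Z (Some e) -` {True} \<inter> space M) = (\<Prod>z\<leftarrow>zs. if e \<in> z then 1 - exp (- h) else exp (- h))"
    if "e \<in> E" for e
  proof -
    have "Z (Some e) -` {True} \<inter> space M = {\<omega>\<in>space M. ring_pattern h (?bs e) (\<lambda>k. \<tau> e k \<omega>)}"
      unfolding vimage_def Z by blast
    moreover have "e \<in> edges adj" using that E by blast
    ultimately show ?thesis by (simp only: prob_ring_pattern[OF _ h] map_map comp_def)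
  qed
  have "prob (\<Inter>j\<in>L. Z j -` {True} \<inter> space M) = (\<Prod>j\<in>L. prob (Z j -` {True} \<inter> space M))"
    by (rule indep_varsD_finite[OF indZ]) (use fin in \<open>auto simp: L_def\<close>)
  also have "\<dots> = prob (Z None -` {True} \<inter> space M) * (\<Prod>e\<in>E. prob (Z (Some e) -` {True} \<inter> space M))"
    unfolding L_def using E by (simp add: prod.reindex image_iff)
  also have "(\<Prod>e\<in>E. prob (Z (Some e) -` {True} \<inter> space M))
     = (\<Prod>e\<in>E. \<Prod>z\<leftarrow>zs. if e \<in> z then 1 - exp (- h) else exp (- h))"
    by (intro prod.cong refl r)
  \<comment> \<open>Exchange of the products over edges and over cells.\<close>
  also have "\<dots> = prod_list (map (bern (1 - exp (- h)) E) zs)"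
  proof -
    have "bern (1 - exp (- h)) E z = (\<Prod>e\<in>E. if e \<in> z then 1 - exp (- h) else exp (- h))" for z
      unfolding bern_def by (intro prod.cong) auto
    thus ?thesis by (induction zs) (simp_all add: prod.distrib)
  qed
  also have "Z None -` {True} \<inter> space M = {\<omega>\<in>space M. Q (\<lambda>v. X v \<omega>)}"
    unfolding vimage_def Z by blast
  finally show "prob {\<omega>\<in>space M. ring_word \<tau> h E N \<omega> = zs \<and> Q (\<lambda>v. X v \<omega>)}
      = prod_list (map (bern (1 - exp (- h)) E) zs) * prob {\<omega>\<in>space M. Q (\<lambda>v. X v \<omega>)}"
    unfolding eq by (simp add: mult.commute)
qed

text \<open>Freezing the word: by independence its value may be fixed before the probability over
  the opinions is taken, and only finitely many words occur. This takes the place of conditioning on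
  the clocks.\<close>

lemma prob_word_event:
  assumes E: "finite E" "E \<subseteq> edges adj" and h: "0 < h"
    and Q: "\<And>zs. Measurable.pred (Pi\<^sub>M UNIV (\<lambda>_. borel)) (Q zs)"
  shows "{\<omega>\<in>space M. Q (ring_word \<tau> h E N \<omega>) (\<lambda>v. X v \<omega>)} \<in> sets M"
    and "prob {\<omega>\<in>space M. Q (ring_word \<tau> h E N \<omega>) (\<lambda>v. X v \<omega>)}
      = word_sum (Pow E) (bern (1 - exp (- h)) E) N (\<lambda>zs. prob {\<omega>\<in>space M. Q zs (\<lambda>v. X v \<omega>)})"
proof -
  let ?A = "\<lambda>zs. {\<omega>\<in>space M. ring_word \<tau> h E N \<omega> = zs \<and> Q zs (\<lambda>v. X v \<omega>)}"
  have fin: "finite (words (Pow E) N)" using E by (simp add: finite_words)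
  have eq: "{\<omega>\<in>space M. Q (ring_word \<tau> h E N \<omega>) (\<lambda>v. X v \<omega>)} = (\<Union>zs\<in>words (Pow E) N. ?A zs)"
    by (auto intro: ring_word_in_words)
  note A = prob_ring_word[OF E h _ Q]
  show "{\<omega>\<in>space M. Q (ring_word \<tau> h E N \<omega>) (\<lambda>v. X v \<omega>)} \<in> sets M"
    unfolding eq by (intro sets.finite_UN fin A)
  have "prob (\<Union>zs\<in>words (Pow E) N. ?A zs) = (\<Sum>zs\<in>words (Pow E) N. prob (?A zs))"
    using A(1) by (intro finite_measure_finite_Union fin) (auto simp: disjoint_family_on_def)
  also have "\<dots> = word_sum (Pow E) (bern (1 - exp (- h)) E) N (\<lambda>zs. prob {\<omega>\<in>space M. Q zs (\<lambda>v. X v \<omega>)})"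
    unfolding word_sum_def by (intro sum.cong refl A(2))
  finally show "prob {\<omega>\<in>space M. Q (ring_word \<tau> h E N \<omega>) (\<lambda>v. X v \<omega>)}
      = word_sum (Pow E) (bern (1 - exp (- h)) E) N (\<lambda>zs. prob {\<omega>\<in>space M. Q zs (\<lambda>v. X v \<omega>)})"
    unfolding eq .
qed

text \<open>Fubini for a finite sum. It allows the maximal inequality for words to be applied with
  the initial opinions frozen.\<close>

lemma word_sum_prob:
  assumes Q: "\<And>zs. Measurable.pred (Pi\<^sub>M UNIV (\<lambda>_. borel)) (Q zs)" and "finite Z"
  shows "integrable M (\<lambda>\<omega>. word_sum Z \<pi> N (\<lambda>zs. of_bool (Q zs (\<lambda>v. X v \<omega>))))"
    and "word_sum Z \<pi> N (\<lambda>zs. prob {\<omega>\<in>space M. Q zs (\<lambda>v. X v \<omega>)})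
      = expectation (\<lambda>\<omega>. word_sum Z \<pi> N (\<lambda>zs. of_bool (Q zs (\<lambda>v. X v \<omega>))))"
proof -
  have m [measurable]: "{\<omega>\<in>space M. Q zs (\<lambda>v. X v \<omega>)} \<in> sets M" for zs by (rule sets_opinions[OF Q])
  have i: "integrable M (\<lambda>\<omega>. of_bool (Q zs (\<lambda>v. X v \<omega>)) :: real)" for zs
    by (rule integrable_const_bound[of _ 1]) auto
  have e: "expectation (\<lambda>\<omega>. of_bool (Q zs (\<lambda>v. X v \<omega>))) = prob {\<omega>\<in>space M. Q zs (\<lambda>v. X v \<omega>)}" for zs
  proof -
    have "expectation (\<lambda>\<omega>. of_bool (Q zs (\<lambda>v. X v \<omega>))) = expectation (indicator {\<omega>\<in>space M. Q zs (\<lambda>v. X v \<omega>)})"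
      by (intro Bochner_Integration.integral_cong) (auto simp: indicator_def)
    also have "\<dots> = prob {\<omega>\<in>space M. Q zs (\<lambda>v. X v \<omega>)}" using m by (simp add: Int_absorb2 subset_eq)
    finally show ?thesis .
  qed
  show "integrable M (\<lambda>\<omega>. word_sum Z \<pi> N (\<lambda>zs. of_bool (Q zs (\<lambda>v. X v \<omega>))))"
    unfolding word_sum_def by (intro Bochner_Integration.integrable_sum integrable_mult_right i)
  show "word_sum Z \<pi> N (\<lambda>zs. prob {\<omega>\<in>space M. Q zs (\<lambda>v. X v \<omega>)})
      = expectation (\<lambda>\<omega>. word_sum Z \<pi> N (\<lambda>zs. of_bool (Q zs (\<lambda>v. X v \<omega>))))"
    unfolding word_sum_def by (subst Bochner_Integration.integral_sum) (simp_all add: i e)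
qed

end

section \<open>Deviation probabilities\<close>

lemma measurable_fold_act [measurable]:
  "(\<lambda>x. fold act zs x w) \<in> borel_measurable (Pi\<^sub>M UNIV (\<lambda>_. borel))"
proof (induction zs arbitrary: w rule: rev_induct)
  case (snoc z zs)
  note [measurable] = snoc
  have "fold act (zs @ [z]) x w = (if is_singleton z \<and> w \<in> the_elem z
      then (\<Sum>u\<in>the_elem z. fold act zs x u) / 2 else fold act zs x w)" for x :: "'a \<Rightarrow> real"
    by (simp add: act_def[of z] avg_def)
  thus ?case by simp
qed simp

text \<open>A letter is quiet when its action leaves \<open>v\<close> alone; letters with collisions
  count as quiet. Only the at most \<open>D\<close> singletons of edges at \<open>v\<close> remain,
  each of weight at most \<open>r\<close>.\<close>

lemma (in finite_graph) bern_quiet_ge: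
  assumes r: "0 \<le> r" "r \<le> 1" and D: "card {e\<in>E. v \<in> e} \<le> D"
  shows "1 - D * r \<le> sum (bern r E) {z\<in>Pow E. \<not> (\<exists>e. z = {e} \<and> v \<in> e)}"
proof -
  define \<rho> where "\<rho> = r * (1 - r) ^ (card E - 1)"
  have \<rho>: "0 \<le> \<rho>" "\<rho> \<le> r"
    unfolding \<rho>_def using r by (auto intro!: mult_left_le power_le_one)
  have "sum (bern r E) {z\<in>Pow E. \<not> (\<exists>e. z = {e} \<and> v \<in> e)}
     = (\<Sum>z\<in>Pow E. bern r E z * of_bool (\<not> (\<exists>e. z = {e} \<and> v \<in> e)))"
    using finite_E by (simp add: sum.inter_filter[symmetric] of_bool_def if_distrib cong: if_cong)
  also have "\<dots> = 1 + \<rho> * (\<Sum>e\<in>E. of_bool (\<not> (\<exists>e'. {e} = {e'} \<and> v \<in> e')) - 1)"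
    unfolding \<rho>_def by (rule bern_sum_singletons[OF finite_E]) (auto simp: is_singleton_def)
  also have "(\<Sum>e\<in>E. of_bool (\<not> (\<exists>e'. {e} = {e'} \<and> v \<in> e')) - 1 :: real) = - (\<Sum>e\<in>E. of_bool (v \<in> e))"
    unfolding sum_negf[symmetric] by (intro sum.cong) auto
  also have "(\<Sum>e\<in>E. of_bool (v \<in> e)) = real (card {e\<in>E. v \<in> e})"
    using finite_E by (simp add: of_bool_def sum.If_cases Collect_conj_eq Int_commute)
  finally have eq: "sum (bern r E) {z\<in>Pow E. \<not> (\<exists>e. z = {e} \<and> v \<in> e)} = 1 - \<rho> * card {e\<in>E. v \<in> e}"
    by simp
  have "\<rho> * card {e\<in>E. v \<in> e} \<le> r * D" using \<rho> D r by (intro mult_mono) auto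
  thus ?thesis unfolding eq by (simp add: mult.commute)
qed

lemma exp_minus_two_le:
  fixes x :: real
  assumes "0 \<le> x" "x \<le> 1 / 2"
  shows "exp (- 2 * x) \<le> 1 - x"
proof -
  have "2 * x\<^sup>2 \<le> x" using assms mult_left_mono[of x "1/2" x] by (simp add: power2_eq_square)
  hence "- 2 * x \<le> ln (1 - x)" using ln_one_minus_pos_lower_bound[OF assms] by simp
  thus ?thesis using assms by (simp add: ln_ge_iff)
qed

lemma one_minus_power_le_exp:
  fixes x :: real
  assumes "x \<le> 1"
  shows "(1 - x) ^ n \<le> exp (- x * n)"
proof -
  have "(1 - x) ^ n \<le> exp (- x) ^ n"
    using assms exp_ge_add_one_self[of "- x"] by (intro power_mono) auto
  thus ?thesis by (simp add: exp_of_nat_mult[symmetric] mult.commute)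
qed

context clocked_opinions
begin

context
  fixes D :: nat and v :: 'v and p \<mu> K :: real
  assumes G: "simple_graph adj" and conn: "graph_connected adj" and inf: "infinite (UNIV :: 'v set)"
    and finN: "\<And>w. finite {u. adj w u}" and D: "\<And>w. card {u. adj w u} \<le> D"
    and p: "0 < p" and K: "0 \<le> K"
    and moment: "\<And>W g. finite W \<Longrightarrow>
      integrable M (\<lambda>\<omega>. \<bar>\<Sum>w\<in>W. g w * (X w \<omega> - \<mu>)\<bar> powr p) \<and>
      expectation (\<lambda>\<omega>. \<bar>\<Sum>w\<in>W. g w * (X w \<omega> - \<mu>)\<bar> powr p) \<le> K * (\<Sum>w\<in>W. (g w)\<^sup>2) powr (p / 2)"
begin

text \<open>By duality the deviation is a weighted sum of centred opinions, the weights being a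
  probability vector. If their square sum is below \<open>s\<close>, Markov's inequality for the
  moment of order \<open>p\<close> applies; otherwise the indicator already gives the trivial bound
  1.\<close>

lemma prob_deviation_word_le:
  fixes s \<epsilon> :: real
  assumes B: "finite_graph B E" and v: "v \<in> B" and zs: "set zs \<subseteq> Pow E" and s: "0 < s" and \<epsilon>: "0 < \<epsilon>"
  shows "prob {\<omega>\<in>space M. \<epsilon> < \<bar>fold act zs (\<lambda>w. X w \<omega>) v - \<mu>\<bar>}
    \<le> of_bool (s \<le> finite_graph.sq B (fold act (rev zs) (indicator {v}))) + K * s powr (p / 2) / \<epsilon> powr p"
proof -
  interpret finite_graph B E by (rule B)
  define g where "g = fold act (rev zs) (indicator {v})"
  show ?thesis
  proof (cases "s \<le> sq g")
    case True
    have "prob {\<omega>\<in>space M. \<epsilon> < \<bar>fold act zs (\<lambda>w. X w \<omega>) v - \<mu>\<bar>} \<le> 1" by simp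
    also have "1 \<le> 1 + K * s powr (p / 2) / \<epsilon> powr p" using K by simp
    finally show ?thesis using True by (simp add: g_def)
  next
    case False
    have "dist_on (indicator {v})"
      using v finite_B by (auto simp: dist_on_def indicator_def)
    hence "dist_on g" unfolding g_def using zs by (intro dist_on_fold) auto
    hence one: "(\<Sum>w\<in>B. g w) = 1" by (simp add: dist_on_def)
    have rep: "fold act zs x v = (\<Sum>w\<in>B. g w * x w)" for x
    proof -
      have "fold act zs x v = (\<Sum>w\<in>B. indicator {v} w * fold act zs x w)"
        using v finite_B by (simp add: indicator_def if_distrib[of "\<lambda>a. a * _"] cong: if_cong)
      also have "\<dots> = (\<Sum>w\<in>B. g w * x w)" unfolding g_def by (rule fold_act_dual[OF zs])
      finally show ?thesis .
    qed
    let ?S = "\<lambda>\<omega>. \<Sum>w\<in>B. g w * (X w \<omega> - \<mu>)"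
    have S: "fold act zs (\<lambda>w. X w \<omega>) v - \<mu> = ?S \<omega>" for \<omega>
      by (simp add: rep right_diff_distrib sum_subtractf one flip: sum_distrib_right)
    note mom = moment[OF finite_B, of g]
    have "prob {\<omega>\<in>space M. \<epsilon> < \<bar>?S \<omega>\<bar>} \<le> prob {\<omega>\<in>space M. \<epsilon> powr p \<le> \<bar>?S \<omega>\<bar> powr p}"
    proof (rule finite_measure_mono)
      show "{\<omega>\<in>space M. \<epsilon> < \<bar>?S \<omega>\<bar>} \<subseteq> {\<omega>\<in>space M. \<epsilon> powr p \<le> \<bar>?S \<omega>\<bar> powr p}"
        using \<epsilon> p by (auto intro!: powr_mono2)
    qed measurable
    also have "\<dots> \<le> expectation (\<lambda>\<omega>. \<bar>?S \<omega>\<bar> powr p) / \<epsilon> powr p"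
      using mom \<epsilon> by (intro integral_Markov_inequality_measure[where A = "{}"]) auto
    also have "\<dots> \<le> K * (sq g) powr (p / 2) / \<epsilon> powr p"
      using mom by (intro divide_right_mono) (auto simp: sq_def)
    also have "\<dots> \<le> K * s powr (p / 2) / \<epsilon> powr p"
      using False K p by (intro divide_right_mono mult_left_mono powr_mono2) (auto simp: sq_def sum_nonneg)
    finally show ?thesis using False by (simp add: S g_def)
  qed
qed

text \<open>For frozen opinions the maximal inequality moves the deviation to the end of the window,
  at the price \<open>1 / c ^ k\<close>. For frozen words the moment bound then leaves the spread of
  the reversed word, which has the tail of the word itself.\<close>

lemma word_sum_deviation_le:
  fixes s \<epsilon> r c :: real
  assumes B: "B = gball adj v R" "E = ball_edges adj v R"
    and r: "0 \<le> r" "r \<le> 1" and c: "0 < c" "c \<le> 1 - D * r"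
    and s: "2 \<le> s * Suc R" "0 < s" "s \<le> 1" and \<epsilon>: "0 < \<epsilon>"
  shows "word_sum (Pow E) (bern r E) (m + k)
      (\<lambda>zs. prob {\<omega>\<in>space M. \<exists>j\<in>{m..m + k}. \<epsilon> < \<bar>fold act (take j zs) (\<lambda>w. X w \<omega>) v - \<mu>\<bar>})
    \<le> ((1 - r * (1 - r) ^ (card E - 1) * s\<^sup>2 / 16) ^ (m + k) / s + K * s powr (p / 2) / \<epsilon> powr p) / c ^ k"
proof -
  have fg: "finite_graph B E" unfolding B by (rule finite_graph_ball[OF G finN])
  interpret finite_graph B E by (rule fg)
  interpret weights "Pow E" "bern r E" by (rule weights_bern[OF finite_E r])
  have v: "v \<in> B" by (simp add: B)
  define bad where "bad x \<longleftrightarrow> \<epsilon> < \<bar>x v - \<mu>\<bar>" for x :: "'v \<Rightarrow> real"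
  define Q where "Q zs x \<longleftrightarrow> (\<exists>j\<in>{m..m + k}. bad (fold act (take j zs) x))" for zs x
  define Q' where "Q' zs x \<longleftrightarrow> bad (fold act zs x)" for zs x
  have [measurable]: "Measurable.pred (Pi\<^sub>M UNIV (\<lambda>_. borel)) (\<lambda>x. bad (fold act zs x))" for zs
    unfolding bad_def by measurable
  have Qm: "Measurable.pred (Pi\<^sub>M UNIV (\<lambda>_. borel)) (Q zs)" for zs
    unfolding Q_def by measurable
  have Q'm: "Measurable.pred (Pi\<^sub>M UNIV (\<lambda>_. borel)) (Q' zs)" for zs
    unfolding Q'_def by measurable
  let ?W = "word_sum (Pow E) (bern r E) (m + k)"
  have point: "c ^ k * ?W (\<lambda>zs. of_bool (Q zs x)) \<le> ?W (\<lambda>zs. of_bool (Q' zs x))" for x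
    unfolding Q_def Q'_def
  proof (rule word_sum_maximal[where Q = "{z\<in>Pow E. \<not> (\<exists>e. z = {e} \<and> v \<in> e)}" and bad = bad])
    show "{z\<in>Pow E. \<not> (\<exists>e. z = {e} \<and> v \<in> e)} \<subseteq> Pow E" by auto
    have "card {e\<in>E. v \<in> e} \<le> D" unfolding B by (rule card_ball_edges_at_le[OF G finN D])
    from bern_quiet_ge[OF r this] c(2)
    show "c \<le> sum (bern r E) {z\<in>Pow E. \<not> (\<exists>e. z = {e} \<and> v \<in> e)}" by linarith
    show "0 \<le> c" using c by simp
    show "bad (act z x)" if "z \<in> {z\<in>Pow E. \<not> (\<exists>e. z = {e} \<and> v \<in> e)}" "bad x" for z x
    proof -
      have "act z x v = x v"
        using that(1) by (auto simp: act_def avg_def is_singleton_def)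
      thus ?thesis using that(2) by (simp add: bad_def)
    qed
  qed
  have fin: "finite (Pow E)" using finite_E by simp
  have "c ^ k * ?W (\<lambda>zs. prob {\<omega>\<in>space M. Q zs (\<lambda>w. X w \<omega>)})
     = expectation (\<lambda>\<omega>. c ^ k * ?W (\<lambda>zs. of_bool (Q zs (\<lambda>w. X w \<omega>))))"
    by (simp add: word_sum_prob(2)[OF Qm fin])
  also have "\<dots> \<le> expectation (\<lambda>\<omega>. ?W (\<lambda>zs. of_bool (Q' zs (\<lambda>w. X w \<omega>))))"
    using word_sum_prob(1)[OF Qm fin] word_sum_prob(1)[OF Q'm fin] point
    by (intro integral_mono) auto
  also have "\<dots> = ?W (\<lambda>zs. prob {\<omega>\<in>space M. Q' zs (\<lambda>w. X w \<omega>)})"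
    by (simp add: word_sum_prob(2)[OF Q'm fin])
  also have "\<dots> \<le> ?W (\<lambda>zs. of_bool (s \<le> sq (fold act (rev zs) (indicator {v}))) + K * s powr (p / 2) / \<epsilon> powr p)"
    unfolding Q'_def bad_def
    by (intro word_sum_mono prob_deviation_word_le[OF fg v]) (use s \<epsilon> in \<open>auto simp: words_def\<close>)
  also have "\<dots> = ?W (\<lambda>zs. of_bool (s \<le> sq (fold act (rev zs) (indicator {v})))) + K * s powr (p / 2) / \<epsilon> powr p"
    by (simp add: word_sum_add)
  also have "?W (\<lambda>zs. of_bool (s \<le> sq (fold act (rev zs) (indicator {v}))))
      = ?W (\<lambda>zs. of_bool (s \<le> sq (fold act zs (indicator {v}))))"
    by (rule word_sum_rev)
  also have "\<dots> \<le> (1 - r * (1 - r) ^ (card E - 1) * s\<^sup>2 / 16) ^ (m + k) / s"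
  proof (rule spread_tail[OF _ r _ s(2,3) v])
    show "(\<lambda>x y. {x, y} \<in> E)\<^sup>*\<^sup>* x y" if "x \<in> B" "y \<in> B" for x y
      using ball_edges_connected[OF G] that unfolding B by blast
    have "s * real (Suc R) \<le> s * real (card B)"
      using card_gball_ge[OF conn finN inf, of R v] s unfolding B by (intro mult_left_mono) auto
    thus "2 \<le> s * real (card B)" using s(1) by linarith
  qed
  finally have "c ^ k * ?W (\<lambda>zs. prob {\<omega>\<in>space M. Q zs (\<lambda>w. X w \<omega>)})
    \<le> (1 - r * (1 - r) ^ (card E - 1) * s\<^sup>2 / 16) ^ (m + k) / s + K * s powr (p / 2) / \<epsilon> powr p" by simp
  thus ?thesis using c by (simp add: pos_le_divide_eq mult.commute Q_def bad_def)
qed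

text \<open>\<open>U\<close> collects collisions, influence from outside the ball and deviations of
  the discretised process; it depends only on the ring word and \<open>X\<close>, hence is
  measurable. Off \<open>U\<close> the bound holds for every path of the dynamics with finitely many
  rings in bounded time on the edges of \<open>E\<close>.\<close>

lemma exceptional_event:
  fixes s \<epsilon> :: real and n :: nat
  assumes s: "0 < s" "s \<le> 1" and \<epsilon>: "0 < \<epsilon>"
  shows "\<exists>U E. U \<in> sets M \<and> finite E \<and> E \<subseteq> edges adj \<and>
    prob U \<le> 2 / (real n + 1)\<^sup>2
      + exp (2 * real D) * (exp (- (real n + 1) * s\<^sup>2 / 96) / s + K * s powr (p / 2) / \<epsilon> powr p) \<and>
    (\<forall>\<omega> f t. \<omega> \<in> space M - U \<longrightarrow> edge_averaging adj \<tau> f \<omega> \<longrightarrow> (\<forall>w. f 0 w \<omega> = X w \<omega>) \<longrightarrow>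
      (\<forall>e\<in>E. \<forall>t. finite {i. ring_time \<tau> e i \<omega> \<le> t}) \<longrightarrow>
      real n \<le> t \<longrightarrow> t \<le> real n + 1 \<longrightarrow> \<bar>f t v \<omega> - \<mu>\<bar> \<le> \<epsilon>)"
proof -
  define T where "T = real n + 1"
  have T: "1 \<le> T" by (simp add: T_def)
  \<comment> \<open>\<open>R1\<close> pays for the exponential growth of influence up to time
    \<open>T\<close>; \<open>R2\<close> makes the ball large compared with \<open>1 / s\<close>, as
    the energy inequality requires.\<close>
  obtain R1 :: nat where R1: "exp (2 * real D * T) * T\<^sup>2 \<le> R1" using real_arch_simple by blast
  obtain R2 :: nat where R2: "2 / s \<le> R2" using real_arch_simple by blast
  define R where "R = R1 + R2"
  have R: "exp (2 * real D * T) / 2 ^ R \<le> 1 / T\<^sup>2"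
  proof -
    have "real R1 \<le> real R" by (simp add: R_def)
    also have "\<dots> \<le> 2 ^ R" using of_nat_less_two_power[of R, where 'a = real] by simp
    finally have "exp (2 * real D * T) * T\<^sup>2 \<le> 2 ^ R" using R1 by linarith
    thus ?thesis using T by (simp add: field_simps)
  qed
  have sR: "2 \<le> s * Suc R"
  proof -
    have "2 \<le> s * real R2" using R2 s by (simp add: field_simps)
    also have "\<dots> \<le> s * Suc R" using s by (intro mult_left_mono) (auto simp: R_def)
    finally show ?thesis .
  qed
  define B where "B = gball adj v R"
  define E where "E = ball_edges adj v R"
  have fg: "finite_graph B E" unfolding B_def E_def by (rule finite_graph_ball[OF G finN])
  interpret finite_graph B E by (rule fg)
  have E: "finite E" "E \<subseteq> edges adj" using finite_E by (auto simp: E_def ball_edges_def)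
  obtain k0 :: nat where k0: "T ^ 3 * (card E)\<^sup>2 \<le> k0" using real_arch_simple by blast
  \<comment> \<open>The number of cells per unit of time. \<open>k0\<close> makes the expected
    number of collisions at most \<open>1 / T\<^sup>2\<close>, \<open>2 * D\<close> gives
    \<open>D * h \<le> 1 / 2\<close>, \<open>card E\<close> keeps
    \<open>(1 - r) ^ (card E - 1)\<close> at least \<open>exp (- 1)\<close>, and 1 ensures
    positivity.\<close>
  define k where "k = k0 + 2 * D + card E + 1"
  define h where "h = 1 / real k"
  have k: "0 < k" "k0 \<le> k" "2 * D \<le> k" "card E \<le> k" by (auto simp: k_def)
  have h: "0 < h" "h \<le> 1" "h * k = 1" using k by (auto simp: h_def)
  define r where "r = 1 - exp (- h)"
  have r: "0 \<le> r" "r \<le> 1" "r \<le> h" "h / 2 \<le> r"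
  proof -
    show "0 \<le> r" "r \<le> 1" using h by (auto simp: r_def)
    show "r \<le> h" using exp_ge_add_one_self[of "- h"] by (simp add: r_def)
    show "h / 2 \<le> r" using exp_minus_two_le[of "h / 2"] h by (simp add: r_def)
  qed
  interpret weights "Pow E" "bern r E" by (rule weights_bern[OF finite_E r(1,2)])
  define m where "m = n * k"
  define N where "N = m + k"
  have hm: "h * m = n" and hN: "h * N = T"
    using h by (auto simp: m_def N_def T_def algebra_simps)
  let ?W = "word_sum (Pow E) (bern r E) N"
  define C1 where "C1 zs \<longleftrightarrow> (\<exists>z\<in>set zs. z \<noteq> {} \<and> \<not> is_singleton z)" for zs :: "'v set set list"
  define C2 where "C2 zs \<longleftrightarrow> (\<exists>w\<in>fold infl (rev zs) {v}. R \<le> level adj v w)" for zs :: "'v set set list"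
  define C3 where "C3 zs x \<longleftrightarrow> (\<exists>j\<in>{m..N}. \<epsilon> < \<bar>fold act (take j zs) x v - \<mu>\<bar>)" for zs x
  define Q where "Q zs x \<longleftrightarrow> C1 zs \<or> C2 zs \<or> C3 zs x" for zs x
  define U where "U = {\<omega>\<in>space M. Q (ring_word \<tau> h E N \<omega>) (\<lambda>w. X w \<omega>)}"
  have C3m [measurable]: "Measurable.pred (Pi\<^sub>M UNIV (\<lambda>_. borel)) (C3 zs)" for zs
    unfolding C3_def by measurable
  have Qm: "Measurable.pred (Pi\<^sub>M UNIV (\<lambda>_. borel)) (Q zs)" for zs
    unfolding Q_def by measurable
  have U: "U \<in> sets M" "prob U = ?W (\<lambda>zs. prob {\<omega>\<in>space M. Q zs (\<lambda>w. X w \<omega>)})"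
    unfolding U_def r_def using prob_word_event[OF E h(1) Qm] by auto
  have "prob U \<le> ?W (\<lambda>zs. (of_bool (C1 zs) + of_bool (C2 zs)) + prob {\<omega>\<in>space M. C3 zs (\<lambda>w. X w \<omega>)})"
    unfolding U(2)
  proof (rule word_sum_mono)
    fix zs
    have le1: "prob {\<omega>\<in>space M. Q zs (\<lambda>w. X w \<omega>)} \<le> 1" by simp
    show "prob {\<omega>\<in>space M. Q zs (\<lambda>w. X w \<omega>)}
      \<le> (of_bool (C1 zs) + of_bool (C2 zs)) + prob {\<omega>\<in>space M. C3 zs (\<lambda>w. X w \<omega>)}"
    proof (cases "C1 zs \<or> C2 zs")
      case True
      hence "1 \<le> (of_bool (C1 zs) + of_bool (C2 zs) :: real)" by auto
      thus ?thesis using le1 measure_nonneg[of M "{\<omega>\<in>space M. C3 zs (\<lambda>w. X w \<omega>)}"] by linarith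
    qed (simp add: Q_def)
  qed
  also have "\<dots> = ?W (\<lambda>zs. of_bool (C1 zs)) + ?W (\<lambda>zs. of_bool (C2 zs)) + ?W (\<lambda>zs. prob {\<omega>\<in>space M. C3 zs (\<lambda>w. X w \<omega>)})"
    by (simp only: word_sum_add)
  also have "\<dots> \<le> 1 / T\<^sup>2 + 1 / T\<^sup>2
      + exp (2 * real D) * (exp (- T * s\<^sup>2 / 96) / s + K * s powr (p / 2) / \<epsilon> powr p)"
  proof (intro add_mono)
    have "?W (\<lambda>zs. of_bool (C1 zs)) \<le> N * (real (card E) * r)\<^sup>2"
      unfolding C1_def using bern_collision_le[OF finite_E r(1,2)]
      by (intro order_trans[OF word_sum_exists] mult_left_mono) auto
    also have "\<dots> \<le> N * (real (card E) * h)\<^sup>2"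
      using r by (intro mult_left_mono power_mono) auto
    also have "\<dots> = (h * N) * (h * real (card E)^2)" by (simp add: power2_eq_square)
    also have "\<dots> = T * (real (card E)^2 / k)" unfolding hN by (simp add: h_def)
    also have "\<dots> \<le> 1 / T\<^sup>2"
    proof -
      have "T ^ 3 * (card E)\<^sup>2 \<le> k" using k0 k(2) by (meson of_nat_mono order_trans)
      hence "T * T\<^sup>2 * (card E)\<^sup>2 \<le> k" by (simp add: power2_eq_square power3_eq_cube mult.assoc)
      thus ?thesis using T k by (simp add: field_simps)
    qed
    finally show "?W (\<lambda>zs. of_bool (C1 zs)) \<le> 1 / T\<^sup>2" .
  next
    have "?W (\<lambda>zs. of_bool (C2 zs)) = ?W (\<lambda>zs. of_bool (\<exists>w\<in>fold infl zs {v}. R \<le> level adj v w))"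
      unfolding C2_def by (rule word_sum_rev)
    also have "\<dots> \<le> (1 + 2 * real D * r) ^ N / 2 ^ R"
    proof (rule influence_tail[OF r(1,2)])
      show "level adj v u \<le> Suc (level adj v w)" if "{u, w} \<in> E" for u w
      proof -
        have "adj w u" using that E(2) edges_iff[OF G, of w u] by (auto simp: insert_commute)
        thus ?thesis by (rule level_adj_le[OF conn])
      qed
      show "card {e\<in>E. w \<in> e} \<le> D" for w unfolding E_def by (rule card_ball_edges_at_le[OF G finN D])
      show "level adj v v = 0" using level_le_iff[OF conn, of v v 0] by simp
    qed
    also have "\<dots> \<le> exp (2 * real D * T) / 2 ^ R"
    proof (rule divide_right_mono)
      have "(1 + 2 * real D * r) ^ N \<le> exp (2 * real D * h) ^ N"
      proof (rule power_mono)
        have "2 * real D * r \<le> 2 * real D * h" using r by (intro mult_left_mono) auto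
        thus "1 + 2 * real D * r \<le> exp (2 * real D * h)"
          using exp_ge_add_one_self[of "2 * real D * h"] by linarith
      qed (use r in simp)
      also have "\<dots> = exp (2 * real D * (h * N))" by (simp add: exp_of_nat_mult[symmetric] mult_ac)
      finally show "(1 + 2 * real D * r) ^ N \<le> exp (2 * real D * T)" unfolding hN .
    qed simp
    finally show "?W (\<lambda>zs. of_bool (C2 zs)) \<le> 1 / T\<^sup>2" using R by linarith
  next
    \<comment> \<open>The probability that exactly one given edge rings in a cell. It is at least
      \<open>h / 6\<close>, from \<open>r \<ge> h / 2\<close> and
      \<open>exp (- 1) \<ge> 1 / 3\<close>; with the 16 of the energy inequality this produces
      96.\<close>
    define \<rho> where "\<rho> = r * (1 - r) ^ (card E - 1)"
    have \<rho>: "h / 6 \<le> \<rho>" "\<rho> \<le> 1"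
    proof -
      have "exp (- 1) \<le> exp (- h * real (card E - 1))"
      proof -
        have "h * real (card E - 1) \<le> h * real k" using h k by (intro mult_left_mono) auto
        thus ?thesis using h by simp
      qed
      also have "\<dots> = (1 - r) ^ (card E - 1)"
        by (simp add: r_def exp_of_nat_mult[symmetric] mult.commute)
      finally have e1: "exp (- 1) \<le> (1 - r) ^ (card E - 1)" .
      have "inverse 3 \<le> inverse (exp (1 :: real))" by (rule le_imp_inverse_le[OF exp_le]) simp
      hence "1 / 3 \<le> exp (- 1 :: real)" by (simp only: exp_minus inverse_eq_divide)
      hence "1 / 3 \<le> (1 - r) ^ (card E - 1)" using e1 by linarith
      hence "h / 2 * (1 / 3) \<le> \<rho>" unfolding \<rho>_def using r h by (intro mult_mono) auto
      thus "h / 6 \<le> \<rho>" by simp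
      show "\<rho> \<le> 1" unfolding \<rho>_def using r by (intro mult_le_one power_le_one) auto
    qed
    \<comment> \<open>An exponential is chosen so that \<open>c ^ k = exp (- 2 * D)\<close> exactly:
      the price of the unit window does not depend on the cell size.\<close>
    define c where "c = exp (- 2 * (D * h))"
    have "D * h \<le> 1 / 2" using k by (simp add: h_def field_simps)
    hence c: "0 < c" "c \<le> 1 - D * r"
    proof -
      show "0 < c" by (simp add: c_def)
      have "c \<le> 1 - D * h" unfolding c_def using \<open>D * h \<le> 1 / 2\<close> h by (intro exp_minus_two_le) auto
      also have "\<dots> \<le> 1 - D * r" using r by (intro diff_left_mono mult_left_mono) auto
      finally show "c \<le> 1 - D * r" .
    qed
    have ck: "1 / c ^ k = exp (2 * real D)"
    proof -
      have "c ^ k = exp (real k * (- 2 * (D * h)))" unfolding c_def by (rule exp_of_nat_mult[symmetric])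
      also have "real k * (- 2 * (D * h)) = - (2 * real D) * (h * k)" by simp
      also have "\<dots> = - (2 * real D)" by (simp only: h(3) mult_1_right)
      finally show ?thesis by (simp only: exp_minus inverse_eq_divide) simp
    qed
    have "?W (\<lambda>zs. prob {\<omega>\<in>space M. C3 zs (\<lambda>w. X w \<omega>)})
      \<le> ((1 - \<rho> * s\<^sup>2 / 16) ^ N / s + K * s powr (p / 2) / \<epsilon> powr p) / c ^ k"
      unfolding C3_def N_def \<rho>_def
      by (rule word_sum_deviation_le[OF B_def E_def r(1,2) c sR s \<epsilon>])
    also have "\<dots> = exp (2 * real D) * ((1 - \<rho> * s\<^sup>2 / 16) ^ N / s + K * s powr (p / 2) / \<epsilon> powr p)"
      unfolding ck[symmetric] by simp
    also have "\<dots> \<le> exp (2 * real D) * (exp (- T * s\<^sup>2 / 96) / s + K * s powr (p / 2) / \<epsilon> powr p)"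
    proof (intro mult_left_mono add_right_mono divide_right_mono)
      have "\<rho> * s\<^sup>2 \<le> 1 * 1" using \<rho> h s by (intro mult_mono power_le_one) auto
      hence "(1 - \<rho> * s\<^sup>2 / 16) ^ N \<le> exp (- (\<rho> * s\<^sup>2 / 16) * N)"
        by (intro one_minus_power_le_exp) simp
      also have "\<dots> \<le> exp (- T * s\<^sup>2 / 96)"
      proof -
        have "(h / 6) * (s\<^sup>2 / 16 * N) \<le> \<rho> * (s\<^sup>2 / 16 * N)" using \<rho> by (intro mult_right_mono) auto
        moreover have "(h / 6) * (s\<^sup>2 / 16 * N) = T * s\<^sup>2 / 96" unfolding hN[symmetric] by simp
        moreover have "\<rho> * (s\<^sup>2 / 16 * N) = (\<rho> * s\<^sup>2 / 16) * N" by simp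
        ultimately have "T * s\<^sup>2 / 96 \<le> (\<rho> * s\<^sup>2 / 16) * N" by linarith
        thus ?thesis unfolding exp_le_cancel_iff minus_mult_left[symmetric] minus_divide_left[symmetric] by linarith
      qed
      finally show "(1 - \<rho> * s\<^sup>2 / 16) ^ N \<le> exp (- T * s\<^sup>2 / 96)" .
    qed (use s in auto)
    finally show "?W (\<lambda>zs. prob {\<omega>\<in>space M. C3 zs (\<lambda>w. X w \<omega>)})
      \<le> exp (2 * real D) * (exp (- T * s\<^sup>2 / 96) / s + K * s powr (p / 2) / \<epsilon> powr p)" .
  qed
  finally have bound: "prob U \<le> 2 / (real n + 1)\<^sup>2
      + exp (2 * real D) * (exp (- (real n + 1) * s\<^sup>2 / 96) / s + K * s powr (p / 2) / \<epsilon> powr p)"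
    by (simp add: T_def)
  have path: "\<bar>f t v \<omega> - \<mu>\<bar> \<le> \<epsilon>"
    if \<omega>: "\<omega> \<in> space M - U" and EA: "edge_averaging adj \<tau> f \<omega>" and f0: "\<forall>w. f 0 w \<omega> = X w \<omega>"
      and fin: "\<forall>e\<in>E. \<forall>t. finite {i. ring_time \<tau> e i \<omega> \<le> t}"
      and t: "real n \<le> t" "t \<le> real n + 1" for \<omega> f t
  proof -
    define zs where "zs = ring_word \<tau> h E N \<omega>"
    have nQ: "\<not> Q zs (\<lambda>w. X w \<omega>)" using \<omega> by (auto simp: U_def zs_def)
    have "\<exists>j\<in>{m..N}. f t v \<omega> = fold act (take j zs) (\<lambda>w. f 0 w \<omega>) v"
    proof (rule edge_averaging_eq_fold_act[OF EA G E(2) h(1) zs_def])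
      show "z = {} \<or> is_singleton z" if "z \<in> set zs" for z
        using nQ that by (auto simp: Q_def C1_def)
      show "{x, u} \<in> E" if "x \<in> fold infl (rev zs) {v}" "adj x u" for x u
      proof -
        \<comment> \<open>The strict inequality leaves room for one more step: neighbours of
          \<open>x\<close> are still in the ball, so all edges at \<open>x\<close> belong to
          \<open>E\<close>.\<close>
        have "level adj v x < R" using nQ that(1) unfolding Q_def C2_def by (meson not_less)
        hence "level adj v x \<le> R" "level adj v u \<le> R" using level_adj_le[OF conn that(2), of v] by auto
        hence "x \<in> gball adj v R" "u \<in> gball adj v R" by (simp_all only: level_le_iff[OF conn])
        thus ?thesis using that(2) edges_iff[OF G] by (simp add: E_def ball_edges_def)
      qed
      show "finite {i. ring_time \<tau> e i \<omega> \<le> t}" if "e \<in> E" for e t using fin that by blast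
      show "h * m \<le> t" "t \<le> h * N" using t by (simp_all add: hm hN T_def)
    qed
    then obtain j where "j \<in> {m..N}" "f t v \<omega> = fold act (take j zs) (\<lambda>w. f 0 w \<omega>) v" by blast
    thus ?thesis using nQ by (auto simp: Q_def C3_def f0 not_less)
  qed
  show ?thesis
    by (intro exI[of _ U] exI[of _ E] conjI allI impI U(1) E bound) (rule path)
qed

end

end

section \<open>Summation over unit time intervals and conclusion\<close>

lemma summable_powr_Suc:
  fixes a :: real
  assumes "a < - 1"
  shows "summable (\<lambda>n. (real n + 1) powr a)"
proof -
  have "summable (\<lambda>n. of_nat (Suc n) powr a :: real)"
    using assms by (subst summable_Suc_iff) (simp add: summable_real_powr_iff)
  thus ?thesis by (simp add: add.commute)
qed

text \<open>With this \<open>s\<close> the exponent \<open>(n + 1) * (s n)\<^sup>2\<close> equals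
  \<open>(n + 1) powr \<delta>\<close>, so the spread term is a stretched exponential times a power.
  The moment term is a power with exponent below -1 by the assumption on \<delta> and
  \<open>p\<close>.\<close>

lemma summable_exceptional_bound:
  fixes p \<delta> :: real
  assumes \<delta>: "0 < \<delta>" and p: "1 < (1 - \<delta>) * p / 4"
  defines "s \<equiv> \<lambda>n::nat. (real n + 1) powr (- (1 - \<delta>) / 2)"
  shows "summable (\<lambda>n. 2 / (real n + 1)\<^sup>2
      + A * (exp (- (real n + 1) * (s n)\<^sup>2 / 96) / s n + K * s n powr (p / 2) / c))"
proof -
  have "summable (\<lambda>n. 2 * (real n + 1) powr (- 2))"
    by (intro summable_mult summable_powr_Suc) simp
  moreover have "2 * (real n + 1) powr (- 2) = 2 / (real n + 1)\<^sup>2" for n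
    by (simp add: powr_minus divide_inverse)
  ultimately have 1: "summable (\<lambda>n. 2 / (real n + 1)\<^sup>2)" by simp
  have "s n powr (p / 2) = (real n + 1) powr (- ((1 - \<delta>) * p / 4))" for n
  proof -
    have "- (1 - \<delta>) / 2 * (p / 2) = - ((1 - \<delta>) * p / 4)" by (simp add: field_simps)
    thus ?thesis unfolding s_def powr_powr by (simp only:)
  qed
  hence 2: "summable (\<lambda>n. s n powr (p / 2))"
    using summable_powr_Suc[of "- ((1 - \<delta>) * p / 4)"] p by simp
  have eq: "exp (- (real n + 1) * (s n)\<^sup>2 / 96) / s n
      = exp (- ((real n + 1) powr \<delta> / 96)) * (real n + 1) powr ((1 - \<delta>) / 2)" for n
  proof -
    have "(s n)\<^sup>2 = (real n + 1) powr (- (1 - \<delta>))"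
      by (simp add: s_def power2_eq_square flip: powr_add)
    hence "(real n + 1) * (s n)\<^sup>2 = (real n + 1) powr 1 * (real n + 1) powr (- (1 - \<delta>))" by simp
    also have "\<dots> = (real n + 1) powr \<delta>" unfolding powr_add[symmetric] by simp
    finally have a: "(real n + 1) * (s n)\<^sup>2 = (real n + 1) powr \<delta>" .
    have b: "1 / s n = (real n + 1) powr ((1 - \<delta>) / 2)"
    proof -
      have "- (- (1 - \<delta>) / 2) = (1 - \<delta>) / 2" by (simp add: field_simps)
      thus ?thesis unfolding s_def using powr_minus_divide[of "real n + 1" "- (1 - \<delta>) / 2"] by (simp only:)
    qed
    have "- (real n + 1) * (s n)\<^sup>2 / 96 = - ((real n + 1) * (s n)\<^sup>2 / 96)" by (simp add: field_simps)
    hence "exp (- (real n + 1) * (s n)\<^sup>2 / 96) / s n = exp (- ((real n + 1) * (s n)\<^sup>2 / 96)) * (1 / s n)"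
      by (simp only: divide_inverse mult_1_left)
    thus ?thesis unfolding a b .
  qed
  have "(\<lambda>n. exp (- ((real n + 1) powr \<delta> / 96)) * (real n + 1) powr ((1 - \<delta>) / 2)) \<in> O(\<lambda>n. (real n + 1) powr (- 2))"
    using \<delta> by real_asymp
  hence 3: "summable (\<lambda>n. exp (- (real n + 1) * (s n)\<^sup>2 / 96) / s n)"
    unfolding eq by (rule summable_comparison_test_bigo[rotated]) (use summable_powr_Suc[of "- 2"] in simp)
  show ?thesis
    using 1 2 3 by (intro summable_add summable_mult summable_divide)
qed

context clocked_opinions
begin

lemma centered_moment:
  assumes p: "2 < p"
    and int: "\<And>w. integrable M (\<lambda>\<omega>. \<bar>X w \<omega>\<bar> powr p)"
    and id: "\<And>w w'. distr M borel (X w) = distr M borel (X w')"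
    and mean: "\<And>w. expectation (X w) = \<mu>"
  obtains K where "0 \<le> K" "\<And>W g. finite W \<Longrightarrow>
      integrable M (\<lambda>\<omega>. \<bar>\<Sum>w\<in>W. g w * (X w \<omega> - \<mu>)\<bar> powr p) \<and>
      expectation (\<lambda>\<omega>. \<bar>\<Sum>w\<in>W. g w * (X w \<omega> - \<mu>)\<bar> powr p) \<le> K * (\<Sum>w\<in>W. (g w)\<^sup>2) powr (p / 2)"
proof -
  have intX: "integrable M (X w)" for w
  proof (rule integrable_abs_cancel)
    have "integrable M (\<lambda>\<omega>. \<bar>X w \<omega>\<bar> powr 1)"
      using p by (intro integrable_abs_powr_mono[OF _ int]) simp_all
    thus "integrable M (\<lambda>\<omega>. \<bar>X w \<omega>\<bar>)" by simp
  qed simp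
  have intc: "integrable M (\<lambda>\<omega>. \<bar>X w \<omega> - \<mu>\<bar> powr p)" for w
  proof (rule Bochner_Integration.integrable_bound)
    show "integrable M (\<lambda>\<omega>. 2 powr p * (\<bar>X w \<omega>\<bar> powr p + \<bar>\<mu>\<bar> powr p))" using int by simp
    have "\<bar>x - \<mu>\<bar> powr p \<le> 2 powr p * (\<bar>x\<bar> powr p + \<bar>\<mu>\<bar> powr p)" for x
    proof -
      have "\<bar>x - \<mu>\<bar> powr p \<le> (2 * max \<bar>x\<bar> \<bar>\<mu>\<bar>) powr p" using p by (intro powr_mono2) auto
      also have "\<dots> = 2 powr p * max \<bar>x\<bar> \<bar>\<mu>\<bar> powr p" by (simp add: powr_mult)
      also have "\<dots> \<le> 2 powr p * (\<bar>x\<bar> powr p + \<bar>\<mu>\<bar> powr p)"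
        by (intro mult_left_mono) (auto simp: max_def)
      finally show ?thesis .
    qed
    thus "AE \<omega> in M. norm (\<bar>X w \<omega> - \<mu>\<bar> powr p) \<le> norm (2 powr p * (\<bar>X w \<omega>\<bar> powr p + \<bar>\<mu>\<bar> powr p))"
      by (intro AE_I2) (simp add: abs_mult)
  qed simp
  \<comment> \<open>\<open>undefined\<close> is merely some vertex; identical distribution makes its
    centred moment that of every vertex.\<close>
  define \<kappa> where "\<kappa> = expectation (\<lambda>\<omega>. \<bar>X undefined \<omega> - \<mu>\<bar> powr p)"
  have \<kappa>: "expectation (\<lambda>\<omega>. \<bar>X w \<omega> - \<mu>\<bar> powr p) \<le> \<kappa>" for w
  proof -
    have "expectation (\<lambda>\<omega>. \<bar>X w \<omega> - \<mu>\<bar> powr p) = (\<integral>x. \<bar>x - \<mu>\<bar> powr p \<partial>distr M borel (X w))" for w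
      by (subst integral_distr) simp_all
    thus ?thesis unfolding \<kappa>_def using id[of w undefined] by simp
  qed
  have ind: "indep_vars (\<lambda>_. borel) (\<lambda>i \<omega>. family i \<omega> - \<mu>) (range Inl)"
    by (rule indep_vars_compose2[OF indep_vars_subset[OF indep], where Y = "\<lambda>_ x. x - \<mu>"]) auto
  obtain K where K: "0 \<le> K" "\<And>W g. finite W \<Longrightarrow> W \<subseteq> range Inl \<Longrightarrow>
      integrable M (\<lambda>\<omega>. \<bar>\<Sum>i\<in>W. g i * (family i \<omega> - \<mu>)\<bar> powr p) \<and>
      expectation (\<lambda>\<omega>. \<bar>\<Sum>i\<in>W. g i * (family i \<omega> - \<mu>)\<bar> powr p) \<le> K * (\<Sum>i\<in>W. (g i)\<^sup>2) powr (p / 2)"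
  proof (rule weighted_sum_moment_le[OF p ind, of \<kappa>])
    show "integrable M (\<lambda>\<omega>. \<bar>family i \<omega> - \<mu>\<bar> powr p)" if "i \<in> range Inl" for i
      using that intc by auto
    show "expectation (\<lambda>\<omega>. family i \<omega> - \<mu>) = 0" if "i \<in> range Inl" for i
      using that intX mean by (auto simp: prob_space)
    show "expectation (\<lambda>\<omega>. \<bar>family i \<omega> - \<mu>\<bar> powr p) \<le> \<kappa>" if "i \<in> range Inl" for i
      using that \<kappa> by auto
    show "0 \<le> \<kappa>" unfolding \<kappa>_def by simp
  qed blast
  show thesis
  proof (rule that[OF K(1)])
    fix W :: "'v set" and g :: "'v \<Rightarrow> real"
    assume W: "finite W"
    show "integrable M (\<lambda>\<omega>. \<bar>\<Sum>w\<in>W. g w * (X w \<omega> - \<mu>)\<bar> powr p) \<and>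
      expectation (\<lambda>\<omega>. \<bar>\<Sum>w\<in>W. g w * (X w \<omega> - \<mu>)\<bar> powr p) \<le> K * (\<Sum>w\<in>W. (g w)\<^sup>2) powr (p / 2)"
      using K(2)[of "Inl ` W" "\<lambda>i. g (projl i)"] W by (simp add: sum.reindex image_subset_iff)
  qed
qed

end

theorem theorem1p4:
  fixes M :: "'a measure"
    and adj :: "'v \<Rightarrow> 'v \<Rightarrow> bool"
    and \<tau> :: "'v set \<Rightarrow> nat \<Rightarrow> 'a \<Rightarrow> real"
    and f :: "real \<Rightarrow> 'v \<Rightarrow> 'a \<Rightarrow> real"
    and p \<mu> :: real
  assumes "prob_space M"
    and "simple_graph adj" and "graph_connected adj" and "bounded_degree adj"
    and "infinite (UNIV :: 'v set)"
    \<comment> \<open>initial opinions f 0 v: i.i.d., in L^p for some p > 4, with mean mu\<close>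
    and "p > 4"
    and "\<And>v. f 0 v \<in> borel_measurable M"
    and "\<And>v. integrable M (\<lambda>\<omega>. \<bar>f 0 v \<omega>\<bar> powr p)"
    and "\<And>v w. distr M borel (f 0 v) = distr M borel (f 0 w)"
    and "\<And>v. integral\<^sup>L M (f 0 v) = \<mu>"
    \<comment> \<open>rate-one Poisson clocks: i.i.d. Exp(1) inter-arrival times\<close>
    and "\<And>e k. e \<in> edges adj \<Longrightarrow> distributed M lborel (\<tau> e k) (exponential_density 1)"
    \<comment> \<open>all initial opinions and all clock variables are mutually independent\<close>
    and "prob_space.indep_vars M (\<lambda>_. borel)
           (\<lambda>i. case i of Inl v \<Rightarrow> f 0 v | Inr (e, k) \<Rightarrow> \<tau> e k)
           (range Inl \<union> Inr ` (edges adj \<times> UNIV))"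
    \<comment> \<open>f follows the edge-averaging dynamics driven by these clocks, almost surely\<close>
    and "AE \<omega> in M. edge_averaging adj \<tau> f \<omega>"
  shows "\<forall>v. AE \<omega> in M. ((\<lambda>t. f t v \<omega>) \<longlongrightarrow> \<mu>) at_top"
proof
  fix v
  interpret prob_space M by fact
  interpret clocked_opinions M adj \<tau> "f 0"
    by unfold_locales (fact assms(11,12))+
  obtain D :: nat where finN: "\<And>w. finite {u. adj w u}" and D: "\<And>w. card {u. adj w u} \<le> D"
    using assms(4) unfolding bounded_degree_def by blast
  have p: "2 < p" "0 < p" using assms(6) by auto
  obtain K where K: "0 \<le> K" and mom: "\<And>W g. finite W \<Longrightarrow>
      integrable M (\<lambda>\<omega>. \<bar>\<Sum>w\<in>W. g w * (f 0 w \<omega> - \<mu>)\<bar> powr p) \<and>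
      expectation (\<lambda>\<omega>. \<bar>\<Sum>w\<in>W. g w * (f 0 w \<omega> - \<mu>)\<bar> powr p) \<le> K * (\<Sum>w\<in>W. (g w)\<^sup>2) powr (p / 2)"
    using centered_moment[OF p(1) assms(8,9,10)] by blast
  \<comment> \<open>Then \<open>(1 - \<delta>) * p / 4 = p / 8 + 1 / 2\<close>, which exceeds 1
    precisely for \<open>p > 4\<close>.\<close>
  define \<delta> where "\<delta> = (1 - 4 / p) / 2"
  have \<delta>: "0 < \<delta>" "\<delta> < 1" using assms(6) by (auto simp: \<delta>_def field_simps)
  have \<delta>p: "1 < (1 - \<delta>) * p / 4" using assms(6) by (simp add: \<delta>_def field_simps)
  define s where "s n = (real n + 1) powr (- (1 - \<delta>) / 2)" for n :: nat
  have s: "0 < s n" "s n \<le> 1" for n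
  proof -
    show "0 < s n" by (simp add: s_def)
    have "(real n + 1) powr (- (1 - \<delta>) / 2) \<le> (real n + 1) powr 0"
      by (rule powr_mono) (use \<delta> in auto)
    also have "\<dots> = 1" by simp
    finally show "s n \<le> 1" unfolding s_def .
  qed
  have near: "AE \<omega> in M. \<exists>n0. \<forall>t\<ge>real n0. \<bar>f t v \<omega> - \<mu>\<bar> \<le> \<epsilon>" if \<epsilon>: "0 < \<epsilon>" for \<epsilon>
  proof -
    let ?b = "\<lambda>n. 2 / (real n + 1)\<^sup>2
      + exp (2 * real D) * (exp (- (real n + 1) * (s n)\<^sup>2 / 96) / s n + K * s n powr (p / 2) / \<epsilon> powr p)"
    define P where "P n U E \<longleftrightarrow> U \<in> sets M \<and> finite E \<and> E \<subseteq> edges adj \<and> prob U \<le> ?b n \<and>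
      (\<forall>\<omega> g t. \<omega> \<in> space M - U \<longrightarrow> edge_averaging adj \<tau> g \<omega> \<longrightarrow> (\<forall>w. g 0 w \<omega> = f 0 w \<omega>) \<longrightarrow>
        (\<forall>e\<in>E. \<forall>t. finite {i. ring_time \<tau> e i \<omega> \<le> t}) \<longrightarrow>
        real n \<le> t \<longrightarrow> t \<le> real n + 1 \<longrightarrow> \<bar>g t v \<omega> - \<mu>\<bar> \<le> \<epsilon>)" for n U E
    have "\<exists>U E. P n U E" for n
      unfolding P_def
      by (rule exceptional_event) (fact assms(2,3,5) finN D p(2) K s \<epsilon> | erule mom)+
    then obtain U E where UE: "\<And>n. P n (U n) (E n)" by metis
    have U: "U n \<in> sets M" "prob (U n) \<le> ?b n" and E: "finite (E n)" "E n \<subseteq> edges adj" for n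
      using UE[of n] unfolding P_def by blast+
    have path: "\<bar>f t v \<omega> - \<mu>\<bar> \<le> \<epsilon>"
      if "\<omega> \<in> space M - U n" "edge_averaging adj \<tau> f \<omega>"
        "\<forall>e\<in>E n. \<forall>t. finite {i. ring_time \<tau> e i \<omega> \<le> t}" "real n \<le> t" "t \<le> real n + 1" for n \<omega> t
      using UE[of n] that unfolding P_def by blast
    have "summable ?b" unfolding s_def by (rule summable_exceptional_bound[OF \<delta>(1) \<delta>p])
    hence "summable (\<lambda>n. prob (U n))"
    proof (rule summable_comparison_test'[where N = 0])
      show "norm (prob (U n)) \<le> ?b n" for n using U(2)[of n] by (simp only: real_norm_def abs_of_nonneg measure_nonneg)
    qed
    hence "AE \<omega> in M. eventually (\<lambda>n. \<omega> \<in> space M - U n) sequentially"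
      by (intro borel_cantelli_AE1 U(1)) (auto simp: emeasure_eq_measure)
    \<comment> \<open>The edge set varies with \<open>n\<close>, but each one is finite, so only
      countably many null sets are united.\<close>
    moreover have "AE \<omega> in M. \<forall>n. \<forall>e\<in>E n. \<forall>t. finite {i. ring_time \<tau> e i \<omega> \<le> t}"
      unfolding AE_all_countable
    proof
      fix n
      show "AE \<omega> in M. \<forall>e\<in>E n. \<forall>t. finite {i. ring_time \<tau> e i \<omega> \<le> t}"
        using E[of n] by (intro eventually_ball_finite ballI AE_ring_times_finite) auto
    qed
    ultimately show ?thesis using assms(13)
    proof eventually_elim
      case (elim \<omega>)
      then obtain n0 where n0: "\<And>n. n0 \<le> n \<Longrightarrow> \<omega> \<in> space M - U n"
        unfolding eventually_sequentially by blast
      have "\<bar>f t v \<omega> - \<mu>\<bar> \<le> \<epsilon>" if t: "real n0 \<le> t" for t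
      proof -
        have "0 \<le> t" using t by linarith
        define n where "n = nat \<lfloor>t\<rfloor>"
        have n: "real n \<le> t" "t \<le> real n + 1" "n0 \<le> n"
          using t \<open>0 \<le> t\<close> by (auto simp: n_def le_nat_floor)
        show ?thesis using path[OF n0[OF n(3)] elim(3) _ n(1,2)] elim(2) by blast
      qed
      thus ?case by blast
    qed
  qed
  \<comment> \<open>The null set in \<open>near\<close> depends on the tolerance, so the tolerance
    is restricted to a countable sequence tending to 0.\<close>
  have "AE \<omega> in M. \<forall>i::nat. \<exists>n0. \<forall>t\<ge>real n0. \<bar>f t v \<omega> - \<mu>\<bar> \<le> 1 / (real i + 1)"
    unfolding AE_all_countable by (intro allI near) simp
  thus "AE \<omega> in M. ((\<lambda>t. f t v \<omega>) \<longlongrightarrow> \<mu>) at_top"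
  proof eventually_elim
    case (elim \<omega>)
    show ?case
    proof (rule tendstoI)
      fix e :: real assume "0 < e"
      then obtain i :: nat where i: "1 / (real i + 1) < e"
        using reals_Archimedean[of e] by (auto simp: inverse_eq_divide add.commute)
      obtain n0 :: nat where "\<forall>t\<ge>real n0. \<bar>f t v \<omega> - \<mu>\<bar> \<le> 1 / (real i + 1)" using elim by blast
      hence "\<forall>t\<ge>real n0. dist (f t v \<omega>) \<mu> < e" using i by (auto simp: dist_real_def intro: le_less_trans)
      thus "\<forall>\<^sub>F t in at_top. dist (f t v \<omega>) \<mu> < e" unfolding eventually_at_top_linorder by blast
    qed
  qed
qed

end
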